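(* Let $I=(0,1)$ and let admissibility, $A_M$ and $\mathcal{F}$ be as defined in the context. Let $M\in L^2(I;\mathbb{R}^{2\times2}_{\mathrm{sym}})$ be such that $M_{11}\ne0$ on a set of positive measure and $A_M$ is admissible. Then there exist $\lambda_n\in C^\infty(\overline I)$ and $p_n\in C^\infty(\overline I;\mathbb{S}^1)$, $n\in\mathbb{N}$, such that, setting $M_n:=\lambda_n\,p_n\otimes p_n$, we have: (i) $p_n\cdot\underline e_1>0$ everywhere on $\overline I$, $p_n=\underline e_1$ near $\partial I$ (i.e. in a neighbourhood of $\{0,1\}$ in $\overline I$), and $A_{M_n}$ is admissible, for every $n$; (ii) $M_n\rightharpoonup M$ weakly in $L^2(I;\mathbb{R}^{2\times2}_{\mathrm{sym}})$; (iii) $\mathcal{F}(M_n)\to\mathcal{F}(M)$.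
   Context: $(e_1,e_2,e_3)$ and $(\underline e_1,\underline e_2)$ are the canonical bases of $\mathbb{R}^3$ and $\mathbb{R}^2$; $\mathbb{S}^1\subset\mathbb{R}^2$ is the unit circle. Let $\mathfrak{A}\subset\mathbb{R}^{3\times3}$ be the span of $e_1\otimes e_3-e_3\otimes e_1$ and $e_2\otimes e_3-e_3\otimes e_2$. For $A\in L^2(I;\mathfrak{A})$ let $r_A:I\to SO(3)$ be the solution of $r_A'=A\,r_A$ in $I$ with $r_A(0)=\mathrm{Id}$, and let $\Gamma_A:=\int_0^1r_A^T(t)e_1\,dt$. A map $A\in L^2(I;\mathfrak{A})$ is called nondegenerate if $\{A_{13}\ne0\}$ has positive measure. Fix a nondegenerate $A^{(0)}\in L^2(I;\mathfrak{A})$ and set $\bar r=r_{A^{(0)}}(1)$, $\bar\Gamma=\Gamma_{A^{(0)}}$. A map $A\in L^2(I;\mathfrak{A})$ is called admissible if $r_A(1)=\bar r$ and $\Gamma_A=\bar\Gamma$. For $M\in\mathbb{R}^{2\times2}_{\mathrm{sym}}$, $A_M\in\mathfrak{A}$ is defined by $(A_M)_{13}=M_{11}$, $(A_M)_{23}=M_{12}$ (applied pointwise for matrix fields). For $M\in L^2(I;\mathbb{R}^{2\times2}_{\mathrm{sym}})$, $\mathcal{F}(M):=\int_0^1(|M|^2+2|\det M|)\,dt$, with $|\cdot|$ the Frobenius norm. *)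

theory Defs
  imports "HOL-Analysis.Analysis"
begin

abbreviation I01 :: "real set" where
  "I01 \<equiv> {0<..<1}"

definition outer :: "real^'n \<Rightarrow> real^'m \<Rightarrow> real^'m^'n" (infixl "\<otimes>\<^sub>o" 75) where
  "a \<otimes>\<^sub>o b = (\<chi> i j. a $ i * b $ j)"

text \<open>
  \<open>L2 V\<close> is the space of representatives of elements of $L^2(I;V)$. Values on null sets and
  outside $I$ are irrelevant. The norm of the types \<open>real^'n^'m\<close> is the Frobenius norm, and \<open>inner\<close>
  is the corresponding inner product.
\<close>
definition L2 :: "'a::euclidean_space set \<Rightarrow> (real \<Rightarrow> 'a) set" where
  "L2 V = {f. f \<in> borel_measurable (lebesgue_on I01)
            \<and> integrable (lebesgue_on I01) (\<lambda>t. (norm (f t))\<^sup>2)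
            \<and> (AE t in lebesgue_on I01. f t \<in> V)}"

definition weakly_L2 ::
  "'a::euclidean_space set \<Rightarrow> (nat \<Rightarrow> real \<Rightarrow> 'a) \<Rightarrow> (real \<Rightarrow> 'a) \<Rightarrow> bool" where
  "weakly_L2 V F f \<longleftrightarrow> (\<forall>n. F n \<in> L2 V) \<and> f \<in> L2 V \<and>
     (\<forall>\<phi>\<in>L2 V. (\<lambda>n. LINT t|lebesgue_on I01. F n t \<bullet> \<phi> t)
                 \<longlonglongrightarrow> (LINT t|lebesgue_on I01. f t \<bullet> \<phi> t))"

text \<open>$C^\infty(\overline I)$: all derivatives exist on $[0,1]$, one-sided ones at the endpoints.\<close>
definition smooth_cl :: "(real \<Rightarrow> 'a::real_normed_vector) \<Rightarrow> bool" where
  "smooth_cl f \<longleftrightarrow> (\<exists>D :: nat \<Rightarrow> real \<Rightarrow> 'a.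
     (\<forall>t\<in>{0..1}. D 0 t = f t) \<and>
     (\<forall>k. \<forall>t\<in>{0..1}. (D k has_vector_derivative D (Suc k) t) (at t within {0..1})))"

definition Sym2 :: "(real^2^2) set" where
  "Sym2 = {M. transpose M = M}"

definition frakA :: "(real^3^3) set" where
  "frakA = span {axis 1 1 \<otimes>\<^sub>o axis 3 1 - axis 3 1 \<otimes>\<^sub>o axis 1 1,
                 axis 2 1 \<otimes>\<^sub>o axis 3 1 - axis 3 1 \<otimes>\<^sub>o axis 2 1}"

text \<open>
  For merely square integrable $A$, the initial value problem $r' = A r$, $r(0) = \mathrm{Id}$ is
  understood in the sense of Caratheodory: $r$ is absolutely continuous and the equation holds
  almost everywhere, i.e. $r$ is continuous and satisfies the integral equation below.
\<close>
definition is_frame :: "(real \<Rightarrow> real^3^3) \<Rightarrow> (real \<Rightarrow> real^3^3) \<Rightarrow> bool" where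
  "is_frame A r \<longleftrightarrow> continuous_on {0..1} r \<and>
     (\<forall>t\<in>{0..1}. rotation_matrix (r t)) \<and>
     (\<forall>t\<in>{0..1}. r t = mat 1 + (LINT s|lebesgue_on {0<..<t}. A s ** r s))"

text \<open>For \<open>A \<in> L2 frakA\<close> the solution exists and is unique on $[0,1]$; \<open>frame A\<close> is only
  used there.\<close>
definition frame :: "(real \<Rightarrow> real^3^3) \<Rightarrow> real \<Rightarrow> real^3^3" where
  "frame A = (SOME r. is_frame A r)"

definition Gam :: "(real \<Rightarrow> real^3^3) \<Rightarrow> real^3" where
  "Gam A = (LINT t|lebesgue_on I01. transpose (frame A t) *v axis 1 1)"

definition nondegenerate :: "(real \<Rightarrow> real^3^3) \<Rightarrow> bool" where
  "nondegenerate A \<longleftrightarrow> emeasure lebesgue {t\<in>I01. A t $ 1 $ 3 \<noteq> 0} > 0"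

definition admissible :: "(real \<Rightarrow> real^3^3) \<Rightarrow> (real \<Rightarrow> real^3^3) \<Rightarrow> bool" where
  "admissible A0 A \<longleftrightarrow> A \<in> L2 frakA \<and> frame A 1 = frame A0 1 \<and> Gam A = Gam A0"

definition A_of :: "real^2^2 \<Rightarrow> real^3^3" where
  "A_of M = (M $ 1 $ 1) *\<^sub>R (axis 1 1 \<otimes>\<^sub>o axis 3 1 - axis 3 1 \<otimes>\<^sub>o axis 1 1)
          + (M $ 1 $ 2) *\<^sub>R (axis 2 1 \<otimes>\<^sub>o axis 3 1 - axis 3 1 \<otimes>\<^sub>o axis 2 1)"

lemma A_of_char:
  "A_of M \<in> frakA" "A_of M $ 1 $ 3 = M $ 1 $ 1" "A_of M $ 2 $ 3 = M $ 1 $ 2"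
proof -
  show "A_of M \<in> frakA"
    unfolding A_of_def frakA_def
    by (intro span_add span_scale span_base) auto
qed (simp_all add: A_of_def outer_def axis_def)

definition calF :: "(real \<Rightarrow> real^2^2) \<Rightarrow> real" where
  "calF M = (LINT t|lebesgue_on I01. (norm (M t))\<^sup>2 + 2 * \<bar>det (M t)\<bar>)"

end

theory Submission
  imports Defs
begin

text \<open>
  Write a degenerate field as \<open>\<mu> (1, s) \<otimes> (1, s)\<close> with slope \<open>s\<close>. Fast oscillation between suitable
  multiples of the two spectral projections of \<open>M\<close>, followed by smoothing, gives smooth degenerate
  fields that converge weakly to \<open>M\<close> and whose energies converge to that of \<open>M\<close>, but their endpoint
  data \<open>(r(1), \<Gamma>)\<close> are only approximately right. These data are repaired by the substitution
  \<open>\<mu> \<mapsto> (1 + \<phi>) \<mu>\<close>, \<open>s \<mapsto> s + \<psi>\<close>. It acts linearly on the field, hence makes sense for \<open>M\<close> itself and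
  is compatible with weak limits. Since \<open>M\<^sub>1\<^sub>1 \<noteq> 0\<close> on a set of positive measure, the derivative of the
  endpoint data of \<open>M\<close> with respect to \<open>(\<phi>, \<psi>)\<close> is onto a six-dimensional space. On bounded sets of
  \<open>L\<^sup>2\<close> the frame depends continuously on the primitive of the field, so the endpoint data of the
  approximating fields converge uniformly in finitely many parameters, and Brouwer's theorem provides
  small parameters for which they are exact.
\<close>

subsection \<open>Primitives of integrable functions\<close>

text \<open>Normalising (1, s) builds in the sign condition on the direction, and slope 0 near the
  ends gives the direction e1 there; the price is that the projection onto e2 is reached only in the
  limit of infinite slope. Weak closeness is used in the form of an L2 bound together with a
  uniformly small primitive. This form survives integration by parts, so it passes to frames and
  through multiplication by smooth functions; closeness in norm is out of reach because M need not
  be degenerate. The energies do not drop in the limit because both dyads used for a matrix have the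
  norm whose square is the energy density of that matrix, whatever their volume fractions. The
  constraint on r(1) lives on a curved manifold. It is replaced by the vanishing of the axial vector
  of the transposed target rotation times r(1), which is linear in the matrix r(1) and decides
  equality for rotations close to the target. The radius of the parameter ball depends only on M and
  the tolerance and is fixed before the approximating field, so that Brouwer's theorem is applied to
  a small perturbation of a fixed map.\<close>

definition primitive :: "(real \<Rightarrow> 'a::euclidean_space) \<Rightarrow> (real \<Rightarrow> 'a) \<Rightarrow> bool" where
  "primitive f F \<longleftrightarrow> f absolutely_integrable_on {0..1} \<and>
     (\<forall>t\<in>{0..1}. F t = F 0 + integral {0..t} f)"

lemma primitive_ai: "primitive f F \<Longrightarrow> f absolutely_integrable_on {0..1}"
  unfolding primitive_def by blast

lemma primitive_value: "primitive f F \<Longrightarrow> 0 \<le> t \<Longrightarrow> t \<le> 1 \<Longrightarrow> F t = F 0 + integral {0..t} f"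
  by (metis primitive_def atLeastAtMost_iff)

lemma ai_subinterval:
  fixes f :: "real \<Rightarrow> 'a::euclidean_space"
  assumes "f absolutely_integrable_on {0..1}" "0 \<le> a" "b \<le> 1"
  shows "f absolutely_integrable_on {a..b}"
  using absolutely_integrable_on_subinterval[OF assms(1), of a b] assms by auto

lemma ai_integrable_sub:
  fixes f :: "real \<Rightarrow> 'a::euclidean_space"
  assumes "f absolutely_integrable_on {0..1}" "0 \<le> a" "b \<le> 1"
  shows "f integrable_on {a..b}"
  using ai_subinterval[OF assms] absolutely_integrable_on_def by blast

lemma primitive_increment:
  assumes "primitive f F" "0 \<le> a" "a \<le> b" "b \<le> 1"
  shows "F b - F a = integral {a..b} f"
proof -
  have ai: "f absolutely_integrable_on {0..1}" using assms by (blast intro: primitive_ai)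
  have "integral {0..a} f + integral {a..b} f = integral {0..b} f"
    using assms by (intro Henstock_Kurzweil_Integration.integral_combine ai_integrable_sub[OF ai]) auto
  moreover have "F a = F 0 + integral {0..a} f" "F b = F 0 + integral {0..b} f"
    using assms by (auto intro!: primitive_value)
  ultimately show ?thesis by (simp add: algebra_simps)
qed

lemma primitive_continuous:
  assumes "primitive f F" shows "continuous_on {0..1} F"
proof -
  have ai: "f absolutely_integrable_on {0..1}" using assms by (blast intro: primitive_ai)
  have "continuous_on {0..1} (\<lambda>t. F 0 + integral {0..t} f)"
    by (intro continuous_intros indefinite_integral_continuous_1 ai_integrable_sub[OF ai]) auto
  then show ?thesis
    by (rule continuous_on_eq) (use assms in \<open>auto intro: primitive_value[symmetric]\<close>)
qed

lemma primitive_integral: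
  fixes f :: "real \<Rightarrow> 'a::euclidean_space"
  assumes "f absolutely_integrable_on {0..1}"
  shows "primitive f (\<lambda>t. integral {0..t} f)"
  using assms by (simp add: primitive_def)

lemma primitive_const: "primitive (\<lambda>_. 0) (\<lambda>_. c)"
  by (simp add: primitive_def)

lemma primitive_add:
  assumes "primitive f F" "primitive g G"
  shows "primitive (\<lambda>t. f t + g t) (\<lambda>t. F t + G t)"
  unfolding primitive_def
proof (intro conjI ballI)
  show "(\<lambda>t. f t + g t) absolutely_integrable_on {0..1}"
    using assms by (auto dest!: primitive_ai intro: set_integral_add(1))
  fix t :: real assume t: "t \<in> {0..1}"
  have "integral {0..t} (\<lambda>t. f t + g t) = integral {0..t} f + integral {0..t} g"
    using assms t by (intro Henstock_Kurzweil_Integration.integral_add ai_integrable_sub) (auto dest!: primitive_ai)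
  moreover have "F t = F 0 + integral {0..t} f" "G t = G 0 + integral {0..t} g"
    using assms t by (auto intro: primitive_value)
  ultimately show "F t + G t = F 0 + G 0 + integral {0..t} (\<lambda>t. f t + g t)" by simp
qed

lemma primitive_linear:
  assumes "primitive f F" "bounded_linear h"
  shows "primitive (\<lambda>t. h (f t)) (\<lambda>t. h (F t))"
  unfolding primitive_def
proof (intro conjI ballI)
  show "(\<lambda>t. h (f t)) absolutely_integrable_on {0..1}"
    using absolutely_integrable_linear[OF primitive_ai[OF assms(1)] assms(2)] by (simp add: o_def)
  fix t :: real assume t: "t \<in> {0..1}"
  have "integral {0..t} (h \<circ> f) = h (integral {0..t} f)"
    using assms t by (intro integral_linear ai_integrable_sub) (auto dest!: primitive_ai)
  moreover have "F t = F 0 + integral {0..t} f"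
    using assms t by (auto intro: primitive_value)
  ultimately show "h (F t) = h (F 0) + integral {0..t} (\<lambda>t. h (f t))"
    by (simp add: o_def bounded_linear.linear[OF assms(2)] linear_add)
qed

lemma primitive_diff:
  assumes "primitive f F" "primitive g G"
  shows "primitive (\<lambda>t. f t - g t) (\<lambda>t. F t - G t)"
  using primitive_add[OF assms(1) primitive_linear[OF assms(2) bounded_linear_minus[OF bounded_linear_ident]]]
  by simp

lemma primitive_cong:
  assumes "primitive f F" "\<And>t. t \<in> {0..1} \<Longrightarrow> f t = g t" "\<And>t. t \<in> {0..1} \<Longrightarrow> F t = G t"
  shows "primitive g G"
  unfolding primitive_def
proof (intro conjI ballI)
  show "g absolutely_integrable_on {0..1}"
    using absolutely_integrable_spike[OF primitive_ai[OF assms(1)], of "{}" g] assms(2) by auto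
  fix t :: real assume t: "t \<in> {0..1}"
  have "integral {0..t} f = integral {0..t} g"
    using assms t by (intro Henstock_Kurzweil_Integration.integral_cong) auto
  then show "G t = G 0 + integral {0..t} g"
    using primitive_value[OF assms(1), of t] assms(3)[of t] assms(3)[of 0] t by auto
qed

lemma primitive_of_derivative:
  assumes "\<And>t. t \<in> {0..1} \<Longrightarrow> (F has_vector_derivative f t) (at t within {0..1})"
    and "continuous_on {0..1} f"
  shows "primitive f F"
  unfolding primitive_def
proof (intro conjI ballI)
  show "f absolutely_integrable_on {0..1}"
    by (intro absolutely_integrable_continuous_real assms)
  fix t :: real assume t: "t \<in> {0..1}"
  have "(F has_vector_derivative f x) (at x within {0..t})" if "x \<in> {0..t}" for x
    using assms(1)[of x] that t by (auto intro: has_vector_derivative_within_subset)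
  then have "(f has_integral (F t - F 0)) {0..t}"
    using t by (intro fundamental_theorem_of_calculus) auto
  then show "F t = F 0 + integral {0..t} f" by (simp add: integral_unique)
qed

lemma ai_bilinear:
  fixes f :: "real \<Rightarrow> 'a::euclidean_space" and G :: "real \<Rightarrow> 'b::euclidean_space"
    and h :: "'a \<Rightarrow> 'b \<Rightarrow> 'c::euclidean_space"
  assumes "bounded_bilinear h" "f absolutely_integrable_on {0..1}" "continuous_on {0..1} G"
  shows "(\<lambda>t. h (f t) (G t)) absolutely_integrable_on {0..1}"
proof -
  show ?thesis
  proof (rule absolutely_integrable_bounded_measurable_product[where h = "\<lambda>x y. h y x"])
    show "bilinear (\<lambda>x y. h y x)"
      using bounded_bilinear.flip[OF assms(1)] by (simp add: bilinear_conv_bounded_bilinear)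
    show "G \<in> borel_measurable (lebesgue_on {0..1})"
      using assms(3) by (intro continuous_imp_measurable_on_sets_lebesgue) auto
    show "bounded (G ` {0..1})"
      by (intro compact_imp_bounded compact_continuous_image assms) auto
  qed (use assms in auto)
qed

lemma norm_integral_le:
  fixes f :: "real \<Rightarrow> 'a::euclidean_space"
  assumes "f absolutely_integrable_on {a..b}" "g integrable_on {a..b}"
    "\<And>t. t \<in> {a..b} \<Longrightarrow> norm (f t) \<le> g t"
  shows "norm (integral {a..b} f) \<le> integral {a..b} g"
  using assms by (intro integral_norm_bound_integral) (auto simp: absolutely_integrable_on_def)

text \<open>For the primitive \<open>K\<close> of the defect, an increment over \<open>[a, b]\<close> is a product of two
  increments and hence small compared with the increment of \<open>\<integral>(|f| + |g|)\<close>.\<close>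
lemma primitive_bilinear:
  fixes f F :: "real \<Rightarrow> 'a::euclidean_space" and g G :: "real \<Rightarrow> 'b::euclidean_space"
    and h :: "'a \<Rightarrow> 'b \<Rightarrow> 'c::euclidean_space"
  assumes h: "bounded_bilinear h" and F: "primitive f F" and G: "primitive g G"
  shows "primitive (\<lambda>t. h (f t) (G t) + h (F t) (g t)) (\<lambda>t. h (F t) (G t))"
proof -
  interpret h: bounded_bilinear h by (rule h)
  obtain C where C: "C > 0" "\<And>x y. norm (h x y) \<le> norm x * norm y * C"
    using h.pos_bounded by blast
  note f = primitive_ai[OF F] and g = primitive_ai[OF G]
  note contF = primitive_continuous[OF F] and contG = primitive_continuous[OF G]
  have nf: "(\<lambda>t. norm (f t)) absolutely_integrable_on {0..1}" and ng: "(\<lambda>t. norm (g t)) absolutely_integrable_on {0..1}"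
    using f g by (auto intro: absolutely_integrable_norm[unfolded o_def])
  define k where "k = (\<lambda>t. h (f t) (G t) + h (F t) (g t))"
  have fG: "(\<lambda>t. h (f t) (G t)) absolutely_integrable_on {0..1}"
    by (rule ai_bilinear[OF h f contG])
  have Fg: "(\<lambda>t. h (F t) (g t)) absolutely_integrable_on {0..1}"
    by (rule ai_bilinear[OF h.flip g contF])
  have k: "k absolutely_integrable_on {0..1}"
    unfolding k_def using fG Fg by (rule set_integral_add(1))
  define K where "K = (\<lambda>t. h (F t) (G t) - integral {0..t} k)"
  define m where "m = (\<lambda>t. integral {0..t} (\<lambda>t. norm (f t) + norm (g t)))"
  have mp: "primitive (\<lambda>t. norm (f t) + norm (g t)) m"
    unfolding m_def by (intro primitive_integral set_integral_add(1) nf ng)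
  have uc: "uniformly_continuous_on {0..1} F" "uniformly_continuous_on {0..1} G"
    by (intro compact_uniformly_continuous contF contG; simp)+
  have key: "norm (K b - K a) \<le> C * e * (m b - m a)"
    if e: "e > 0" and ab: "0 \<le> a" "a \<le> b" "b \<le> 1" and
      small: "\<And>s. s \<in> {a..b} \<Longrightarrow> norm (F a - F s) \<le> e \<and> norm (G b - G s) \<le> e" for a b e
  proof -
    have sub: "(\<lambda>t. h (f t) (G b)) absolutely_integrable_on {a..b}"
      "(\<lambda>t. h (F a) (g t)) absolutely_integrable_on {a..b}"
      "(\<lambda>t. h (f t) (G t)) absolutely_integrable_on {a..b}"
      "(\<lambda>t. h (F t) (g t)) absolutely_integrable_on {a..b}"
      by (rule ai_subinterval[OF _ ab(1,3)], rule ai_bilinear[OF h f] ai_bilinear[OF h.flip g] fG Fg,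
          (rule continuous_on_const)?)+
    have i1: "integral {a..b} (\<lambda>t. h (f t) (G b)) = h (F b - F a) (G b)"
      using integral_linear[OF ai_integrable_sub[OF f ab(1,3)] h.bounded_linear_left[of "G b"]]
        primitive_increment[OF F ab] by (simp add: o_def)
    have i2: "integral {a..b} (\<lambda>t. h (F a) (g t)) = h (F a) (G b - G a)"
      using integral_linear[OF ai_integrable_sub[OF g ab(1,3)] h.bounded_linear_right[of "F a"]]
        primitive_increment[OF G ab] by (simp add: o_def)
    have i3: "integral {0..b} k - integral {0..a} k = integral {a..b} k"
      using primitive_increment[OF primitive_integral[OF k] ab] by simp
    have ii: "(\<lambda>t. h (f t) (G b)) integrable_on {a..b}" "(\<lambda>t. h (F a) (g t)) integrable_on {a..b}"
      "(\<lambda>t. h (f t) (G t)) integrable_on {a..b}" "(\<lambda>t. h (F t) (g t)) integrable_on {a..b}"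
      using sub absolutely_integrable_on_def by blast+
    \<comment> \<open>The increment of \<open>h (F t) (G t)\<close> is split with \<open>G\<close>
      frozen at \<open>b\<close> and \<open>F\<close> frozen at \<open>a\<close>; what remains of
      the defect is an integral with a small factor in each term.\<close>
    have e1: "integral {a..b} (\<lambda>t. h (f t) (G b - G t) + h (F a - F t) (g t))
        = (h (F b - F a) (G b) - integral {a..b} (\<lambda>t. h (f t) (G t)))
          + (h (F a) (G b - G a) - integral {a..b} (\<lambda>t. h (F t) (g t)))"
      unfolding i1[symmetric] i2[symmetric] h.diff_right[of "f _"] h.diff_left[of "F a" "F _"]
      by (subst Henstock_Kurzweil_Integration.integral_add integrable_diff ii
          | subst Henstock_Kurzweil_Integration.integral_diff | simp add: ii integrable_diff)+
    have e2: "integral {a..b} k = integral {a..b} (\<lambda>t. h (f t) (G t)) + integral {a..b} (\<lambda>t. h (F t) (g t))"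
      unfolding k_def by (rule Henstock_Kurzweil_Integration.integral_add[OF ii(3,4)])
    have "K b - K a = h (F b) (G b) - h (F a) (G a) - integral {a..b} k"
      using i3 by (simp add: K_def algebra_simps)
    also have "\<dots> = integral {a..b} (\<lambda>t. h (f t) (G b - G t) + h (F a - F t) (g t))"
      unfolding e1 e2 by (simp add: h.diff_left h.diff_right)
    finally have Kd: "K b - K a = integral {a..b} (\<lambda>t. h (f t) (G b - G t) + h (F a - F t) (g t))" .
    have "norm (K b - K a) \<le> integral {a..b} (\<lambda>t. C * e * (norm (f t) + norm (g t)))"
      unfolding Kd
    proof (rule norm_integral_le)
      show "(\<lambda>t. h (f t) (G b - G t) + h (F a - F t) (g t)) absolutely_integrable_on {a..b}"
        unfolding h.diff_left h.diff_right
        using sub by (intro set_integral_add(1) set_integral_diff(1))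
      show "(\<lambda>t. C * e * (norm (f t) + norm (g t))) integrable_on {a..b}"
        using integrable_cmul[OF ai_integrable_sub[OF primitive_ai[OF mp] ab(1,3)], of "C * e"] by simp
      fix t assume t: "t \<in> {a..b}"
      have "norm (h (f t) (G b - G t)) \<le> norm (f t) * norm (G b - G t) * C" by (rule C)
      also have "\<dots> \<le> norm (f t) * e * C"
        using small[OF t] C(1) by (intro mult_right_mono mult_left_mono) auto
      finally have 1: "norm (h (f t) (G b - G t)) \<le> C * e * norm (f t)" by (simp add: mult_ac)
      have "norm (h (F a - F t) (g t)) \<le> norm (F a - F t) * norm (g t) * C" by (rule C)
      also have "\<dots> \<le> e * norm (g t) * C"
        using small[OF t] C(1) by (intro mult_right_mono) auto
      finally have 2: "norm (h (F a - F t) (g t)) \<le> C * e * norm (g t)" by (simp add: mult_ac)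
      show "norm (h (f t) (G b - G t) + h (F a - F t) (g t)) \<le> C * e * (norm (f t) + norm (g t))"
        using norm_triangle_ineq[of "h (f t) (G b - G t)" "h (F a - F t) (g t)"] 1 2 by (simp add: algebra_simps)
    qed
    also have "\<dots> = C * e * (m b - m a)"
      using primitive_increment[OF mp ab] by simp
    finally show ?thesis .
  qed
  have Kt: "norm (K t - K 0) \<le> C * e * (m t - m 0)" if t: "t \<in> {0..1}" and e: "e > 0" for t e
  proof -
    obtain d1 where d1: "d1 > 0" "\<And>s s'. s \<in> {0..1} \<Longrightarrow> s' \<in> {0..1} \<Longrightarrow> dist s s' < d1 \<Longrightarrow> dist (F s) (F s') < e"
      using uc(1) e unfolding uniformly_continuous_on_def by metis
    obtain d2 where d2: "d2 > 0" "\<And>s s'. s \<in> {0..1} \<Longrightarrow> s' \<in> {0..1} \<Longrightarrow> dist s s' < d2 \<Longrightarrow> dist (G s) (G s') < e"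
      using uc(2) e unfolding uniformly_continuous_on_def by metis
    have "0 \<le> t" using t by simp
    define P where "P = (\<lambda>a b. 0 \<le> a \<and> b \<le> 1 \<and> a \<le> b \<longrightarrow> norm (K b - K a) \<le> C * e * (m b - m a))"
    have "P 0 t"
    \<comment> \<open>The estimate adds up over adjacent intervals and holds on intervals short
      enough for uniform continuity, so bisection gives it on all of \<open>{0..t}\<close>.\<close>
    proof (rule Bolzano[OF \<open>0 \<le> t\<close>])
      fix a b c assume trans: "P a b" "P b c" "a \<le> b" "b \<le> c"
      show "P a c"
        unfolding P_def
      proof
        assume "0 \<le> a \<and> c \<le> 1 \<and> a \<le> c"
        then have "norm (K b - K a) \<le> C * e * (m b - m a)" "norm (K c - K b) \<le> C * e * (m c - m b)"
          using trans by (auto simp: P_def)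
        moreover have "norm (K c - K a) \<le> norm (K c - K b) + norm (K b - K a)"
          using norm_triangle_ineq[of "K c - K b" "K b - K a"] by simp
        ultimately show "norm (K c - K a) \<le> C * e * (m c - m a)" by (simp add: algebra_simps)
      qed
    next
      fix x
      show "\<exists>d>0. \<forall>a b. a \<le> x \<and> x \<le> b \<and> b - a < d \<longrightarrow> P a b"
        unfolding P_def
      proof (intro exI[of _ "min d1 d2"] conjI allI impI)
        fix a b assume A: "a \<le> x \<and> x \<le> b \<and> b - a < min d1 d2" "0 \<le> a \<and> b \<le> 1 \<and> a \<le> b"
        show "norm (K b - K a) \<le> C * e * (m b - m a)"
        proof (rule key)
          fix s assume s: "s \<in> {a..b}"
          have "dist (F a) (F s) < e" "dist (G b) (G s) < e"
            using A s by (auto intro!: d1(2) d2(2) simp: dist_real_def)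
          then show "norm (F a - F s) \<le> e \<and> norm (G b - G s) \<le> e" by (simp add: dist_norm)
        qed (use A e in auto)
      qed (use d1 d2 in auto)
    qed
    then show ?thesis using t by (auto simp: P_def)
  qed
  show ?thesis
    unfolding primitive_def k_def[symmetric]
  proof (intro conjI ballI)
    show "k absolutely_integrable_on {0..1}" by (rule k)
    fix t :: real assume t: "t \<in> {0..1}"
    have mt: "0 \<le> m t - m 0"
      using t unfolding m_def by (simp add: integral_nonneg ai_integrable_sub[OF primitive_ai[OF mp]])
    have "norm (K t - K 0) \<le> 0"
    proof (rule field_le_epsilon)
      fix e :: real assume e: "e > 0"
      define d where "d = e / (C * (m t - m 0) + 1)"
      have p: "C * (m t - m 0) + 1 > 0" using C(1) mt by (smt (verit) mult_nonneg_nonneg)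
      have "d > 0" using e p by (simp add: d_def)
      from Kt[OF t this] have "norm (K t - K 0) \<le> d * (C * (m t - m 0))" by (simp add: mult_ac)
      also have "\<dots> \<le> d * (C * (m t - m 0) + 1)" using \<open>d > 0\<close> by (intro mult_left_mono) auto
      also have "\<dots> = e" using p by (simp add: d_def)
      finally show "norm (K t - K 0) \<le> 0 + e" by simp
    qed
    then have "K t = K 0" by simp
    then show "h (F t) (G t) = h (F 0) (G 0) + integral {0..t} k"
      by (simp add: K_def algebra_simps)
  qed
qed

section \<open>Zero sets of absolutely continuous functions\<close>

lemma countable_right_isolated:
  fixes Z :: "real set"
  shows "countable {t\<in>Z. \<exists>d>0. Z \<inter> {t<..<t+d} = {}}" (is "countable ?R")
proof -
  have "\<forall>t\<in>?R. \<exists>d>0. Z \<inter> {t<..<t+d} = {}" by auto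
  then obtain d where d: "\<And>t. t \<in> ?R \<Longrightarrow> d t > 0 \<and> Z \<inter> {t<..<t + d t} = {}"
    by (elim bchoice[THEN exE]) blast
  \<comment> \<open>The gap after a point contains no point of \<open>Z\<close>, so the gaps after
    two different points of \<open>Z\<close> cannot overlap, and the line holds only countably many
    disjoint nonempty open intervals.\<close>
  have disj: "{s<..<s + d s} \<inter> {t<..<t + d t} = {}" if "s \<in> ?R" "t \<in> ?R" "s < t" for s t
  proof -
    have "t \<notin> {s<..<s + d s}" using d[OF that(1)] that(2) by blast
    then have "s + d s \<le> t" using that(3) by auto
    then show ?thesis by auto
  qed
  have inj: "inj_on (\<lambda>t. {t<..<t + d t}) ?R"
  proof (rule inj_onI)
    fix s t assume st: "s \<in> ?R" "t \<in> ?R" "{s<..<s + d s} = {t<..<t + d t}"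
    have "{s<..<s + d s} \<noteq> {}" using d[OF st(1)] by simp
    then have "{s<..<s + d s} \<inter> {t<..<t + d t} \<noteq> {}" using st(3) by simp
    then show "s = t" using disj[OF st(1,2)] disj[OF st(2,1)]
      unfolding Int_commute[of "{t<..<t + d t}"] by (meson linorder_neqE_linordered_idom)
  qed
  have "countable ((\<lambda>t. {t<..<t + d t}) ` ?R)"
  proof (rule countable_disjoint_open_subsets)
    show "disjoint ((\<lambda>t. {t<..<t + d t}) ` ?R)"
    proof (rule pairwiseI, unfold disjnt_def)
      fix A B assume "A \<in> (\<lambda>t. {t<..<t + d t}) ` ?R" "B \<in> (\<lambda>t. {t<..<t + d t}) ` ?R" "A \<noteq> B"
      then obtain s t where st: "s \<in> ?R" "t \<in> ?R" "A = {s<..<s + d s}" "B = {t<..<t + d t}" by blast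
      have "s \<noteq> t" using \<open>A \<noteq> B\<close> st by blast
      then consider "s < t" | "t < s" by linarith
      then show "A \<inter> B = {}"
        using disj[OF st(1,2)] disj[OF st(2,1)] unfolding st(3,4) Int_commute[of "{t<..<t + d t}"] by cases auto
    qed
  qed auto
  then show ?thesis using countable_image_inj_on inj by blast
qed

text \<open>By Lebesgue differentiation \<open>f t\<close> is, for almost every \<open>t\<close>,
  the limit of averages of \<open>f\<close> over intervals to the right of \<open>t\<close>. If
  zeros of \<open>F\<close> accumulate at \<open>t\<close> from the right, the averages up to these
  zeros vanish and so does \<open>f t\<close>. The remaining zeros are isolated from the right,
  hence countable.\<close>

lemma primitive_zero_set:
  fixes f F :: "real \<Rightarrow> real"
  assumes "primitive f F"
  shows "negligible {t\<in>{0..1}. F t = 0 \<and> f t \<noteq> 0}"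
proof -
  define g where "g = (\<lambda>t. if t \<in> {0..1} then f t else 0)"
  note ai = primitive_ai[OF assms]
  have "f integrable_on {0..1}" using ai absolutely_integrable_on_def by blast
  then have "g integrable_on UNIV" unfolding g_def by (subst integrable_restrict_UNIV)
  then have "\<And>a b. g integrable_on cbox a b" using integrable_on_subcbox by blast
  then obtain N where N: "negligible N" "\<And>x e. \<lbrakk>x \<notin> N; 0 < e\<rbrakk> \<Longrightarrow>
      \<exists>d>0. \<forall>h. 0 < h \<and> h < d \<longrightarrow> norm (integral (cbox x (x + h *\<^sub>R One)) g /\<^sub>R h ^ DIM(real) - g x) < e"
    using integrable_ccontinuous_explicit[of g] by blast
  define Z where "Z = {t\<in>{0..1}. F t = 0}"
  define R where "R = {t\<in>Z. \<exists>d>0. Z \<inter> {t<..<t+d} = {}}"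
  have "{t\<in>{0..1}. F t = 0 \<and> f t \<noteq> 0} \<subseteq> N \<union> (R \<union> {1})"
  proof (rule subsetI, rule ccontr)
    fix t assume t: "t \<in> {t\<in>{0..1}. F t = 0 \<and> f t \<noteq> 0}" and n: "t \<notin> N \<union> (R \<union> {1})"
    have "\<bar>f t\<bar> > 0" using t by simp
    \<comment> \<open>The tolerance \<open>\<bar>f t\<bar>\<close> is exactly what excludes a
      vanishing average.\<close>
    then obtain d where d: "d > 0" "\<And>h. 0 < h \<Longrightarrow> h < d \<Longrightarrow> \<bar>integral {t..t+h} g / h - f t\<bar> < \<bar>f t\<bar>"
      using N(2)[of t "\<bar>f t\<bar>"] n t by (auto simp: g_def divide_inverse mult.commute)
    have "t \<in> Z" using t by (simp add: Z_def)
    then have "Z \<inter> {t<..<t+d} \<noteq> {}" using n d(1) unfolding R_def by blast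
    then obtain z where z: "z \<in> Z" "t < z" "z < t + d" by auto
    have "integral {t..z} g = integral {t..z} f"
      using z t by (intro Henstock_Kurzweil_Integration.integral_cong) (auto simp: g_def Z_def)
    also have "\<dots> = 0"
      using primitive_increment[OF assms, of t z] z t by (auto simp: Z_def)
    finally show False using d(2)[of "z - t"] z by auto
  qed
  moreover have "negligible (N \<union> (R \<union> {1}))"
    using N(1) countable_right_isolated[of Z]
    by (intro negligible_Un) (auto simp: R_def negligible_iff_null_sets intro: countable_imp_null_set_lborel null_sets_completionI)
  ultimately show ?thesis using negligible_subset by blast
qed

text \<open>Young's inequality with weights adapted to the endpoint \<open>t\<close>: the integrand
  is at most exp(2Kt) / (4K) a(s)^2 + K exp(-2Kt) exp(4Ks), and each of the two terms integrates to
  at most exp(2Kt) / 4.\<close>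

lemma exp_kernel_bound:
  fixes a :: "real \<Rightarrow> real"
  assumes a: "a absolutely_integrable_on {0..1}" and a2: "(\<lambda>t. (a t)\<^sup>2) absolutely_integrable_on {0..1}"
    and K: "K > 0" "integral {0..1} (\<lambda>t. (a t)\<^sup>2) \<le> K" and t: "0 \<le> t" "t \<le> 1"
  shows "integral {0..t} (\<lambda>s. a s * exp (2 * K * s)) \<le> exp (2 * K * t) / 2"
proof -
  have i0: "(\<lambda>s. a s * exp (2 * K * s)) integrable_on {0..t}"
    by (intro ai_integrable_sub ai_bilinear[OF bounded_bilinear_mult a] continuous_intros) (use t in auto)
  have i1: "(\<lambda>s. exp (2*K*t) / (4*K) * (a s)\<^sup>2) integrable_on {0..t}"
    using integrable_cmul[OF ai_integrable_sub[OF a2, of 0 t], of "exp (2*K*t) / (4*K)"] t by simp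
  have h: "((\<lambda>s. K * exp (- (2*K*t)) * exp (4*K * s)) has_integral exp (- (2*K*t)) * exp (4*K*t) / 4 - exp (- (2*K*t)) * exp (4*K*0) / 4) {0..t}"
    using K t by (intro fundamental_theorem_of_calculus)
      (auto intro!: derivative_eq_intros simp: has_real_derivative_iff_has_vector_derivative[symmetric])
  have "integral {0..t} (\<lambda>s. a s * exp (2 * K * s))
      \<le> integral {0..t} (\<lambda>s. exp (2*K*t) / (4*K) * (a s)\<^sup>2 + K * exp (- (2*K*t)) * exp (4*K * s))"
  proof (rule integral_le[OF i0])
    show "(\<lambda>s. exp (2*K*t) / (4*K) * (a s)\<^sup>2 + K * exp (- (2*K*t)) * exp (4*K * s)) integrable_on {0..t}"
      using i1 h by (intro integrable_add) auto
    fix s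
    define E where "E = exp (K * t)" 
    define G where "G = exp (2 * K * s)"
    have E: "E > 0" "exp (2*K*t) = E\<^sup>2" "exp (- (2*K*t)) = 1 / E\<^sup>2" "exp (4*K * s) = G\<^sup>2"
      by (auto simp: E_def G_def exp_double exp_minus field_simps simp flip: exp_add exp_of_nat_mult)
    have "0 \<le> (E * a s / (2 * sqrt K) - sqrt K * G / E)\<^sup>2" by simp
    also have "\<dots> = E\<^sup>2 / (4*K) * (a s)\<^sup>2 + K * (1 / E\<^sup>2) * G\<^sup>2 - a s * G"
      using E(1) K(1) by (simp add: power2_diff power_mult_distrib power_divide field_simps real_sqrt_pow2) (simp add: power2_eq_square)
    finally show "a s * exp (2 * K * s) \<le> exp (2*K*t) / (4*K) * (a s)\<^sup>2 + K * exp (- (2*K*t)) * exp (4*K * s)"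
      unfolding E G_def[symmetric] by simp
  qed
  also have "\<dots> = exp (2*K*t) / (4*K) * integral {0..t} (\<lambda>s. (a s)\<^sup>2) + integral {0..t} (\<lambda>s. K * exp (- (2*K*t)) * exp (4*K * s))"
    using i1 h by (subst Henstock_Kurzweil_Integration.integral_add) auto
  also have "integral {0..t} (\<lambda>s. K * exp (- (2*K*t)) * exp (4*K * s)) \<le> exp (2*K*t) / 4"
  proof -
    have "exp (- (2*K*t)) * exp (4*K*t) = exp (2*K*t)" by (simp flip: exp_add)
    then show ?thesis using integral_unique[OF h] by simp
  qed
  also have "exp (2*K*t) / (4*K) * integral {0..t} (\<lambda>s. (a s)\<^sup>2) \<le> exp (2*K*t) / (4*K) * K"
  proof (rule mult_left_mono)
    have "integral {0..t} (\<lambda>s. (a s)\<^sup>2) \<le> integral {0..1} (\<lambda>s. (a s)\<^sup>2)"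
      using t by (intro integral_subset_le ai_integrable_sub[OF a2]) auto
    then show "integral {0..t} (\<lambda>s. (a s)\<^sup>2) \<le> K" using K by simp
  qed (use K in auto)
  finally show ?thesis using K by simp
qed

text \<open>The weight \<open>exp (2 K t)\<close> makes \<open>w \<mapsto> \<integral> a w\<close> a contraction with factor \<open>1/2\<close>.\<close>
lemma gronwall_L2:
  fixes a w :: "real \<Rightarrow> real"
  assumes a: "a absolutely_integrable_on {0..1}" "(\<lambda>t. (a t)\<^sup>2) absolutely_integrable_on {0..1}"
    and a0: "\<And>t. t \<in> {0..1} \<Longrightarrow> a t \<ge> 0"
    and K: "K > 0" "integral {0..1} (\<lambda>t. (a t)\<^sup>2) \<le> K"
    and w: "continuous_on {0..1} w" "\<And>t. t \<in> {0..1} \<Longrightarrow> w t \<ge> 0"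
      "\<And>t. t \<in> {0..1} \<Longrightarrow> w t \<le> \<alpha> + integral {0..t} (\<lambda>s. a s * w s)"
    and t: "t \<in> {0..1}"
  shows "w t \<le> 2 * \<alpha> * exp (2 * K)"
proof -
  have "continuous_on {0..1} (\<lambda>t. w t * exp (- 2 * K * t))"
    by (intro continuous_intros w)
  \<comment> \<open>At a maximum point of the weighted function the integral term is at most half of
    the left-hand side and is absorbed; this produces the factor 2 in the bound.\<close>
  then obtain t0 where t0: "t0 \<in> {0..1}" "\<And>t. t \<in> {0..1} \<Longrightarrow> w t * exp (- 2 * K * t) \<le> w t0 * exp (- 2 * K * t0)"
    using continuous_attains_sup[of "{0..1::real}" "\<lambda>t. w t * exp (- 2 * K * t)"] by auto
  define m where "m = w t0 * exp (- 2 * K * t0)"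
  have m: "m \<ge> 0" using w(2)[OF t0(1)] by (simp add: m_def)
  have wm: "w t \<le> m * exp (2 * K * t)" if "t \<in> {0..1}" for t
    using mult_right_mono[OF t0(2)[OF that], of "exp (2 * K * t)"]
    by (simp add: m_def mult.assoc flip: exp_add)
  have wt0: "w t0 = m * exp (2 * K * t0)" by (simp add: m_def flip: exp_add mult.assoc)
  have "w t0 \<le> \<alpha> + integral {0..t0} (\<lambda>s. a s * w s)" by (rule w(3)[OF t0(1)])
  also have "integral {0..t0} (\<lambda>s. a s * w s) \<le> integral {0..t0} (\<lambda>s. m * (a s * exp (2 * K * s)))"
  proof (rule integral_le)
    show "(\<lambda>s. a s * w s) integrable_on {0..t0}"
      by (intro ai_integrable_sub ai_bilinear[OF bounded_bilinear_mult a(1)] w) (use t0 in auto)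
    have "(\<lambda>s. a s * (m * exp (2 * K * s))) integrable_on {0..t0}"
      by (intro ai_integrable_sub ai_bilinear[OF bounded_bilinear_mult a(1)] continuous_intros) (use t0 in auto)
    then show "(\<lambda>s. m * (a s * exp (2 * K * s))) integrable_on {0..t0}" by (simp add: mult_ac)
    fix s assume "s \<in> {0..t0}"
    then have s: "s \<in> {0..1}" using t0 by auto
    show "a s * w s \<le> m * (a s * exp (2 * K * s))"
      using mult_left_mono[OF wm[OF s] a0[OF s]] by (simp add: mult_ac)
  qed
  also have "\<dots> = m * integral {0..t0} (\<lambda>s. a s * exp (2 * K * s))" by simp
  also have "\<dots> \<le> m * (exp (2 * K * t0) / 2)"
    using t0 by (intro mult_left_mono exp_kernel_bound a K m) auto
  finally have "m * exp (2 * K * t0) \<le> 2 * \<alpha>" unfolding wt0 by simp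
  moreover have "m \<le> m * exp (2 * K * t0)" using m K t0 by (simp add: mult_le_cancel_left1)
  ultimately have "m \<le> 2 * \<alpha>" by simp
  then have "m * exp (2 * K * t) \<le> 2 * \<alpha> * exp (2 * K)"
    using m K t by (intro mult_mono) auto
  then show ?thesis using wm[OF t] by simp
qed

lemma norm_matrix_mult_le:
  fixes A B :: "real^'n^'n"
  shows "norm (A ** B) \<le> norm A * norm B"
proof (rule power2_le_imp_le)
  have n: "(norm M)\<^sup>2 = (\<Sum>i\<in>UNIV. \<Sum>j\<in>UNIV. (M $ i $ j)\<^sup>2)" for M :: "real^'n^'n"
    by (simp only: power2_norm_eq_inner inner_vec_def) (simp add: power2_eq_square)
  have "(norm (A ** B))\<^sup>2 = (\<Sum>i\<in>UNIV. \<Sum>j\<in>UNIV. (\<Sum>k\<in>UNIV. A $ i $ k * B $ k $ j)\<^sup>2)"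
    by (simp add: n matrix_matrix_mult_def)
  also have "\<dots> \<le> (\<Sum>i\<in>UNIV. \<Sum>j\<in>UNIV. (\<Sum>k\<in>UNIV. (A $ i $ k)\<^sup>2) * (\<Sum>k\<in>UNIV. (B $ k $ j)\<^sup>2))"
    by (intro sum_mono Cauchy_Schwarz_ineq_sum)
  also have "\<dots> = (\<Sum>i\<in>UNIV. \<Sum>k\<in>UNIV. (A $ i $ k)\<^sup>2) * (\<Sum>j\<in>UNIV. \<Sum>k\<in>UNIV. (B $ k $ j)\<^sup>2)"
    by (simp add: sum_product)
  also have "(\<Sum>j\<in>UNIV. \<Sum>k\<in>UNIV. (B $ k $ j)\<^sup>2) = (norm B)\<^sup>2"
    unfolding n by (rule sum.swap)
  finally show "(norm (A ** B))\<^sup>2 \<le> (norm A * norm B)\<^sup>2" by (simp add: n power_mult_distrib)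
qed simp

lemma bounded_bilinear_matrix_mult:
  "bounded_bilinear ((**) :: real^'n^'n \<Rightarrow> real^'n^'n \<Rightarrow> real^'n^'n)"
  unfolding bilinear_conv_bounded_bilinear[symmetric] bilinear_def
  by (auto intro!: linearI simp: matrix_matrix_mult_def vec_eq_iff sum.distrib sum_distrib_left algebra_simps)

subsection \<open>Square-integrable functions\<close>

text \<open>Square integrability on the closed interval in terms of the gauge integral, where the
  calculus of primitives is available; \<open>L2_iff\<close> translates to the open
  interval.\<close>

definition sqint :: "(real \<Rightarrow> 'a::euclidean_space) \<Rightarrow> bool" where
  "sqint f \<longleftrightarrow> f \<in> borel_measurable (lebesgue_on {0..1})
     \<and> (\<lambda>t. (norm (f t))\<^sup>2) absolutely_integrable_on {0..1}"

lemma ai_bounded_by: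
  fixes f :: "real \<Rightarrow> 'a::euclidean_space"
  assumes "f \<in> borel_measurable (lebesgue_on {0..1})" "g absolutely_integrable_on {0..1}"
    "\<And>t. t \<in> {0..1} \<Longrightarrow> norm (f t) \<le> g t"
  shows "f absolutely_integrable_on {0..1}"
  using assms by (intro measurable_bounded_by_integrable_imp_absolutely_integrable[of f "{0..1}" g])
     (auto simp: absolutely_integrable_on_def)

lemma sqint_ai:
  assumes "sqint f" shows "f absolutely_integrable_on {0..1}"
proof (rule ai_bounded_by)
  show "(\<lambda>t. 1 + (norm (f t))\<^sup>2) absolutely_integrable_on {0..1}"
    using assms by (intro set_integral_add(1)) (auto simp: sqint_def)
  show "norm (f t) \<le> 1 + (norm (f t))\<^sup>2" for t
  proof -
    have "0 \<le> (norm (f t) - 1/2)\<^sup>2" by simp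
    then show ?thesis by (simp add: power2_eq_square algebra_simps)
  qed
qed (use assms in \<open>auto simp: sqint_def\<close>)

lemma sqint_norm_ai:
  assumes "sqint f" shows "(\<lambda>t. norm (f t)) absolutely_integrable_on {0..1}"
  using absolutely_integrable_norm[OF sqint_ai[OF assms]] by (simp add: o_def)

lemma sqint_bound:
  assumes "sqint g" "f \<in> borel_measurable (lebesgue_on {0..1})"
    "\<And>t. t \<in> {0..1} \<Longrightarrow> norm (f t) \<le> c * norm (g t)"
  shows "sqint f"
  unfolding sqint_def
proof
  show "(\<lambda>t. (norm (f t))\<^sup>2) absolutely_integrable_on {0..1}"
  proof (rule ai_bounded_by)
    show "(\<lambda>t. (norm (f t))\<^sup>2) \<in> borel_measurable (lebesgue_on {0..1})"
      using assms(2) by measurable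
    show "(\<lambda>t. c\<^sup>2 * (norm (g t))\<^sup>2) absolutely_integrable_on {0..1}"
      using assms(1) by (auto simp: sqint_def)
    show "norm ((norm (f t))\<^sup>2) \<le> c\<^sup>2 * (norm (g t))\<^sup>2" if "t \<in> {0..1}" for t
      using power_mono[OF assms(3)[OF that], of 2] by (simp add: power_mult_distrib)
  qed
qed (rule assms)

lemma borel_measurable_01:
  fixes f :: "real \<Rightarrow> 'a::euclidean_space"
  shows "f \<in> borel_measurable (lebesgue_on {0<..<1}) \<longleftrightarrow> f \<in> borel_measurable (lebesgue_on {0..1})"
proof -
  have neg: "negligible ({0<..<1} - {0..1} \<union> ({0..1} - {0<..<1::real}))"
    by (rule negligible_subset[of "{0,1}"]) auto
  have "f measurable_on {0<..<1} \<longleftrightarrow> f measurable_on {0..1}"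
    using measurable_on_spike_set[OF _ neg, of f] measurable_on_spike_set[of f "{0..1}" "{0<..<1}"] neg
    by (auto simp: Un_commute)
  then show ?thesis by (simp add: measurable_on_iff_borel_measurable)
qed

lemma ai_01:
  fixes f :: "real \<Rightarrow> 'a::euclidean_space"
  shows "integrable (lebesgue_on {0<..<1}) f \<longleftrightarrow> f absolutely_integrable_on {0..1}"
  using absolutely_integrable_on_open_interval[where f = f and a = 0 and b = 1]
  by (simp add: integrable_restrict_space set_integrable_def)

lemma LINT_01:
  fixes f :: "real \<Rightarrow> 'a::euclidean_space"
  assumes "f absolutely_integrable_on {0..1}" "0 \<le> t" "t \<le> 1"
  shows "(LINT s|lebesgue_on {0<..<t}. f s) = integral {0..t} f"
proof -
  have "f absolutely_integrable_on {0<..<t}"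
    using ai_subinterval[OF assms(1), of 0 t] assms absolutely_integrable_on_open_interval[where f = f and a = 0 and b = t] by simp
  then have "integrable (lebesgue_on {0<..<t}) f"
    by (simp add: absolutely_integrable_imp_integrable)
  then show ?thesis
    by (simp add: lebesgue_integral_eq_integral integral_open_interval_real)
qed

lemma L2_iff: "f \<in> L2 V \<longleftrightarrow> sqint f \<and> (AE t in lebesgue_on I01. f t \<in> V)"
  by (auto simp: L2_def sqint_def borel_measurable_01 ai_01)

lemma sqint_add:
  assumes "sqint f" "sqint g" shows "sqint (\<lambda>t. f t + g t)"
  unfolding sqint_def
proof
  show m: "(\<lambda>t. f t + g t) \<in> borel_measurable (lebesgue_on {0..1})"
    using assms by (auto simp: sqint_def)
  show "(\<lambda>t. (norm (f t + g t))\<^sup>2) absolutely_integrable_on {0..1}"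
  proof (rule ai_bounded_by)
    show "(\<lambda>t. 2 * (norm (f t))\<^sup>2 + 2 * (norm (g t))\<^sup>2) absolutely_integrable_on {0..1}"
      using assms by (intro set_integral_add(1)) (auto simp: sqint_def)
    show "(\<lambda>t. (norm (f t + g t))\<^sup>2) \<in> borel_measurable (lebesgue_on {0..1})" using m by measurable
    fix t
    have "(norm (f t + g t))\<^sup>2 \<le> (norm (f t) + norm (g t))\<^sup>2"
      by (intro power_mono norm_triangle_ineq) auto
    also have "\<dots> \<le> 2 * (norm (f t))\<^sup>2 + 2 * (norm (g t))\<^sup>2"
      using zero_le_power2[of "norm (f t) - norm (g t)"] by (simp add: power2_sum power2_diff)
    finally show "norm ((norm (f t + g t))\<^sup>2) \<le> 2 * (norm (f t))\<^sup>2 + 2 * (norm (g t))\<^sup>2" by simp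
  qed
qed

lemma sqint_linear:
  assumes "sqint f" "bounded_linear h" shows "sqint (\<lambda>t. h (f t))"
proof -
  obtain c where c: "\<And>x. norm (h x) \<le> norm x * c" using bounded_linear.bounded[OF assms(2)] by blast
  have "(\<lambda>t. h (f t)) \<in> borel_measurable (lebesgue_on {0..1})"
    using borel_measurable_continuous_on[OF linear_continuous_on[OF assms(2)]] assms(1)
    unfolding sqint_def by blast
  then show ?thesis
  proof (rule sqint_bound[OF assms(1)])
    show "norm (h (f t)) \<le> c * norm (f t)" for t using c[of "f t"] by (simp only: mult.commute)
  qed
qed

lemma sqint_diff:
  assumes "sqint f" "sqint g" shows "sqint (\<lambda>t. f t - g t)"
  using sqint_add[OF assms(1) sqint_linear[OF assms(2) bounded_linear_minus[OF bounded_linear_ident]]] by simp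

lemma sqint_continuous:
  fixes f :: "real \<Rightarrow> 'a::euclidean_space"
  assumes "continuous_on {0..1} f" shows "sqint f"
  unfolding sqint_def
  by (intro conjI continuous_imp_measurable_on_sets_lebesgue absolutely_integrable_continuous_real continuous_intros assms) simp

lemma sqint_scaleR:
  assumes "continuous_on {0..1} \<eta>" "sqint f" shows "sqint (\<lambda>t. \<eta> t *\<^sub>R f t)"
proof -
  obtain c where c: "\<And>t. t \<in> {0..1} \<Longrightarrow> norm (\<eta> t) \<le> c"
    using compact_imp_bounded[OF compact_continuous_image[OF assms(1)]] by (force simp: bounded_iff)
  have "\<eta> \<in> borel_measurable (lebesgue_on {0..1})"
    by (rule continuous_imp_measurable_on_sets_lebesgue[OF assms(1)]) simp
  moreover have "f \<in> borel_measurable (lebesgue_on {0..1})" using assms(2) by (simp add: sqint_def)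
  ultimately have "(\<lambda>t. \<eta> t *\<^sub>R f t) \<in> borel_measurable (lebesgue_on {0..1})" by measurable
  then show ?thesis
  proof (rule sqint_bound[OF assms(2)])
    show "norm (\<eta> t *\<^sub>R f t) \<le> c * norm (f t)" if "t \<in> {0..1}" for t
      using mult_right_mono[OF c[OF that], of "norm (f t)"] by simp
  qed
qed

subsection \<open>The frame equation\<close>

text \<open>The frame equation as a plain linear equation, without asking for rotations. For skew
  fields the rotation property follows in \<open>sol_rotation\<close>, and
  \<open>is_frame_iff\<close> connects the two notions.\<close>

definition solves :: "(real \<Rightarrow> real^3^3) \<Rightarrow> (real \<Rightarrow> real^3^3) \<Rightarrow> bool" where
  "solves A r \<longleftrightarrow> primitive (\<lambda>t. A t ** r t) r \<and> r 0 = mat 1"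

lemma solves_continuous: "solves A r \<Longrightarrow> continuous_on {0..1} r"
  using primitive_continuous by (auto simp: solves_def)

lemmas matrix_mult_diff_right = bounded_bilinear.diff_right[OF bounded_bilinear_matrix_mult]
lemmas matrix_mult_diff_left = bounded_bilinear.diff_left[OF bounded_bilinear_matrix_mult]
lemmas matrix_mult_minus_right = bounded_bilinear.minus_right[OF bounded_bilinear_matrix_mult]
lemmas matrix_mult_minus_left = bounded_bilinear.minus_left[OF bounded_bilinear_matrix_mult]

lemma ai_matrix_mult:
  fixes A y :: "real \<Rightarrow> real^3^3"
  assumes "sqint A" "continuous_on {0..1} y"
  shows "(\<lambda>t. A t ** y t) absolutely_integrable_on {0..1}"
  by (rule ai_bilinear[OF bounded_bilinear_matrix_mult sqint_ai[OF assms(1)] assms(2)])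

text \<open>Picard iteration written as a series. In the norm weighted by exp(2Kt) each term is at
  most half of its predecessor, so the series converges on all of [0,1] without subdividing the
  interval.\<close>

lemma sol_exists:
  assumes A: "sqint A"
  shows "\<exists>r. solves A r"
proof -
  \<comment> \<open>The summand 1 keeps \<open>K\<close> positive for the zero field as well, since
    the weight argument divides by \<open>K\<close>.\<close>
  define K where "K = integral {0..1} (\<lambda>t. (norm (A t))\<^sup>2) + 1"
  have a: "(\<lambda>t. norm (A t)) absolutely_integrable_on {0..1}"
    "(\<lambda>t. (norm (A t))\<^sup>2) absolutely_integrable_on {0..1}"
    using A sqint_norm_ai[OF A] by (auto simp: sqint_def)
  have "integral {0..1} (\<lambda>t. (norm (A t))\<^sup>2) \<ge> 0" by (rule integral_nonneg[OF ai_integrable_sub[OF a(2)]]) auto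
  then have K: "K > 0" "integral {0..1} (\<lambda>t. (norm (A t))\<^sup>2) \<le> K" by (auto simp: K_def)
  define c where "c = norm (mat 1 :: real^3^3)"
  define w where "w = rec_nat (\<lambda>t. mat 1 :: real^3^3) (\<lambda>k v t. integral {0..t} (\<lambda>s. A s ** v s))"
  have w0: "w 0 = (\<lambda>t. mat 1)" and wS: "w (Suc k) = (\<lambda>t. integral {0..t} (\<lambda>s. A s ** w k s))" for k
    by (simp_all add: w_def)
  have wk: "continuous_on {0..1} (w k) \<and> (\<forall>t\<in>{0..1}. norm (w k t) \<le> c / 2^k * exp (2 * K * t))" for k
  proof (induction k)
    case 0
    have "c \<ge> 0" by (simp add: c_def)
    then show ?case using K(1) by (auto simp: w0 c_def mult_le_cancel_left1)
  next
    case (Suc k)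
    have ai: "(\<lambda>s. A s ** w k s) absolutely_integrable_on {0..1}"
      using ai_matrix_mult[OF A] Suc by blast
    have "norm (integral {0..t} (\<lambda>s. A s ** w k s)) \<le> c / 2 ^ Suc k * exp (2 * K * t)" if t: "t \<in> {0..1}" for t
    proof -
      have "norm (integral {0..t} (\<lambda>s. A s ** w k s)) \<le> integral {0..t} (\<lambda>s. c / 2^k * (norm (A s) * exp (2 * K * s)))"
      proof (rule norm_integral_le)
        show "(\<lambda>s. A s ** w k s) absolutely_integrable_on {0..t}"
          using t by (intro ai_subinterval[OF ai]) auto
        have "(\<lambda>s. norm (A s) * exp (2 * K * s)) absolutely_integrable_on {0..1}"
          by (intro ai_bilinear[OF bounded_bilinear_mult a(1)] continuous_intros)
        from integrable_cmul[OF ai_integrable_sub[OF this, of 0 t], of "c/2^k"] t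
        show "(\<lambda>s. c / 2^k * (norm (A s) * exp (2 * K * s))) integrable_on {0..t}" by simp
        fix s assume "s \<in> {0..t}"
        then have "norm (w k s) \<le> c / 2^k * exp (2 * K * s)" using Suc t by auto
        from mult_left_mono[OF this norm_ge_zero[of "A s"]] norm_matrix_mult_le[of "A s" "w k s"]
        show "norm (A s ** w k s) \<le> c / 2^k * (norm (A s) * exp (2 * K * s))" by (simp add: mult_ac)
      qed
      also have "\<dots> = c / 2^k * integral {0..t} (\<lambda>s. norm (A s) * exp (2 * K * s))" by simp
      also have "\<dots> \<le> c / 2^k * (exp (2 * K * t) / 2)"
        using t by (intro mult_left_mono exp_kernel_bound a K) (auto simp: c_def)
      finally show ?thesis by simp
    qed
    then show ?case
      unfolding wS using primitive_continuous[OF primitive_integral[OF ai]] by blast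
  qed
  define m where "m = (\<lambda>k. c * exp (2 * K) * (1/2)^k)"
  have wm: "norm (w k t) \<le> m k" if "t \<in> {0..1}" for k t
  proof -
    have "norm (w k t) \<le> c / 2^k * exp (2 * K * t)" using wk that by blast
    also have "\<dots> \<le> c / 2^k * exp (2 * K)" using that K(1) by (intro mult_left_mono) (auto simp: c_def)
    finally show ?thesis by (simp add: m_def power_one_over field_simps)
  qed
  have ms: "summable m" unfolding m_def by (intro summable_mult summable_geometric) simp
  define S where "S = (\<lambda>n t. \<Sum>k<n. w k t)"
  define r where "r = (\<lambda>t. \<Sum>k. w k t)"
  have ul: "uniform_limit {0..1} S r sequentially"
    unfolding S_def r_def by (rule Weierstrass_m_test[OF wm ms])
  have contS: "continuous_on {0..1} (S n)" for n
    unfolding S_def using wk by (intro continuous_on_sum) blast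
  have contr: "continuous_on {0..1} r"
    by (rule uniform_limit_theorem[OF _ ul]) (use contS in auto)
  have Sb: "norm (S n t) \<le> suminf m" if "t \<in> {0..1}" for n t
  proof -
    have "norm (S n t) \<le> (\<Sum>k<n. m k)" unfolding S_def by (rule sum_norm_le) (use wm that in blast)
    also have "\<dots> \<le> suminf m" by (rule sum_le_suminf[OF ms]) (auto simp: m_def c_def)
    finally show ?thesis .
  qed
  have Srec: "S (Suc n) t = mat 1 + integral {0..t} (\<lambda>s. A s ** S n s)" if t: "t \<in> {0..1}" for n t
  proof (induction n)
    case 0 show ?case by (simp add: S_def w0 matrix_matrix_mult_def zero_vec_def[symmetric])
  next
    case (Suc n)
    have i: "(\<lambda>s. A s ** S n s) integrable_on {0..t}" "(\<lambda>s. A s ** w n s) integrable_on {0..t}"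
      using ai_integrable_sub[OF ai_matrix_mult[OF A contS]] ai_integrable_sub[OF ai_matrix_mult[OF A conjunct1[OF wk]]] t by auto
    have "integral {0..t} (\<lambda>s. A s ** S (Suc n) s) = integral {0..t} (\<lambda>s. A s ** S n s + A s ** w n s)"
      by (simp add: S_def matrix_add_ldistrib)
    also have "\<dots> = integral {0..t} (\<lambda>s. A s ** S n s) + w (Suc n) t"
      unfolding wS by (rule Henstock_Kurzweil_Integration.integral_add[OF i])
    finally show ?case using Suc by (simp add: S_def)
  qed
  have rt: "r t = mat 1 + integral {0..t} (\<lambda>s. A s ** r s)" if t: "t \<in> {0..1}" for t
  proof -
    have lim: "(\<lambda>n. S n s) \<longlonglongrightarrow> r s" if "s \<in> {0..1}" for s
      by (rule tendsto_uniform_limitI[OF ul that])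
    have "(\<lambda>n. integral {0..t} (\<lambda>s. A s ** S n s)) \<longlonglongrightarrow> integral {0..t} (\<lambda>s. A s ** r s)"
    proof (rule dominated_convergence(2))
      show "(\<lambda>s. A s ** S n s) integrable_on {0..t}" for n
        using ai_integrable_sub[OF ai_matrix_mult[OF A contS]] t by auto
      show "(\<lambda>s. norm (A s) * suminf m) integrable_on {0..t}"
        using integrable_cmul[OF ai_integrable_sub[OF a(1), of 0 t], of "suminf m"] t by (simp add: mult.commute)
      fix s assume s: "s \<in> {0..t}"
      then have s1: "s \<in> {0..1}" using t by auto
      show "norm (A s ** S n s) \<le> norm (A s) * suminf m" for n
        using mult_left_mono[OF Sb[OF s1, of n] norm_ge_zero[of "A s"]] norm_matrix_mult_le[of "A s" "S n s"] by linarith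
      show "(\<lambda>n. A s ** S n s) \<longlonglongrightarrow> A s ** r s"
        by (intro bounded_bilinear.tendsto[OF bounded_bilinear_matrix_mult] tendsto_const lim s1)
    qed
    then have "(\<lambda>n. S (Suc n) t) \<longlonglongrightarrow> mat 1 + integral {0..t} (\<lambda>s. A s ** r s)"
      unfolding Srec[OF t] by (intro tendsto_add tendsto_const)
    then show ?thesis using LIMSEQ_Suc[OF lim[OF t]] LIMSEQ_unique by blast
  qed
  have "r 0 = mat 1" using rt[of 0] by simp
  then have "solves A r"
    unfolding solves_def primitive_def using ai_matrix_mult[OF A contr] rt by simp
  then show ?thesis by blast
qed

text \<open>The hypothesis concerns the residual of the integral equation, not a derivative: the
  differences estimated below satisfy such an equation only after an integration by parts, up to a
  uniformly small error.\<close>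

lemma gronwall_matrix:
  fixes A y :: "real \<Rightarrow> real^3^3"
  assumes A: "sqint A" "integral {0..1} (\<lambda>t. (norm (A t))\<^sup>2) \<le> K" "K > 0"
    and y: "continuous_on {0..1} y"
      "\<And>t. t \<in> {0..1} \<Longrightarrow> norm (y t - integral {0..t} (\<lambda>s. A s ** y s)) \<le> \<alpha>"
    and t: "t \<in> {0..1}"
  shows "norm (y t) \<le> 2 * \<alpha> * exp (2 * K)"
proof (rule gronwall_L2[where a = "\<lambda>t. norm (A t)" and w = "\<lambda>t. norm (y t)"])
  show a: "(\<lambda>t. norm (A t)) absolutely_integrable_on {0..1}" by (rule sqint_norm_ai[OF A(1)])
  show "(\<lambda>t. (norm (A t))\<^sup>2) absolutely_integrable_on {0..1}" using A(1) by (simp add: sqint_def)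
  show "continuous_on {0..1} (\<lambda>t. norm (y t))" by (intro continuous_intros y)
  fix t :: real assume t: "t \<in> {0..1}"
  have "norm (integral {0..t} (\<lambda>s. A s ** y s)) \<le> integral {0..t} (\<lambda>s. norm (A s) * norm (y s))"
  proof (rule norm_integral_le)
    show "(\<lambda>s. A s ** y s) absolutely_integrable_on {0..t}"
      using t by (intro ai_subinterval[OF ai_matrix_mult[OF A(1) y(1)]]) auto
    show "(\<lambda>s. norm (A s) * norm (y s)) integrable_on {0..t}"
      using t by (intro ai_integrable_sub[OF ai_bilinear[OF bounded_bilinear_mult a]] continuous_intros y) auto
  qed (rule norm_matrix_mult_le)
  then show "norm (y t) \<le> \<alpha> + integral {0..t} (\<lambda>s. norm (A s) * norm (y s))"
    using y(2)[OF t] norm_triangle_ineq[of "y t - integral {0..t} (\<lambda>s. A s ** y s)" "integral {0..t} (\<lambda>s. A s ** y s)"] by simp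
qed (use A t in auto)

lemma bounded_linear_transpose: "bounded_linear (transpose :: real^3^3 \<Rightarrow> real^3^3)"
  unfolding linear_conv_bounded_linear[symmetric]
  by (rule linearI) (simp_all add: transpose_def vec_eq_iff)

text \<open>Skewness makes the derivative of \<open>transpose (r t) ** r t\<close> vanish, so this
  product stays the identity. The determinant is then continuous with values 1 and -1 and starts at
  1.\<close>

lemma sol_rotation:
  assumes r: "solves A r" and skew: "\<And>t. t \<in> {0..1} \<Longrightarrow> transpose (A t) = - A t" and t: "t \<in> {0..1}"
  shows "rotation_matrix (r t)"
proof -
  have p: "primitive (\<lambda>t. A t ** r t) r" and r0: "r 0 = mat 1" using r by (auto simp: solves_def)
  have orth: "transpose (r t) ** r t = mat 1" if t: "t \<in> {0..1}" for t
  proof -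
    have "primitive (\<lambda>t. transpose (A t ** r t) ** r t + transpose (r t) ** (A t ** r t)) (\<lambda>t. transpose (r t) ** r t)"
      by (rule primitive_bilinear[OF bounded_bilinear_matrix_mult primitive_linear[OF p bounded_linear_transpose] p])
    then have "primitive (\<lambda>t. 0) (\<lambda>t. transpose (r t) ** r t)"
    proof (rule primitive_cong)
      fix t :: real assume "t \<in> {0..1}"
      have "transpose (A t ** r t) ** r t = transpose (r t) ** (- A t) ** r t"
        by (simp add: matrix_transpose_mul skew[OF \<open>t \<in> {0..1}\<close>])
      also have "\<dots> = - (transpose (r t) ** (A t ** r t))"
        by (simp add: matrix_mul_assoc matrix_mult_minus_right matrix_mult_minus_left)
      finally show "transpose (A t ** r t) ** r t + transpose (r t) ** (A t ** r t) = 0" by simp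
    qed auto
    from primitive_value[OF this, of t] t show ?thesis by (simp add: r0 transpose_mat)
  qed
  then have om: "orthogonal_matrix (r t)" if "t \<in> {0..1}" for t
    using that by (simp add: orthogonal_matrix)
  have "continuous_on {0..1} (\<lambda>t. det (r t))"
    unfolding det_3 by (intro continuous_intros solves_continuous[OF r])
  then have "connected ((\<lambda>t. det (r t)) ` {0..1})" by (intro connected_continuous_image) auto
  moreover have "1 \<in> (\<lambda>t. det (r t)) ` {0..1}" using r0 by (auto intro!: image_eqI[of _ _ 0])
  moreover have "det (r t) = 1 \<or> det (r t) = -1" using det_orthogonal_matrix[OF om[OF t]] .
  moreover have "0 \<notin> (\<lambda>t. det (r t)) ` {0..1}" using det_orthogonal_matrix[OF om] by force
  moreover have "det (r t) \<in> (\<lambda>t. det (r t)) ` {0..1}" using t by blast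
  ultimately have "det (r t) = 1"
    using connectedD_interval[of "(\<lambda>t. det (r t)) ` {0..1}" "-1" 1 0] by auto
  then show ?thesis using om[OF t] by (simp add: rotation_matrix_def)
qed

lemma is_frame_iff:
  assumes A: "sqint A" and skew: "\<And>t. t \<in> {0..1} \<Longrightarrow> transpose (A t) = - A t"
  shows "is_frame A r \<longleftrightarrow> solves A r"
proof
  assume r: "is_frame A r"
  then have ai: "(\<lambda>t. A t ** r t) absolutely_integrable_on {0..1}"
    by (intro ai_matrix_mult[OF A]) (simp add: is_frame_def)
  have e: "r t = mat 1 + integral {0..t} (\<lambda>s. A s ** r s)" if "t \<in> {0..1}" for t
    using r that LINT_01[OF ai, of t] by (auto simp: is_frame_def)
  have "r 0 = mat 1" using e[of 0] by simp
  then show "solves A r" using ai e by (simp add: solves_def primitive_def)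
next
  assume r: "solves A r"
  then have "r t = mat 1 + (LINT s|lebesgue_on {0<..<t}. A s ** r s)" if "t \<in> {0..1}" for t
    using that primitive_value[of "\<lambda>t. A t ** r t" r t] LINT_01[OF ai_matrix_mult[OF A solves_continuous[OF r]], of t]
    by (simp add: solves_def)
  then show "is_frame A r"
    using solves_continuous[OF r] sol_rotation[OF r skew] by (simp add: is_frame_def)
qed

lemma frame_solves:
  assumes A: "sqint A" and skew: "\<And>t. t \<in> {0..1} \<Longrightarrow> transpose (A t) = - A t"
  shows "solves A (frame A)"
  using sol_exists[OF A] is_frame_iff[OF A skew] someI_ex[of "is_frame A"] by (auto simp: frame_def)

text \<open>The Frobenius norm of a rotation is the square root of 3; the rounded value 2 enters the
  later constants.\<close>

lemma norm_rotation:
  fixes Q :: "real^3^3"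
  assumes "rotation_matrix Q" shows "norm Q \<le> 2"
proof -
  have "transpose Q ** Q = mat 1" using assms by (simp add: rotation_matrix_def orthogonal_matrix)
  then have "(\<Sum>i\<in>UNIV. (transpose Q ** Q) $ i $ i) = 3" by (simp add: mat_def)
  moreover have "(norm Q)\<^sup>2 = (\<Sum>i\<in>UNIV. (transpose Q ** Q) $ i $ i)"
    by (simp only: power2_norm_eq_inner inner_vec_def)
       (simp add: matrix_matrix_mult_def transpose_def sum_3 algebra_simps)
  ultimately have "(norm Q)\<^sup>2 \<le> 2\<^sup>2" by simp
  then show ?thesis by (rule power2_le_imp_le) simp
qed

lemma integral_norm_le:
  assumes "sqint B" "integral {0..1} (\<lambda>t. (norm (B t))\<^sup>2) \<le> K"
  shows "integral {0..1} (\<lambda>t. norm (B t)) \<le> 1 + K"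
proof -
  have "integral {0..1} (\<lambda>t. norm (B t)) \<le> integral {0..1} (\<lambda>t. 1 + (norm (B t))\<^sup>2)"
  proof (rule integral_le)
    show "(\<lambda>t. norm (B t)) integrable_on {0..1}"
      using sqint_norm_ai[OF assms(1)] by (simp add: absolutely_integrable_on_def)
    show "(\<lambda>t. 1 + (norm (B t))\<^sup>2) integrable_on {0..1}"
      using assms(1) by (intro integrable_add) (auto simp: sqint_def absolutely_integrable_on_def)
    show "norm (B t) \<le> 1 + (norm (B t))\<^sup>2" for t
      using zero_le_power2[of "norm (B t) - 1/2"] by (simp add: power2_eq_square algebra_simps)
  qed
  also have "\<dots> = 1 + integral {0..1} (\<lambda>t. (norm (B t))\<^sup>2)"
    using assms(1) by (subst Henstock_Kurzweil_Integration.integral_add) (auto simp: sqint_def absolutely_integrable_on_def)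
  finally show ?thesis using assms(2) by simp
qed

text \<open>Integrating by parts in \<open>\<integral> (A - B) r'\<close>, only the primitive of \<open>A - B\<close> enters. This is what
  makes the frame continuous with respect to weak convergence.\<close>
lemma sol_stability:
  assumes A: "sqint A" "integral {0..1} (\<lambda>t. (norm (A t))\<^sup>2) \<le> K"
    and B: "sqint B" "integral {0..1} (\<lambda>t. (norm (B t))\<^sup>2) \<le> K" and K: "K > 0"
    and r: "solves A r" "solves B r'" and rot: "\<And>t. t \<in> {0..1} \<Longrightarrow> norm (r' t) \<le> 2"
    and d: "\<And>t. t \<in> {0..1} \<Longrightarrow> norm (integral {0..t} (\<lambda>s. A s - B s)) \<le> \<delta>"
    and t: "t \<in> {0..1}"
  shows "norm (r t - r' t) \<le> 2 * ((4 + 2 * K) * \<delta>) * exp (2 * K)"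
proof -
  define D where "D = (\<lambda>t. integral {0..t} (\<lambda>s. A s - B s))"
  have d0: "\<delta> \<ge> 0" using d[of 0] by simp
  have pD: "primitive (\<lambda>s. A s - B s) D"
    unfolding D_def by (rule primitive_integral[OF sqint_ai[OF sqint_diff[OF A(1) B(1)]]])
  have pr: "primitive (\<lambda>t. A t ** r t) r" "primitive (\<lambda>t. B t ** r' t) r'" using r by (auto simp: solves_def)
  have pDr: "primitive (\<lambda>t. (A t - B t) ** r' t + D t ** (B t ** r' t)) (\<lambda>t. D t ** r' t)"
    by (rule primitive_bilinear[OF bounded_bilinear_matrix_mult pD pr(2)])
  note cont = solves_continuous[OF r(1)] solves_continuous[OF r(2)] primitive_continuous[OF pD]
  have aiDB: "(\<lambda>t. D t ** (B t ** r' t)) absolutely_integrable_on {0..1}"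
    by (rule ai_bilinear[OF bounded_bilinear.flip[OF bounded_bilinear_matrix_mult] ai_matrix_mult[OF B(1) cont(2)] cont(3)])
  have dd: "primitive (\<lambda>t. A t ** (r t - r' t) + (A t - B t) ** r' t) (\<lambda>t. r t - r' t)"
    by (rule primitive_cong[OF primitive_diff[OF pr]])
       (simp_all add: matrix_matrix_mult_def vec_eq_iff algebra_simps sum_subtractf)
  \<comment> \<open>Subtracting \<open>D ** r'\<close> trades the term \<open>(A - B) ** r'\<close>
    for \<open>D ** (B ** r')\<close>. The bound (4 + 2 K) \<delta> below is 2 \<delta> from the
    boundary term plus 2 \<delta> (1 + K) from this integral.\<close>
  have 1: "primitive (\<lambda>t. A t ** (r t - r' t) - D t ** (B t ** r' t)) (\<lambda>t. (r t - r' t) - D t ** r' t)"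
    by (rule primitive_cong[OF primitive_diff[OF dd pDr]]) simp_all
  show ?thesis
  proof (rule gronwall_matrix[OF A K _ _ t])
    show "continuous_on {0..1} (\<lambda>t. r t - r' t)" by (intro continuous_intros cont)
    fix t :: real assume t: "t \<in> {0..1}"
    have i1: "(\<lambda>s. A s ** (r s - r' s)) integrable_on {0..t}"
      using t by (intro ai_integrable_sub[OF ai_matrix_mult[OF A(1)]] continuous_intros cont) auto
    have i2: "(\<lambda>s. D s ** (B s ** r' s)) integrable_on {0..t}"
      using t by (intro ai_integrable_sub[OF aiDB]) auto
    have "D 0 = 0" by (simp add: D_def)
    then have "(r t - r' t) - D t ** r' t = integral {0..t} (\<lambda>t. A t ** (r t - r' t) - D t ** (B t ** r' t))"
      using primitive_value[OF 1, of t] t r by (simp add: solves_def matrix_matrix_mult_def vec_eq_iff)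
    also have "\<dots> = integral {0..t} (\<lambda>s. A s ** (r s - r' s)) - integral {0..t} (\<lambda>t. D t ** (B t ** r' t))"
      by (rule Henstock_Kurzweil_Integration.integral_diff[OF i1 i2])
    finally have e: "r t - r' t - integral {0..t} (\<lambda>s. A s ** (r s - r' s)) = D t ** r' t - integral {0..t} (\<lambda>t. D t ** (B t ** r' t))"
      by (simp add: algebra_simps)
    have n1: "norm (D t ** r' t) \<le> \<delta> * 2"
      using norm_matrix_mult_le[of "D t" "r' t"] mult_mono[OF d[OF t] rot[OF t]] d0 by (simp add: D_def)
    have "norm (integral {0..t} (\<lambda>t. D t ** (B t ** r' t))) \<le> integral {0..t} (\<lambda>s. 2 * \<delta> * norm (B s))"
    proof (rule norm_integral_le)
      show "(\<lambda>t. D t ** (B t ** r' t)) absolutely_integrable_on {0..t}"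
        using t by (intro ai_subinterval[OF aiDB]) auto
      show "(\<lambda>s. 2 * \<delta> * norm (B s)) integrable_on {0..t}"
        using integrable_cmul[OF ai_integrable_sub[OF sqint_norm_ai[OF B(1)], of 0 t], of "2 * \<delta>"] t by simp
      fix s assume "s \<in> {0..t}"
      then have s: "s \<in> {0..1}" using t by auto
      have "norm (D s ** (B s ** r' s)) \<le> norm (D s) * (norm (B s) * norm (r' s))"
        using norm_matrix_mult_le[of "D s" "B s ** r' s"] mult_left_mono[OF norm_matrix_mult_le[of "B s" "r' s"], of "norm (D s)"] by simp
      also have "\<dots> \<le> \<delta> * (norm (B s) * 2)"
        using d[OF s] rot[OF s] d0 by (intro mult_mono) (auto simp: D_def)
      finally show "norm (D s ** (B s ** r' s)) \<le> 2 * \<delta> * norm (B s)" by simp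
    qed
    also have "\<dots> = 2 * \<delta> * integral {0..t} (\<lambda>s. norm (B s))" by simp
    also have "\<dots> \<le> 2 * \<delta> * integral {0..1} (\<lambda>s. norm (B s))"
      using t d0 by (intro mult_left_mono integral_subset_le ai_integrable_sub[OF sqint_norm_ai[OF B(1)]]) auto
    also have "\<dots> \<le> 2 * \<delta> * (1 + K)"
      using d0 by (intro mult_left_mono integral_norm_le[OF B]) auto
    finally have n2: "norm (integral {0..t} (\<lambda>t. D t ** (B t ** r' t))) \<le> 2 * \<delta> * (1 + K)" .
    show "norm (r t - r' t - integral {0..t} (\<lambda>s. A s ** (r s - r' s))) \<le> (4 + 2 * K) * \<delta>"
      unfolding e using n1 n2 norm_triangle_ineq4[of "D t ** r' t" "integral {0..t} (\<lambda>t. D t ** (B t ** r' t))"]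
      by (simp add: algebra_simps)
  qed
qed

text \<open>\<open>B\<close> is the first variation of the field. The error y = r' - r - r \<Omega>
  solves y' = A y + E with E = (A' - A)(r' - r) + (A' - A - B) r. The first part of E is a product
  of two first-order quantities and the second is the Taylor remainder of the field, so the Gronwall
  bound is of second order.\<close>

lemma sol_linearization:
  assumes A: "sqint A" "integral {0..1} (\<lambda>t. (norm (A t))\<^sup>2) \<le> K" and K: "K > 0"
    and A': "sqint A'" and B: "sqint B"
    and r: "solves A r" "solves A' r'" and rot: "\<And>t. t \<in> {0..1} \<Longrightarrow> rotation_matrix (r t)"
    and \<Omega>: "primitive (\<lambda>t. transpose (r t) ** (B t ** r t)) \<Omega>" "\<Omega> 0 = 0"
    and b1: "\<And>t. t \<in> {0..1} \<Longrightarrow> norm (r' t - r t) \<le> \<beta>"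
    and b2: "integral {0..1} (\<lambda>t. norm (A' t - A t - B t)) \<le> \<gamma>"
    and b3: "integral {0..1} (\<lambda>t. norm (A' t - A t)) \<le> \<kappa>"
    and t: "t \<in> {0..1}"
  shows "norm (r' t - r t - r t ** \<Omega> t) \<le> 2 * (\<kappa> * \<beta> + 2 * \<gamma>) * exp (2 * K)"
proof -
  have pr: "primitive (\<lambda>t. A t ** r t) r" "primitive (\<lambda>t. A' t ** r' t) r'" using r by (auto simp: solves_def)
  note cont = solves_continuous[OF r(1)] solves_continuous[OF r(2)] primitive_continuous[OF \<Omega>(1)]
  have b0: "\<beta> \<ge> 0" using b1[OF t] norm_ge_zero order_trans by blast
  have prO: "primitive (\<lambda>t. A t ** r t ** \<Omega> t + r t ** (transpose (r t) ** (B t ** r t))) (\<lambda>t. r t ** \<Omega> t)"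
    by (rule primitive_bilinear[OF bounded_bilinear_matrix_mult pr(1) \<Omega>(1)])
  define E where "E = (\<lambda>t. (A' t - A t) ** (r' t - r t) + (A' t - A t - B t) ** r t)"
  have p: "primitive (\<lambda>t. A t ** (r' t - r t - r t ** \<Omega> t) + E t) (\<lambda>t. r' t - r t - r t ** \<Omega> t)"
  proof (rule primitive_cong[OF primitive_diff[OF primitive_diff[OF pr(2,1)] prO]])
    fix t :: real assume t: "t \<in> {0..1}"
    have "r t ** transpose (r t) = mat 1"
      using rot[OF t] by (simp add: rotation_matrix_def orthogonal_matrix_def)
    then have "r t ** (transpose (r t) ** (B t ** r t)) = B t ** r t"
      by (simp add: matrix_mul_assoc)
    then show "A' t ** r' t - A t ** r t - (A t ** r t ** \<Omega> t + r t ** (transpose (r t) ** (B t ** r t)))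
        = A t ** (r' t - r t - r t ** \<Omega> t) + E t"
      unfolding E_def matrix_mult_diff_right matrix_mult_diff_left matrix_mul_assoc[symmetric] by simp
  qed simp
  have s1: "sqint (\<lambda>t. A' t - A t)" by (rule sqint_diff[OF A' A(1)])
  have s2: "sqint (\<lambda>t. A' t - A t - B t)" by (rule sqint_diff[OF s1 B])
  have cd: "continuous_on {0..1} (\<lambda>t. r' t - r t)" by (intro continuous_intros cont)
  have aiE: "E absolutely_integrable_on {0..1}"
    unfolding E_def by (rule set_integral_add(1)[OF ai_matrix_mult[OF s1 cd] ai_matrix_mult[OF s2 cont(1)]])
  have cy: "continuous_on {0..1} (\<lambda>t. r' t - r t - r t ** \<Omega> t)" by (rule primitive_continuous[OF p])
  show ?thesis
  proof (rule gronwall_matrix[OF A K cy _ t])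
    fix t :: real assume t: "t \<in> {0..1}"
    have i: "(\<lambda>s. A s ** (r' s - r s - r s ** \<Omega> s)) integrable_on {0..t}" "E integrable_on {0..t}"
      using ai_integrable_sub[OF ai_matrix_mult[OF A(1) cy], of 0 t] ai_integrable_sub[OF aiE, of 0 t] t by auto
    have "r' 0 - r 0 - r 0 ** \<Omega> 0 = 0" using r \<Omega>(2) by (simp add: solves_def)
    then have "r' t - r t - r t ** \<Omega> t = integral {0..t} (\<lambda>s. A s ** (r' s - r s - r s ** \<Omega> s)) + integral {0..t} E"
      using primitive_value[OF p, of t] t Henstock_Kurzweil_Integration.integral_add[OF i] by simp
    then have e: "r' t - r t - r t ** \<Omega> t - integral {0..t} (\<lambda>s. A s ** (r' s - r s - r s ** \<Omega> s)) = integral {0..t} E"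
      by simp
    have n: "(\<lambda>s. norm (A' s - A s)) integrable_on {0..1}" "(\<lambda>s. norm (A' s - A s - B s)) integrable_on {0..1}"
      using sqint_norm_ai[OF s1] sqint_norm_ai[OF s2] by (auto simp: absolutely_integrable_on_def)
    define G where "G = (\<lambda>s. \<beta> * norm (A' s - A s) + 2 * norm (A' s - A s - B s))"
    have iG: "G integrable_on {0..1}"
      unfolding G_def using integrable_add[OF integrable_cmul[OF n(1), of \<beta>] integrable_cmul[OF n(2), of 2]] by simp
    have iGt: "G integrable_on {0..t}" using integrable_subinterval_real[OF iG, of 0 t] t by auto
    have "norm (integral {0..t} E) \<le> integral {0..t} G"
    proof (rule norm_integral_le[OF _ iGt])
      show "E absolutely_integrable_on {0..t}" using t by (intro ai_subinterval[OF aiE]) auto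
      fix s assume "s \<in> {0..t}"
      then have s: "s \<in> {0..1}" using t by auto
      have "norm ((A' s - A s) ** (r' s - r s)) \<le> norm (A' s - A s) * \<beta>"
        using norm_matrix_mult_le[of "A' s - A s" "r' s - r s"] mult_left_mono[OF b1[OF s], of "norm (A' s - A s)"] by simp
      moreover have "norm ((A' s - A s - B s) ** r s) \<le> norm (A' s - A s - B s) * 2"
        using norm_matrix_mult_le[of "A' s - A s - B s" "r s"]
          mult_left_mono[OF norm_rotation[OF rot[OF s]], of "norm (A' s - A s - B s)"] by simp
      ultimately show "norm (E s) \<le> G s"
        unfolding E_def G_def by (intro norm_triangle_le) (simp add: mult.commute)
    qed
    also have "\<dots> \<le> integral {0..1} G"
      using t b0 by (intro integral_subset_le iG iGt) (auto simp: G_def)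
    also have "\<dots> = \<beta> * integral {0..1} (\<lambda>s. norm (A' s - A s)) + 2 * integral {0..1} (\<lambda>s. norm (A' s - A s - B s))"
      unfolding G_def using Henstock_Kurzweil_Integration.integral_add[OF integrable_cmul[OF n(1), of \<beta>] integrable_cmul[OF n(2), of 2]] by simp
    also have "\<dots> \<le> \<kappa> * \<beta> + 2 * \<gamma>"
      using mult_left_mono[OF b3 b0] b2 by (simp add: mult.commute)
    finally show "norm (r' t - r t - r t ** \<Omega> t - integral {0..t} (\<lambda>s. A s ** (r' s - r s - r s ** \<Omega> s))) \<le> \<kappa> * \<beta> + 2 * \<gamma>"
      unfolding e .
  qed
qed

subsection \<open>Smooth functions and density\<close>

text \<open>Choosing for each member of the class a derivative inside the class and iterating the
  choice produces all derivatives at once, so no formula for higher derivatives is ever written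
  down.\<close>

lemma smooth_clI:
  fixes f :: "real \<Rightarrow> 'a::real_normed_vector"
  assumes f: "f \<in> C"
    and C: "\<And>g. g \<in> C \<Longrightarrow> \<exists>g'\<in>C. \<forall>t\<in>{0..1}. (g has_vector_derivative g' t) (at t within {0..1})"
  shows "smooth_cl f"
proof -
  have "\<forall>g\<in>C. \<exists>g'. g' \<in> C \<and> (\<forall>t\<in>{0..1}. (g has_vector_derivative g' t) (at t within {0..1}))"
    using C by blast
  from bchoice[OF this] obtain d where
    d: "\<forall>g\<in>C. d g \<in> C \<and> (\<forall>t\<in>{0..1}. (g has_vector_derivative d g t) (at t within {0..1}))" ..
  define D where "D = (\<lambda>k. (d ^^ k) f)"
  have "D k \<in> C" for k by (induction k) (use f d in \<open>auto simp: D_def\<close>)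
  then have "\<forall>k. \<forall>t\<in>{0..1}. (D k has_vector_derivative D (Suc k) t) (at t within {0..1})"
    using d by (simp add: D_def)
  moreover have "\<forall>t\<in>{0..1}. D 0 t = f t" by (simp add: D_def)
  ultimately show ?thesis unfolding smooth_cl_def by blast
qed

lemma smooth_cl_cong:
  assumes "smooth_cl f" "\<And>t. t \<in> {0..1} \<Longrightarrow> f t = g t"
  shows "smooth_cl g"
proof -
  obtain D where "\<forall>t\<in>{0..1}. D 0 t = f t"
    "\<forall>k. \<forall>t\<in>{0..1}. (D k has_vector_derivative D (Suc k) t) (at t within {0..1})"
    using assms(1) unfolding smooth_cl_def by (elim exE conjE)
  then show ?thesis unfolding smooth_cl_def using assms(2) by (intro exI[of _ D]) simp
qed

text \<open>The algebra generated by \<open>B\<close>. It is closed under differentiation as soon as the derivatives of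
  the generators belong to it, and then all its elements are smooth.\<close>
inductive_set alg :: "(real \<Rightarrow> real) set \<Rightarrow> (real \<Rightarrow> real) set" for B where
  base: "b \<in> B \<Longrightarrow> b \<in> alg B"
| const: "(\<lambda>_. c) \<in> alg B"
| add: "f \<in> alg B \<Longrightarrow> g \<in> alg B \<Longrightarrow> (\<lambda>t. f t + g t) \<in> alg B"
| mult: "f \<in> alg B \<Longrightarrow> g \<in> alg B \<Longrightarrow> (\<lambda>t. f t * g t) \<in> alg B"

lemma smooth_alg:
  assumes f: "f \<in> alg B"
    and B: "\<And>b. b \<in> B \<Longrightarrow> \<exists>b'\<in>alg B. \<forall>t\<in>{0..1}. (b has_real_derivative b' t) (at t within {0..1})"
  shows "smooth_cl f"
proof (rule smooth_clI[OF f])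
  fix g assume "g \<in> alg B"
  then have "\<exists>g'\<in>alg B. \<forall>t\<in>{0..1}. (g has_real_derivative g' t) (at t within {0..1})"
  proof induction
    case (const c)
    show ?case by (rule bexI[of _ "\<lambda>_. 0"]) (auto intro: alg.const)
  next
    case (add f g)
    then obtain f' g' where "f' \<in> alg B" "g' \<in> alg B"
      "\<forall>t\<in>{0..1}. (f has_real_derivative f' t) (at t within {0..1})"
      "\<forall>t\<in>{0..1}. (g has_real_derivative g' t) (at t within {0..1})" by blast
    then show ?case by (intro bexI[of _ "\<lambda>t. f' t + g' t"] alg.add ballI DERIV_add) auto
  next
    case (mult f g)
    then obtain f' g' where *: "f' \<in> alg B" "g' \<in> alg B"
      "\<forall>t\<in>{0..1}. (f has_real_derivative f' t) (at t within {0..1})"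
      "\<forall>t\<in>{0..1}. (g has_real_derivative g' t) (at t within {0..1})" by blast
    have "(\<lambda>t. f' t * g t + g' t * f t) \<in> alg B"
      by (intro alg.add alg.mult * mult)
    then show ?case by (rule rev_bexI) (use * in \<open>auto intro: DERIV_mult\<close>)
  qed (use B in blast)
  then show "\<exists>g'\<in>alg B. \<forall>t\<in>{0..1}. (g has_vector_derivative g' t) (at t within {0..1})"
    by (simp add: has_real_derivative_iff_has_vector_derivative)
qed

section \<open>Closure properties of smooth functions\<close>

lemma smooth_cl_derivs:
  fixes f :: "real \<Rightarrow> real"
  assumes "smooth_cl f"
  shows "\<exists>D. (\<forall>t\<in>{0..1}. D 0 t = f t) \<and>
    (\<forall>k. \<forall>t\<in>{0..1}. (D k has_real_derivative D (Suc k) t) (at t within {0..1}))"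
  using assms unfolding smooth_cl_def has_real_derivative_iff_has_vector_derivative .

text \<open>All derivatives of \<open>f\<close> and \<open>g\<close> together generate an algebra
  that is closed under differentiation, which replaces the Leibniz formula for higher
  derivatives.\<close>

lemma smooth_cl_two:
  fixes f g :: "real \<Rightarrow> real"
  assumes "smooth_cl f" "smooth_cl g"
  shows smooth_cl_add: "smooth_cl (\<lambda>t. f t + g t)" and smooth_cl_mult: "smooth_cl (\<lambda>t. f t * g t)"
proof -
  obtain D where D0: "\<forall>t\<in>{0..1}. D 0 t = f t"
    "\<forall>k. \<forall>t\<in>{0..1}. (D k has_real_derivative D (Suc k) t) (at t within {0..1})"
    using smooth_cl_derivs[OF assms(1)] by blast
  note D = D0(1)[rule_format] D0(2)[rule_format]
  obtain E where E0: "\<forall>t\<in>{0..1}. E 0 t = g t"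
    "\<forall>k. \<forall>t\<in>{0..1}. (E k has_real_derivative E (Suc k) t) (at t within {0..1})"
    using smooth_cl_derivs[OF assms(2)] by blast
  note E = E0(1)[rule_format] E0(2)[rule_format]
  define B where "B = range D \<union> range E"
  have B: "\<exists>b'\<in>alg B. \<forall>t\<in>{0..1}. (b has_real_derivative b' t) (at t within {0..1})" if b: "b \<in> B" for b
  proof -
    consider k where "b = D k" | k where "b = E k" using b by (auto simp: B_def)
    then show ?thesis
    proof cases
      case (1 k)
      then show ?thesis using D(2) by (intro bexI[of _ "D (Suc k)"] alg.base) (auto simp: B_def)
    next
      case (2 k)
      then show ?thesis using E(2) by (intro bexI[of _ "E (Suc k)"] alg.base) (auto simp: B_def)
    qed
  qed
  have m: "D 0 \<in> alg B" "E 0 \<in> alg B" by (auto simp: B_def intro!: alg.base)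
  show "smooth_cl (\<lambda>t. f t + g t)"
    by (rule smooth_cl_cong[OF smooth_alg[OF alg.add[OF m] B]]) (simp_all add: D(1) E(1))
  show "smooth_cl (\<lambda>t. f t * g t)"
    by (rule smooth_cl_cong[OF smooth_alg[OF alg.mult[OF m] B]]) (simp_all add: D(1) E(1))
qed

lemma smooth_cl_const: "smooth_cl (\<lambda>_. c :: real)"
  by (rule smooth_alg[of _ "{}"]) (auto intro: alg.const)

text \<open>The function q = 1 / sqrt (1 + s^2) satisfies q' = - s s' q^3, a polynomial in q and
  derivatives of s, so adjoining q to these derivatives keeps the algebra closed under
  differentiation.\<close>

lemma smooth_cl_inverse_sqrt:
  assumes "smooth_cl s"
  shows "smooth_cl (\<lambda>t. 1 / sqrt (1 + (s t)\<^sup>2))"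
proof -
  obtain D where D0: "\<forall>t\<in>{0..1}. D 0 t = s t"
    "\<forall>k. \<forall>t\<in>{0..1}. (D k has_real_derivative D (Suc k) t) (at t within {0..1})"
    using smooth_cl_derivs[OF assms] by blast
  note D = D0(1)[rule_format] D0(2)[rule_format]
  define q where "q = (\<lambda>t. 1 / sqrt (1 + (D 0 t)\<^sup>2))"
  define B where "B = insert q (range D)"
  have "smooth_cl q"
  proof (rule smooth_alg[of _ B])
    show "q \<in> alg B" by (rule alg.base) (simp add: B_def)
    fix b assume "b \<in> B"
    then consider "b = q" | k where "b = D k" by (auto simp: B_def)
    then show "\<exists>b'\<in>alg B. \<forall>t\<in>{0..1}. (b has_real_derivative b' t) (at t within {0..1})"
    proof cases
      case 1
      have "(\<lambda>t. ((-1) * (D 0 t * D (Suc 0) t)) * (q t * (q t * q t))) \<in> alg B"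
        by (intro alg.mult alg.const alg.base) (auto simp: B_def)
      then show ?thesis
      proof (rule rev_bexI, intro ballI)
        fix t :: real assume t: "t \<in> {0..1}"
        have p: "1 + (D 0 t)\<^sup>2 > 0" by (simp add: add_pos_nonneg)
        have "((\<lambda>t. 1 / sqrt (1 + (D 0 t)\<^sup>2)) has_real_derivative
            - (inverse (sqrt (1 + (D 0 t)\<^sup>2)) / 2 * (2 * D 0 t * D (Suc 0) t)) / (sqrt (1 + (D 0 t)\<^sup>2) * sqrt (1 + (D 0 t)\<^sup>2))) (at t within {0..1})"
          using p by (auto intro!: derivative_eq_intros D(2)[OF t] simp: power2_eq_square)
        moreover have "- (inverse (sqrt (1 + (D 0 t)\<^sup>2)) / 2 * (2 * D 0 t * D (Suc 0) t)) / (sqrt (1 + (D 0 t)\<^sup>2) * sqrt (1 + (D 0 t)\<^sup>2))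
            = ((-1) * (D 0 t * D (Suc 0) t)) * (q t * (q t * q t))"
          by (simp add: q_def field_simps)
        ultimately show "(b has_real_derivative ((-1) * (D 0 t * D (Suc 0) t)) * (q t * (q t * q t))) (at t within {0..1})"
          unfolding 1 by (simp add: q_def)
      qed
    next
      case (2 k)
      then show ?thesis using D(2) by (intro bexI[of _ "D (Suc k)"] alg.base) (auto simp: B_def)
    qed
  qed
  then show ?thesis by (rule smooth_cl_cong) (simp add: q_def D(1))
qed

lemma smooth_cl_polynomial:
  assumes "real_polynomial_function p"
  shows "smooth_cl p"
proof (rule smooth_clI[of _ "Collect polynomial_function"])
  show "p \<in> Collect polynomial_function" using assms by (simp add: real_polynomial_function_eq)
  fix g :: "real \<Rightarrow> real" assume "g \<in> Collect polynomial_function"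
  then obtain g' where "polynomial_function g'" "\<And>x. (g has_vector_derivative g' x) (at x)"
    using has_vector_derivative_polynomial_function[of g] by auto
  then show "\<exists>g'\<in>Collect polynomial_function. \<forall>t\<in>{0..1}. (g has_vector_derivative g' t) (at t within {0..1})"
    by (auto intro: has_vector_derivative_at_within)
qed

lemma smooth_cl_vec2:
  fixes f g :: "real \<Rightarrow> real"
  assumes "smooth_cl f" "smooth_cl g"
  shows "smooth_cl (\<lambda>t. vector [f t, g t] :: real^2)"
proof -
  obtain D where D0: "\<forall>t\<in>{0..1}. D 0 t = f t"
    "\<forall>k. \<forall>t\<in>{0..1}. (D k has_real_derivative D (Suc k) t) (at t within {0..1})"
    using smooth_cl_derivs[OF assms(1)] by blast
  note D = D0(1)[rule_format] D0(2)[rule_format]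
  obtain E where E0: "\<forall>t\<in>{0..1}. E 0 t = g t"
    "\<forall>k. \<forall>t\<in>{0..1}. (E k has_real_derivative E (Suc k) t) (at t within {0..1})"
    using smooth_cl_derivs[OF assms(2)] by blast
  note E = E0(1)[rule_format] E0(2)[rule_format]
  have e: "vector [x, y] = x *\<^sub>R axis 1 1 + y *\<^sub>R (axis 2 1 :: real^2)" for x y :: real
    by (simp add: vec_eq_iff forall_2 axis_def)
  show ?thesis
    unfolding smooth_cl_def e
    by (rule exI[of _ "\<lambda>k t. D k t *\<^sub>R axis 1 1 + E k t *\<^sub>R axis 2 1"])
       (auto simp: D(1) E(1) intro!: derivative_eq_intros D(2) E(2))
qed

text \<open>The derivatives of \<open>exp (- 1 / x)\<close>, extended by \<open>0\<close>, are linear combinations of these functions.\<close>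
definition flat :: "nat \<Rightarrow> real \<Rightarrow> real" where
  "flat k x = (if x > 0 then inverse x ^ k * exp (- inverse x) else 0)"

text \<open>The difference quotient at 0, the only point where the two branches meet. Substituting y
  = 1 / h reduces it to the exponential growing faster than any power.\<close>

lemma flat_div_tendsto: "((\<lambda>h. flat k h / h) \<longlongrightarrow> 0) (at 0)"
proof -
  have "((\<lambda>y::real. y ^ Suc k / exp y) \<longlongrightarrow> 0) at_top" by (rule tendsto_power_div_exp_0)
  then have "((\<lambda>h::real. inverse h ^ Suc k / exp (inverse h)) \<longlongrightarrow> 0) (at_right 0)"
    by (rule filterlim_compose[OF _ filterlim_inverse_at_top_right])
  then have r: "((\<lambda>h. flat k h / h) \<longlongrightarrow> 0) (at_right 0)"
    by (rule Lim_transform_eventually)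
       (auto simp: eventually_at_filter flat_def exp_minus field_simps)
  have l: "((\<lambda>h. flat k h / h) \<longlongrightarrow> 0) (at_left 0)"
    by (rule Lim_transform_eventually[OF tendsto_const]) (auto simp: eventually_at_filter flat_def)
  show ?thesis using filterlim_split_at[OF l r] .
qed

lemma DERIV_flat: "(flat k has_real_derivative (- real k) * flat (Suc k) x + flat (Suc (Suc k)) x) (at x)"
proof (cases x "0 :: real" rule: linorder_cases)
  case less
  have "((\<lambda>_. 0) has_real_derivative 0) (at x)" by simp
  then have "(flat k has_real_derivative 0) (at x)"
    by (rule has_field_derivative_transform_within_open[where S = "{..<0}"]) (use less in \<open>auto simp: flat_def\<close>)
  then show ?thesis using less by (simp add: flat_def)
next
  case equal
  have "((\<lambda>h. (flat k (0 + h) - flat k 0) / h) \<longlongrightarrow> 0) (at 0)"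
    using flat_div_tendsto[of k] by (simp add: flat_def)
  then show ?thesis unfolding equal DERIV_def by (simp add: flat_def)
next
  case greater
  have "((\<lambda>x. inverse x ^ k * exp (- inverse x)) has_real_derivative
      (real k * (- (inverse x * inverse x)) * inverse x ^ (k - 1)) * exp (- inverse x)
        + (exp (- inverse x) * (inverse x * inverse x)) * inverse x ^ k) (at x)"
    using greater by (auto intro!: derivative_eq_intros)
  also have "(real k * (- (inverse x * inverse x)) * inverse x ^ (k - 1)) * exp (- inverse x)
        + (exp (- inverse x) * (inverse x * inverse x)) * inverse x ^ k
      = (- real k) * flat (Suc k) x + flat (Suc (Suc k)) x"
    using greater by (cases k) (auto simp: flat_def algebra_simps)
  finally have "((\<lambda>x. inverse x ^ k * exp (- inverse x)) has_real_derivative (- real k) * flat (Suc k) x + flat (Suc (Suc k)) x) (at x)" .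
  then show ?thesis
    by (rule has_field_derivative_transform_within_open[where S = "{0<..}"]) (use greater in \<open>auto simp: flat_def\<close>)
qed

text \<open>Vanishes within distance 1 / (n + 1) of either endpoint. It has no plateau of height 1;
  pointwise convergence to 1 in the interior and the bounds 0 and 1 are what dominated convergence
  asks for.\<close>

definition cutoff :: "nat \<Rightarrow> real \<Rightarrow> real" where
  "cutoff n t = flat 0 (real (Suc n) * t - 1) * flat 0 (real (Suc n) * (1 - t) - 1)"

lemma smooth_cutoff: "smooth_cl (cutoff n)"
proof (rule smooth_alg)
  define B where "B = {\<lambda>t. flat k (c * t + d) |k c d. True}"
  have "(\<lambda>t. flat 0 (real (Suc n) * t + (-1)) * flat 0 ((- real (Suc n)) * t + (real (Suc n) - 1))) \<in> alg B"
    unfolding B_def by (intro alg.mult alg.base) blast+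
  then show "cutoff n \<in> alg B"
    by (simp add: cutoff_def[abs_def] algebra_simps)
  fix b assume "b \<in> B"
  then obtain k c d where b: "b = (\<lambda>t. flat k (c * t + d))" by (auto simp: B_def)
  have m: "(\<lambda>t. ((- real k) * flat (Suc k) (c * t + d) + flat (Suc (Suc k)) (c * t + d)) * c) \<in> alg B"
    unfolding B_def by (intro alg.mult alg.add alg.const alg.base) blast+
  have "(b has_real_derivative ((- real k) * flat (Suc k) (c * t + d) + flat (Suc (Suc k)) (c * t + d)) * c) (at t within {0..1})" for t
    unfolding b by (rule DERIV_chain2[OF DERIV_flat]) (auto intro!: derivative_eq_intros)
  then show "\<exists>b'\<in>alg B. \<forall>t\<in>{0..1}. (b has_real_derivative b' t) (at t within {0..1})"
    by (intro bexI[OF _ m]) blast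
qed

lemma flat_0_bounds: "0 \<le> flat 0 x" "flat 0 x \<le> 1"
  by (auto simp: flat_def)

lemma flat_0_tendsto: "(flat 0 \<longlongrightarrow> 1) at_top"
proof -
  have "((\<lambda>x::real. exp (- inverse x)) \<longlongrightarrow> exp (- 0)) at_top"
    by (intro tendsto_intros tendsto_inverse_0_at_top filterlim_ident)
  then have "((\<lambda>x::real. exp (- inverse x)) \<longlongrightarrow> 1) at_top" by simp
  then show ?thesis
    by (rule Lim_transform_eventually) (use eventually_gt_at_top[of 0] in \<open>auto elim!: eventually_mono simp: flat_def\<close>)
qed

lemma cutoff_bounds: "0 \<le> cutoff n t" "cutoff n t \<le> 1"
  using flat_0_bounds by (auto simp: cutoff_def intro: mult_le_one)

lemma cutoff_tendsto:
  assumes "0 < t" "t < 1" shows "(\<lambda>n. cutoff n t) \<longlonglongrightarrow> 1"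
proof -
  have f: "filterlim (\<lambda>n. real (Suc n) * s - 1) at_top sequentially" if "s > 0" for s
  proof -
    have "filterlim (\<lambda>n. -1 + s * real (Suc n)) at_top sequentially"
      by (intro filterlim_tendsto_add_at_top[OF tendsto_const] filterlim_tendsto_pos_mult_at_top[OF tendsto_const that]
          filterlim_compose[OF filterlim_real_sequentially filterlim_Suc])
    then show ?thesis by (simp add: algebra_simps)
  qed
  have "(\<lambda>n. flat 0 (real (Suc n) * t - 1) * flat 0 (real (Suc n) * (1 - t) - 1)) \<longlonglongrightarrow> 1 * 1"
    using assms by (intro tendsto_mult filterlim_compose[OF flat_0_tendsto] f) auto
  then show ?thesis by (simp add: cutoff_def)
qed

text \<open>Serves both for test functions and for slopes: a slope that vanishes near the ends means
  that the direction is e1 there.\<close>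

definition smooth0 :: "(real \<Rightarrow> real) \<Rightarrow> bool" where
  "smooth0 f \<longleftrightarrow> smooth_cl f \<and> (\<exists>U. open U \<and> {0, 1} \<subseteq> U \<and> (\<forall>t\<in>U \<inter> {0..1}. f t = 0))"

lemma smooth0_cutoff_mult:
  assumes "smooth_cl p" shows "smooth0 (\<lambda>t. cutoff n t * p t)"
  unfolding smooth0_def
proof (intro conjI exI[of _ "{..<1 / real (Suc n)} \<union> {1 - 1 / real (Suc n)<..}"])
  show "\<forall>t\<in>({..<1 / real (Suc n)} \<union> {1 - 1 / real (Suc n)<..}) \<inter> {0..1}. cutoff n t * p t = 0"
    by (auto simp: cutoff_def flat_def field_simps)
qed (auto intro: smooth_cl_mult[OF smooth_cutoff assms])

lemma smooth0_add:
  assumes "smooth0 f" "smooth0 g" shows "smooth0 (\<lambda>t. f t + g t)"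
proof -
  obtain U V where "open U" "{0,1} \<subseteq> U" "\<forall>t\<in>U \<inter> {0..1}. f t = 0" "open V" "{0,1} \<subseteq> V" "\<forall>t\<in>V \<inter> {0..1}. g t = 0"
    using assms unfolding smooth0_def by blast
  then show ?thesis
    using assms unfolding smooth0_def by (intro conjI exI[of _ "U \<inter> V"] smooth_cl_add) auto
qed

lemma smooth0_cmult:
  assumes "smooth0 f" shows "smooth0 (\<lambda>t. c * f t)"
proof -
  obtain U where "open U" "{0,1} \<subseteq> U" "\<forall>t\<in>U \<inter> {0..1}. f t = 0"
    using assms unfolding smooth0_def by blast
  then show ?thesis
    using assms unfolding smooth0_def by (intro conjI exI[of _ U] smooth_cl_mult smooth_cl_const) auto
qed

lemma smooth0_const_0: "smooth0 (\<lambda>_. 0)"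
  unfolding smooth0_def by (intro conjI smooth_cl_const exI[of _ UNIV]) auto

lemma smooth0_sum:
  assumes "\<And>i. i \<in> I \<Longrightarrow> smooth0 (f i)"
  shows "smooth0 (\<lambda>t. \<Sum>i\<in>I. f i t)"
  using assms
proof (induction I rule: infinite_finite_induct)
  case (insert i I)
  then show ?case by (simp add: smooth0_add)
qed (simp_all add: smooth0_const_0)

lemma smooth_cl_continuous: "smooth_cl f \<Longrightarrow> continuous_on {0..1} f"
proof -
  assume "smooth_cl f"
  then obtain D where D: "\<forall>t\<in>{0..1}. D 0 t = f t" "\<forall>k. \<forall>t\<in>{0..1}. (D k has_vector_derivative D (Suc k) t) (at t within {0..1})"
    unfolding smooth_cl_def by blast
  have "continuous_on {0..1} (D 0)"
    using D(2) unfolding continuous_on_eq_continuous_within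
    by (blast intro: has_vector_derivative_continuous)
  then show ?thesis by (rule continuous_on_eq) (use D(1) in blast)
qed

lemma smooth_cl_primitive:
  fixes f :: "real \<Rightarrow> real"
  assumes "smooth_cl f"
  obtains f' where "continuous_on {0..1} f'" "primitive f' f"
proof -
  obtain D where D0: "\<forall>t\<in>{0..1}. D 0 t = f t"
    "\<forall>k. \<forall>t\<in>{0..1}. (D k has_real_derivative D (Suc k) t) (at t within {0..1})"
    using smooth_cl_derivs[OF assms] by blast
  note D = D0(1)[rule_format] D0(2)[rule_format]
  have c: "continuous_on {0..1} (D k)" for k
    using DERIV_continuous_on[of "{0..1}" "D k" "D (Suc k)"] D(2) by blast
  have "primitive (D (Suc 0)) (D 0)"
    by (rule primitive_of_derivative[OF _ c]) (use D(2) in \<open>simp add: has_real_derivative_iff_has_vector_derivative\<close>)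
  then have "primitive (D (Suc 0)) f" by (rule primitive_cong) (simp_all add: D(1))
  then show ?thesis using that c by blast
qed

text \<open>A measurable function is almost everywhere a limit of continuous ones; these are clipped
  to [-K, K], replaced by polynomials up to 1 / (n + 1), and cut off. The extra 1 in the bound pays
  for the polynomial error.\<close>

lemma smooth0_approx:
  assumes h: "h \<in> borel_measurable (lebesgue_on {0..1})" and K: "\<And>t. t \<in> {0..1} \<Longrightarrow> \<bar>h t\<bar> \<le> K"
  obtains q N where "\<And>n. smooth0 (q n)" "\<And>n t. t \<in> {0..1} \<Longrightarrow> \<bar>q n t\<bar> \<le> K + 1"
    "negligible N" "\<And>t. t \<in> {0..1} - N \<Longrightarrow> (\<lambda>n. q n t) \<longlonglongrightarrow> h t"
proof -
  have K0: "K \<ge> 0" using K[of 0] by simp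
  have "h measurable_on {0..1}" using h by (simp add: measurable_on_iff_borel_measurable)
  then obtain N g where N: "negligible N" and g: "\<And>n. continuous_on UNIV (g n)"
      "\<And>t. t \<notin> N \<Longrightarrow> (\<lambda>n. g n t) \<longlonglongrightarrow> (if t \<in> {0..1} then h t else 0)"
    unfolding measurable_on_def by blast
  define c where "c = (\<lambda>n t. max (- K) (min K (g n t)))"
  have cc: "continuous_on {0..1} (c n)" for n
    unfolding c_def using g(1)[of n] by (intro continuous_intros) (auto intro: continuous_on_subset)
  have "\<exists>p. real_polynomial_function p \<and> (\<forall>t\<in>{0..1}. \<bar>c n t - p t\<bar> < 1 / real (Suc n))" for n
    using Stone_Weierstrass_real_polynomial_function[OF _ cc, of "1 / real (Suc n)"] by (metis compact_Icc zero_less_divide_1_iff of_nat_0_less_iff zero_less_Suc)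
  then obtain p where p: "\<And>n. real_polynomial_function (p n)" "\<And>n t. t \<in> {0..1} \<Longrightarrow> \<bar>c n t - p n t\<bar> < 1 / real (Suc n)"
    by metis
  show ?thesis
  proof (rule that[of "\<lambda>n t. cutoff n t * p n t" "N \<union> {0,1}"])
    show "smooth0 (\<lambda>t. cutoff n t * p n t)" for n
      by (intro smooth0_cutoff_mult smooth_cl_polynomial p)
    show "\<bar>cutoff n t * p n t\<bar> \<le> K + 1" if "t \<in> {0..1}" for n t
    proof -
      have "1 / real (Suc n) \<le> 1" by simp
      moreover have "\<bar>c n t\<bar> \<le> K" using K0 by (auto simp: c_def)
      ultimately have "\<bar>p n t\<bar> \<le> K + 1" using p(2)[OF that, of n] by linarith
      then have "cutoff n t * \<bar>p n t\<bar> \<le> 1 * (K + 1)"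
        using cutoff_bounds[of n t] K0 by (intro mult_mono) auto
      then show ?thesis using cutoff_bounds[of n t] by (simp add: abs_mult)
    qed
    show "negligible (N \<union> {0,1})" using N by (simp add: negligible_Un_eq)
    fix t assume t: "t \<in> {0..1} - (N \<union> {0,1})"
    then have t': "t \<in> {0..1}" "t \<notin> N" "0 < t" "t < 1" by auto
    have "(\<lambda>n. max (- K) (min K (g n t))) \<longlonglongrightarrow> max (- K) (min K (h t))"
      using g(2)[OF t'(2)] t'(1) by (intro tendsto_max tendsto_min tendsto_const) auto
    then have cl: "(\<lambda>n. c n t) \<longlonglongrightarrow> h t" using K[OF t'(1)] by (simp add: c_def)
    have "(\<lambda>n. c n t - p n t) \<longlonglongrightarrow> 0"
    proof (rule Lim_null_comparison)
      show "\<forall>\<^sub>F n in sequentially. norm (c n t - p n t) \<le> 1 / real (Suc n)"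
        by (rule always_eventually) (use p(2)[OF t'(1)] in \<open>simp add: less_imp_le\<close>)
      show "(\<lambda>n. 1 / real (Suc n)) \<longlonglongrightarrow> 0" using LIMSEQ_inverse_real_of_nat by (simp add: inverse_eq_divide)
    qed
    from tendsto_diff[OF cl this] have "(\<lambda>n. p n t) \<longlonglongrightarrow> h t" by simp
    from tendsto_mult[OF cutoff_tendsto[OF t'(3,4)] this] show "(\<lambda>n. cutoff n t * p n t) \<longlonglongrightarrow> h t" by simp
  qed
qed

lemma dominated_convergence_ae:
  fixes F :: "nat \<Rightarrow> real \<Rightarrow> 'a::euclidean_space"
  assumes F: "\<And>n. F n absolutely_integrable_on {0..1}" and g: "g absolutely_integrable_on {0..1}"
    and b: "\<And>n t. t \<in> {0..1} \<Longrightarrow> norm (F n t) \<le> g t"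
    and N: "negligible N" and l: "\<And>t. t \<in> {0..1} - N \<Longrightarrow> (\<lambda>n. F n t) \<longlonglongrightarrow> f t"
  shows "(\<lambda>n. integral {0..1} (F n)) \<longlonglongrightarrow> integral {0..1} f"
proof -
  define G where "G = (\<lambda>n t. if t \<in> N then 0 else F n t)"
  define f' where "f' = (\<lambda>t. if t \<in> N then 0 else f t)"
  have "(\<lambda>n. integral {0..1} (G n)) \<longlonglongrightarrow> integral {0..1} f'"
  proof (rule dominated_convergence(2))
    show "G n integrable_on {0..1}" for n
      by (rule integrable_spike[OF _ N, of "F n"]) (use F[of n] in \<open>auto simp: G_def absolutely_integrable_on_def\<close>)
    show "g integrable_on {0..1}" using g by (simp add: absolutely_integrable_on_def)
    show "norm (G n t) \<le> g t" if "t \<in> {0..1}" for n t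
      using b[OF that, of n] order_trans[OF norm_ge_zero b[OF that, of n]] by (auto simp: G_def)
    show "(\<lambda>n. G n t) \<longlonglongrightarrow> f' t" if "t \<in> {0..1}" for t
      using l[of t] that by (auto simp: G_def f'_def)
  qed
  moreover have "integral {0..1} (G n) = integral {0..1} (F n)" for n
    by (rule integral_spike[OF N]) (auto simp: G_def)
  moreover have "integral {0..1} f' = integral {0..1} f"
    by (rule integral_spike[OF N]) (auto simp: f'_def)
  ultimately show ?thesis by simp
qed

lemma integral_norm_zero_negligible:
  fixes f :: "real \<Rightarrow> real"
  assumes "f absolutely_integrable_on {0..1}" "integral {0..1} (\<lambda>t. \<bar>f t\<bar>) = 0"
  shows "negligible {t\<in>{0..1}. f t \<noteq> 0}"
proof -
  have ai: "(\<lambda>t. \<bar>f t\<bar>) absolutely_integrable_on {0..1}"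
    using absolutely_integrable_norm[OF assms(1)] by (simp add: o_def)
  then have i: "integrable (lebesgue_on {0..1}) (\<lambda>t. \<bar>f t\<bar>)"
    by (rule absolutely_integrable_imp_integrable) simp
  have "integral\<^sup>L (lebesgue_on {0..1}) (\<lambda>t. \<bar>f t\<bar>) = 0"
    using lebesgue_integral_eq_integral[OF i] assms(2) by simp
  then have "AE t in lebesgue_on {0..1}. f t = 0"
    using integral_nonneg_eq_0_iff_AE[OF i] by simp
  then have "AE t in lebesgue. t \<in> {0..1} \<longrightarrow> f t = 0"
    by (simp add: AE_restrict_space_iff)
  then obtain N where N: "N \<in> null_sets lebesgue" "{t\<in>space lebesgue. \<not> (t \<in> {0..1} \<longrightarrow> f t = 0)} \<subseteq> N"
    unfolding eventually_ae_filter by blast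
  have "{t\<in>{0..1}. f t \<noteq> 0} \<subseteq> N" using N(2) by auto
  with N(1) show ?thesis using negligible_subset negligible_iff_null_sets by blast
qed

text \<open>The fundamental lemma of the calculus of variations: testing with bounded smooth
  functions that tend to \<open>sgn (f t)\<close> almost everywhere gives a vanishing integral of
  \<open>\<bar>f t\<bar>\<close>.\<close>

lemma smooth0_fundamental:
  assumes f: "f absolutely_integrable_on {0..1}"
    and 0: "\<And>q. smooth0 q \<Longrightarrow> integral {0..1} (\<lambda>t. f t * q t) = 0"
  shows "negligible {t\<in>{0..1}. f t \<noteq> 0}"
proof -
  have fm: "f \<in> borel_measurable (lebesgue_on {0..1})"
    using absolutely_integrable_imp_borel_measurable[OF f] by simp
  have "(\<lambda>t. sgn (f t)) \<in> borel_measurable (lebesgue_on {0..1})" using fm by (simp add: sgn_real_def[abs_def]) 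
  moreover have "\<bar>sgn (f t)\<bar> \<le> 1" for t by (simp add: sgn_real_def)
  ultimately obtain q N where q: "\<And>n. smooth0 (q n)" "\<And>n t. t \<in> {0..1} \<Longrightarrow> \<bar>q n t\<bar> \<le> 1 + 1"
    "negligible N" "\<And>t. t \<in> {0..1} - N \<Longrightarrow> (\<lambda>n. q n t) \<longlonglongrightarrow> sgn (f t)"
    using smooth0_approx[of "\<lambda>t. sgn (f t)" 1] by blast
  have "(\<lambda>n. integral {0..1} (\<lambda>t. f t * q n t)) \<longlonglongrightarrow> integral {0..1} (\<lambda>t. f t * sgn (f t))"
  proof (rule dominated_convergence_ae[OF _ _ _ q(3)])
    show "(\<lambda>t. f t * q n t) absolutely_integrable_on {0..1}" for n
      using q(1)[of n] by (intro ai_bilinear[OF bounded_bilinear_mult f] smooth_cl_continuous) (simp add: smooth0_def)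
    show "(\<lambda>t. \<bar>f t\<bar> * 2) absolutely_integrable_on {0..1}"
      using absolutely_integrable_norm[OF f] by (simp add: o_def)
    show "norm (f t * q n t) \<le> \<bar>f t\<bar> * 2" if "t \<in> {0..1}" for n t
      using mult_left_mono[OF q(2)[OF that, of n], of "\<bar>f t\<bar>"] by (simp add: abs_mult)
    show "(\<lambda>n. f t * q n t) \<longlonglongrightarrow> f t * sgn (f t)" if "t \<in> {0..1} - N" for t
      by (intro tendsto_mult tendsto_const q(4) that)
  qed
  moreover have "f t * sgn (f t) = \<bar>f t\<bar>" for t by (simp add: sgn_real_def)
  ultimately have "integral {0..1} (\<lambda>t. \<bar>f t\<bar>) = 0"
    using 0[OF q(1)] by (simp add: LIMSEQ_const_iff)
  then show ?thesis by (rule integral_norm_zero_negligible[OF f])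
qed

subsection \<open>Surjectivity of the linearised endpoint map\<close>

lemma bounded_bilinear_cross3: "bounded_bilinear cross3"
  using bilinear_cross by (simp add: bilinear_conv_bounded_bilinear)

lemma bounded_bilinear_matrix_vector_mult:
  "bounded_bilinear ((*v) :: real^3^3 \<Rightarrow> real^3 \<Rightarrow> real^3)"
  unfolding bilinear_conv_bounded_bilinear[symmetric] bilinear_def
  by (auto intro!: linearI simp: matrix_vector_mult_def vec_eq_iff sum.distrib sum_distrib_left algebra_simps)

lemma A_of_mult_vec:
  "A_of N *v x = vector [N$1$1 * x$3, N$1$2 * x$3, - N$1$1 * x$1 - N$1$2 * x$2]"
  by (simp add: vec_eq_iff forall_3 A_of_def outer_def axis_def matrix_vector_mult_def sum_3)

lemma transpose_A_of: "transpose (A_of N) = - A_of N"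
  by (simp add: vec_eq_iff forall_3 A_of_def outer_def axis_def transpose_def)

lemma bounded_linear_A_of: "bounded_linear A_of"
  unfolding linear_conv_bounded_linear[symmetric]
  by (rule linearI) (simp_all add: A_of_def algebra_simps)

text \<open>The axial vector of the skew matrix \<open>A_of N\<close>, see
  \<open>A_of_eq_cross3\<close>.\<close>

definition bvec :: "real^2^2 \<Rightarrow> real^3" where
  "bvec N = vector [- N$1$2, N$1$1, 0]"

text \<open>The skew matrix of the map that takes x to the cross product of w and x.\<close>

definition crossmat :: "real^3 \<Rightarrow> real^3^3" where
  "crossmat w = vector [vector [0, - w$3, w$2], vector [w$3, 0, - w$1], vector [- w$2, w$1, 0]]"

lemma bounded_linear_crossmat: "bounded_linear crossmat"
  unfolding linear_conv_bounded_linear[symmetric]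
  by (rule linearI) (simp_all add: crossmat_def vec_eq_iff forall_3)

lemma crossmat_mult_vec: "crossmat w *v x = cross3 w x"
  by (simp add: crossmat_def cross3_def vec_eq_iff forall_3 matrix_vector_mult_def sum_3)

lemma A_of_eq_cross3: "A_of N *v x = cross3 (bvec N) x"
  by (simp add: A_of_mult_vec bvec_def cross3_def vec_eq_iff forall_3)

lemma bounded_linear_bvec: "bounded_linear bvec"
  unfolding linear_conv_bounded_linear[symmetric]
  by (rule linearI) (simp_all add: bvec_def vec_eq_iff forall_3)

lemma rotation_matrix_transpose: "rotation_matrix Q \<Longrightarrow> rotation_matrix (transpose Q)" for Q :: "real^'n^'n"
  by (simp add: rotation_matrix_def orthogonal_matrix_transpose)

text \<open>Rotations preserve the cross product, so conjugating a skew matrix rotates its axial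
  vector. This turns the linearised frame equation, a matrix equation, into an integral for the
  vector \<open>\<omega>\<close>.\<close>

lemma rotation_conjugate_A_of:
  assumes "rotation_matrix Q"
  shows "transpose Q ** (A_of N ** Q) = crossmat (transpose Q *v bvec N)"
proof -
  have "transpose Q ** Q = mat 1" using assms by (simp add: rotation_matrix_def orthogonal_matrix_def)
  then have inv: "transpose Q *v (Q *v x) = x" for x by (simp only: matrix_vector_mul_assoc matrix_vector_mul_lid)
  have "(transpose Q ** (A_of N ** Q)) *v x = crossmat (transpose Q *v bvec N) *v x" for x
  proof -
    have "(transpose Q ** (A_of N ** Q)) *v x = transpose Q *v cross3 (bvec N) (Q *v x)"
      by (simp only: A_of_eq_cross3[symmetric] matrix_vector_mul_assoc)
    also have "\<dots> = cross3 (transpose Q *v bvec N) (transpose Q *v (Q *v x))"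
      by (rule cross_rotation_matrix[OF rotation_matrix_transpose[OF assms], symmetric])
    finally show ?thesis unfolding inv crossmat_mult_vec .
  qed
  then show ?thesis by (simp add: matrix_eq)
qed

text \<open>For symmetric N and the shear G with rows (1, 0) and (q, 1), \<open>shear1 N\<close> and
  \<open>shear2 N\<close> are the coefficients of q and q^2 in G N G^T.\<close>

definition shear1 :: "real^2^2 \<Rightarrow> real^2^2" where
  "shear1 N = vector [vector [0, N$1$1], vector [N$1$1, 2 * N$1$2]]"

definition shear2 :: "real^2^2 \<Rightarrow> real^2^2" where
  "shear2 N = vector [vector [0, 0], vector [0, N$1$1]]"

lemma bounded_linear_shear1: "bounded_linear shear1"
  unfolding linear_conv_bounded_linear[symmetric]
  by (rule linearI) (simp_all add: shear1_def vec_eq_iff forall_2 algebra_simps)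

lemma bounded_linear_shear2: "bounded_linear shear2"
  unfolding linear_conv_bounded_linear[symmetric]
  by (rule linearI) (simp_all add: shear2_def vec_eq_iff forall_2)

text \<open>The first-order part, in (p, q), of the change that factor 1 + p and slope shift q cause
  in the field.\<close>

definition varfield :: "real \<Rightarrow> real \<Rightarrow> real^2^2 \<Rightarrow> real^2^2" where
  "varfield p q N = p *\<^sub>R N + q *\<^sub>R shear1 N"

lemma varfield_entries:
  "varfield p q N $ 1 $ 1 = p * N$1$1" "varfield p q N $ 1 $ 2 = p * N$1$2 + q * N$1$1"
  by (simp_all add: varfield_def shear1_def)

lemma sqint_varfield:
  assumes "sqint M" "smooth0 \<phi>" "smooth0 \<psi>"
  shows "sqint (\<lambda>t. varfield (\<phi> t) (\<psi> t) (M t))"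
  unfolding varfield_def using assms
  by (intro sqint_add sqint_scaleR sqint_linear[OF _ bounded_linear_shear1] smooth_cl_continuous) (auto simp: smooth0_def)

text \<open>\<open>\<omega>\<close> is the axial vector of the infinitesimal rotation: to first order the frame \<open>r\<close> changes by
  \<open>r (\<omega> \<times> \<cdot>)\<close>.\<close>
definition variation :: "(real \<Rightarrow> real^3^3) \<Rightarrow> (real \<Rightarrow> real^2^2) \<Rightarrow> (real \<Rightarrow> real) \<Rightarrow> (real \<Rightarrow> real) \<Rightarrow> (real \<Rightarrow> real^3) \<Rightarrow> bool" where
  "variation r M \<phi> \<psi> \<omega> \<longleftrightarrow> smooth0 \<phi> \<and> smooth0 \<psi> \<and> \<omega> 0 = 0 \<and>
     primitive (\<lambda>t. transpose (r t) *v bvec (varfield (\<phi> t) (\<psi> t) (M t))) \<omega>"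

text \<open>The derivative of the endpoint data: the change of r(1) is recorded by its axial vector
  in the frame r(1), and the minus sign comes from transposing the skew matrix in the variation of
  r^T e1.\<close>

definition endpoint_variation :: "(real \<Rightarrow> real^3^3) \<Rightarrow> (real \<Rightarrow> real^3) \<Rightarrow> (real^3) \<times> (real^3)" where
  "endpoint_variation r \<omega> = (\<omega> 1, - integral {0..1} (\<lambda>t. cross3 (\<omega> t) (transpose (r t) *v axis 1 1)))"

lemma continuous_on_transpose:
  fixes r :: "real \<Rightarrow> real^3^3"
  assumes "continuous_on S r" shows "continuous_on S (\<lambda>t. transpose (r t))"
  by (rule bounded_linear.continuous_on[OF bounded_linear_transpose assms])

lemma variation_exists:
  assumes "sqint M" "continuous_on {0..1} r" "smooth0 \<phi>" "smooth0 \<psi>"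
  shows "variation r M \<phi> \<psi> (\<lambda>t. integral {0..t} (\<lambda>t. transpose (r t) *v bvec (varfield (\<phi> t) (\<psi> t) (M t))))"
  unfolding variation_def
proof (intro conjI assms primitive_integral)
  have "(\<lambda>t. bvec (varfield (\<phi> t) (\<psi> t) (M t))) absolutely_integrable_on {0..1}"
    by (intro sqint_ai sqint_linear[OF _ bounded_linear_bvec] sqint_varfield assms)
  from ai_bilinear[OF bounded_bilinear.flip[OF bounded_bilinear_matrix_vector_mult] this continuous_on_transpose[OF assms(2)]]
  show "(\<lambda>t. transpose (r t) *v bvec (varfield (\<phi> t) (\<psi> t) (M t))) absolutely_integrable_on {0..1}" .
qed simp

lemma cross_integrable:
  fixes \<omega> :: "real \<Rightarrow> real^3" and r :: "real \<Rightarrow> real^3^3"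
  assumes "continuous_on {0..1} \<omega>" "continuous_on {0..1} r"
  shows "continuous_on {0..1} (\<lambda>t. cross3 (\<omega> t) (transpose (r t) *v axis 1 1))"
  by (intro bounded_bilinear.continuous_on[OF bounded_bilinear_cross3]
      bounded_bilinear.continuous_on[OF bounded_bilinear_matrix_vector_mult] continuous_on_transpose assms continuous_intros)

lemma variation_continuous: "variation r M \<phi> \<psi> \<omega> \<Longrightarrow> continuous_on {0..1} \<omega>"
  by (auto simp: variation_def intro: primitive_continuous)

lemma variation_add:
  assumes r: "continuous_on {0..1} r" and v: "variation r M \<phi> \<psi> \<omega>" "variation r M \<phi>' \<psi>' \<omega>'"
  shows "variation r M (\<lambda>t. \<phi> t + \<phi>' t) (\<lambda>t. \<psi> t + \<psi>' t) (\<lambda>t. \<omega> t + \<omega>' t)"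
    "endpoint_variation r (\<lambda>t. \<omega> t + \<omega>' t) = endpoint_variation r \<omega> + endpoint_variation r \<omega>'"
proof -
  have "primitive (\<lambda>t. transpose (r t) *v bvec (varfield (\<phi> t + \<phi>' t) (\<psi> t + \<psi>' t) (M t))) (\<lambda>t. \<omega> t + \<omega>' t)"
  proof (rule primitive_cong[OF primitive_add])
    show "primitive (\<lambda>t. transpose (r t) *v bvec (varfield (\<phi> t) (\<psi> t) (M t))) \<omega>"
      "primitive (\<lambda>t. transpose (r t) *v bvec (varfield (\<phi>' t) (\<psi>' t) (M t))) \<omega>'"
      using v by (auto simp: variation_def)
    show "transpose (r t) *v bvec (varfield (\<phi> t) (\<psi> t) (M t)) + transpose (r t) *v bvec (varfield (\<phi>' t) (\<psi>' t) (M t))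
        = transpose (r t) *v bvec (varfield (\<phi> t + \<phi>' t) (\<psi> t + \<psi>' t) (M t))" for t
      unfolding matrix_vector_right_distrib[symmetric] linear_add[OF bounded_linear.linear[OF bounded_linear_bvec], symmetric]
      by (simp add: varfield_def algebra_simps)
  qed simp
  then show "variation r M (\<lambda>t. \<phi> t + \<phi>' t) (\<lambda>t. \<psi> t + \<psi>' t) (\<lambda>t. \<omega> t + \<omega>' t)"
    using v by (auto simp: variation_def intro: smooth0_add)
  show "endpoint_variation r (\<lambda>t. \<omega> t + \<omega>' t) = endpoint_variation r \<omega> + endpoint_variation r \<omega>'"
    unfolding endpoint_variation_def cross_add_left
      Henstock_Kurzweil_Integration.integral_add[OF integrable_continuous_real[OF cross_integrable[OF variation_continuous[OF v(1)] r]]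
        integrable_continuous_real[OF cross_integrable[OF variation_continuous[OF v(2)] r]]]
    by simp
qed

lemma variation_scale:
  assumes r: "continuous_on {0..1} r" and v: "variation r M \<phi> \<psi> \<omega>"
  shows "variation r M (\<lambda>t. c * \<phi> t) (\<lambda>t. c * \<psi> t) (\<lambda>t. c *\<^sub>R \<omega> t)"
    "endpoint_variation r (\<lambda>t. c *\<^sub>R \<omega> t) = c *\<^sub>R endpoint_variation r \<omega>"
proof -
  have "primitive (\<lambda>t. transpose (r t) *v bvec (varfield (c * \<phi> t) (c * \<psi> t) (M t))) (\<lambda>t. c *\<^sub>R \<omega> t)"
  proof (rule primitive_cong[OF primitive_linear[OF _ bounded_linear_scaleR_right[of c]]])
    show "primitive (\<lambda>t. transpose (r t) *v bvec (varfield (\<phi> t) (\<psi> t) (M t))) \<omega>"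
      using v by (auto simp: variation_def)
    have "varfield (c * \<phi> t) (c * \<psi> t) (M t) = c *\<^sub>R varfield (\<phi> t) (\<psi> t) (M t)" for t
      by (simp add: varfield_def algebra_simps)
    then show "c *\<^sub>R (transpose (r t) *v bvec (varfield (\<phi> t) (\<psi> t) (M t)))
        = transpose (r t) *v bvec (varfield (c * \<phi> t) (c * \<psi> t) (M t))" for t
      by (simp add: linear_scale[OF bounded_linear.linear[OF bounded_linear_bvec]] bounded_bilinear.scaleR_right[OF bounded_bilinear_matrix_vector_mult])
  qed simp
  then show "variation r M (\<lambda>t. c * \<phi> t) (\<lambda>t. c * \<psi> t) (\<lambda>t. c *\<^sub>R \<omega> t)"
    using v by (auto simp: variation_def intro: smooth0_cmult)
  show "endpoint_variation r (\<lambda>t. c *\<^sub>R \<omega> t) = c *\<^sub>R endpoint_variation r \<omega>"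
    unfolding endpoint_variation_def cross_mult_left by simp
qed

text \<open>The annihilator \<open>(a, c)\<close> of the range of the derivative is tested against \<open>\<omega>' = r\<^sup>T b\<close> after an
  integration by parts. In the moving frame the result is \<open>\<integral> b \<bullet> Q\<close> with \<open>Q = r q\<close>. On the set
  \<open>{M\<^sub>1\<^sub>1 \<noteq> 0}\<close> the first two components of \<open>Q\<close> vanish, and the differential equations for \<open>Q\<close> and
  \<open>C = r c\<close> then successively force all other components to vanish there.\<close>
lemma endpoint_variation_surj:
  assumes M: "sqint M" and r: "solves (\<lambda>t. A_of (M t)) r"
    and S: "\<not> negligible {t\<in>{0..1}. M t $ 1 $ 1 \<noteq> 0}"
  shows "\<exists>\<phi> \<psi> \<omega>. variation r M \<phi> \<psi> \<omega> \<and> endpoint_variation r \<omega> = w"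
proof -
  define R where "R = {endpoint_variation r \<omega> |\<phi> \<psi> \<omega>. variation r M \<phi> \<psi> \<omega>}"
  note contr = solves_continuous[OF r]
  have pr: "primitive (\<lambda>t. A_of (M t) ** r t) r" and r0: "r 0 = mat 1" using r by (auto simp: solves_def)
  have rot: "rotation_matrix (r t)" if "t \<in> {0..1}" for t
    by (rule sol_rotation[OF r transpose_A_of that])
  have zero: "variation r M (\<lambda>_. 0) (\<lambda>_. 0) (\<lambda>_. 0)"
    by (simp add: variation_def smooth0_const_0 varfield_def primitive_const linear_0[OF bounded_linear.linear[OF bounded_linear_bvec]])
  have sub: "subspace R"
    unfolding subspace_def
  proof (intro conjI ballI allI)
    have "endpoint_variation r (\<lambda>_. 0) = 0" by (simp add: endpoint_variation_def zero_prod_def)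
    then show "0 \<in> R" using zero unfolding R_def by force
    fix x assume "x \<in> R"
    then obtain \<phi> \<psi> \<omega> where x: "variation r M \<phi> \<psi> \<omega>" "x = endpoint_variation r \<omega>" unfolding R_def by blast
    show "c *\<^sub>R x \<in> R" for c
      unfolding R_def using variation_scale[OF contr x(1), of c] x(2) by force
    fix y assume "y \<in> R"
    then obtain \<phi>' \<psi>' \<omega>' where y: "variation r M \<phi>' \<psi>' \<omega>'" "y = endpoint_variation r \<omega>'" unfolding R_def by blast
    show "x + y \<in> R"
      unfolding R_def using variation_add[OF contr x(1) y(1)] x(2) y(2) by force
  qed
  have "R = UNIV"
  proof (rule ccontr)
    assume "R \<noteq> UNIV"
    then have "span R \<subset> span UNIV" using sub by (simp add: span_eq_iff[THEN iffD2] psubset_eq)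
    then obtain l where l: "l \<noteq> 0" "\<And>x. x \<in> span R \<Longrightarrow> orthogonal l x"
      using orthogonal_to_subspace_exists_gen[of R UNIV] by auto
    obtain a c where ac: "l = (a, c)" by (cases l)
    have ortho: "a \<bullet> \<omega> 1 = c \<bullet> integral {0..1} (\<lambda>t. cross3 (\<omega> t) (transpose (r t) *v axis 1 1))"
      if "variation r M \<phi> \<psi> \<omega>" for \<phi> \<psi> \<omega>
    proof -
      have "endpoint_variation r \<omega> \<in> span R" using that unfolding R_def by (blast intro: span_base)
      from l(2)[OF this] show ?thesis by (simp add: orthogonal_def ac endpoint_variation_def inner_prod_def)
    qed
    define \<rho> where "\<rho> = (\<lambda>t. transpose (r t) *v axis 1 1)"
    have contrho: "continuous_on {0..1} \<rho>"
      unfolding \<rho>_def by (intro bounded_bilinear.continuous_on[OF bounded_bilinear_matrix_vector_mult] continuous_on_transpose contr continuous_intros)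
    define \<gamma> where "\<gamma> = (\<lambda>t. integral {0..t} \<rho>)"
    have p\<gamma>: "primitive \<rho> \<gamma>"
      unfolding \<gamma>_def by (intro primitive_integral absolutely_integrable_continuous_real contrho)
    \<comment> \<open>Normalised by q(1) = a, so that the boundary term
      \<open>\<omega> 1 \<bullet> q 1\<close> of the integration by parts cancels the left-hand side
      of \<open>ortho\<close> and only the pairing with \<open>Q\<close> survives.\<close>
    define q where "q = (\<lambda>t. (a - cross3 (\<gamma> 1) c) + cross3 (\<gamma> t) c)"
    have pq: "primitive (\<lambda>t. cross3 (\<rho> t) c) q"
      using primitive_add[OF primitive_const[of "a - cross3 (\<gamma> 1) c"]
          primitive_linear[OF p\<gamma> bounded_bilinear.bounded_linear_left[OF bounded_bilinear_cross3, of c]]]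
      by (simp add: q_def)
    define Q where "Q = (\<lambda>t. r t *v q t)"
    define C where "C = (\<lambda>t. r t *v c)"
    have rC: "r t *v cross3 (\<rho> t) c = cross3 (axis 1 1) (C t)" if t: "t \<in> {0..1}" for t
    proof -
      have "r t ** transpose (r t) = mat 1" using rot[OF t] by (simp add: rotation_matrix_def orthogonal_matrix_def)
      then have "r t *v \<rho> t = axis 1 1" by (simp only: \<rho>_def matrix_vector_mul_assoc matrix_vector_mul_lid)
      then show ?thesis using cross_rotation_matrix[OF rot[OF t], of "\<rho> t" c] by (simp add: C_def)
    qed
    have pQ: "primitive (\<lambda>t. A_of (M t) *v Q t + cross3 (axis 1 1) (C t)) Q"
      by (rule primitive_cong[OF primitive_bilinear[OF bounded_bilinear_matrix_vector_mult pr pq]])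
         (simp_all add: Q_def rC matrix_vector_mul_assoc)
    have pC: "primitive (\<lambda>t. A_of (M t) *v C t) C"
      by (rule primitive_cong[OF primitive_linear[OF pr bounded_bilinear.bounded_linear_left[OF bounded_bilinear_matrix_vector_mult, of c]]])
         (simp_all add: C_def matrix_vector_mul_assoc)
    have test: "integral {0..1} (\<lambda>t. bvec (varfield (\<phi> t) (\<psi> t) (M t)) \<bullet> Q t) = 0"
      if "smooth0 \<phi>" "smooth0 \<psi>" for \<phi> \<psi>
    proof -
      obtain \<omega> where \<omega>: "variation r M \<phi> \<psi> \<omega>" using variation_exists[OF M contr \<open>smooth0 \<phi>\<close> \<open>smooth0 \<psi>\<close>] by blast
      let ?b = "\<lambda>t. bvec (varfield (\<phi> t) (\<psi> t) (M t))"
      have p\<omega>: "primitive (\<lambda>t. transpose (r t) *v ?b t) \<omega>" and \<omega>0: "\<omega> 0 = 0" using \<omega> by (auto simp: variation_def)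
      note c\<omega> = variation_continuous[OF \<omega>]
      have cc: "continuous_on {0..1} (\<lambda>t. cross3 (\<omega> t) (\<rho> t))"
        by (intro bounded_bilinear.continuous_on[OF bounded_bilinear_cross3] c\<omega> contrho)
      have "primitive (\<lambda>t. (transpose (r t) *v ?b t) \<bullet> q t + \<omega> t \<bullet> cross3 (\<rho> t) c) (\<lambda>t. \<omega> t \<bullet> q t)"
        by (rule primitive_bilinear[OF bounded_bilinear_inner p\<omega> pq])
      then have p: "primitive (\<lambda>t. ?b t \<bullet> Q t + c \<bullet> cross3 (\<omega> t) (\<rho> t)) (\<lambda>t. \<omega> t \<bullet> q t)"
      proof (rule primitive_cong)
        fix t :: real
        have "(transpose (r t) *v ?b t) \<bullet> q t = ?b t \<bullet> Q t"
          by (simp add: Q_def dot_lmul_matrix[symmetric])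
        moreover have "\<omega> t \<bullet> cross3 (\<rho> t) c = c \<bullet> cross3 (\<omega> t) (\<rho> t)"
          by (simp add: cross3_simps)
        ultimately show "(transpose (r t) *v ?b t) \<bullet> q t + \<omega> t \<bullet> cross3 (\<rho> t) c = ?b t \<bullet> Q t + c \<bullet> cross3 (\<omega> t) (\<rho> t)" by simp
      qed simp
      have i2: "(\<lambda>t. c \<bullet> cross3 (\<omega> t) (\<rho> t)) absolutely_integrable_on {0..1}"
        by (intro absolutely_integrable_continuous_real continuous_intros cc)
      have i1: "(\<lambda>t. ?b t \<bullet> Q t) absolutely_integrable_on {0..1}"
        using set_integral_diff(1)[OF primitive_ai[OF p] i2] by simp
      have "\<omega> 1 \<bullet> q 1 = integral {0..1} (\<lambda>t. ?b t \<bullet> Q t + c \<bullet> cross3 (\<omega> t) (\<rho> t))"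
        using primitive_value[OF p, of 1] \<omega>0 by simp
      also have "\<dots> = integral {0..1} (\<lambda>t. ?b t \<bullet> Q t) + integral {0..1} (\<lambda>t. c \<bullet> cross3 (\<omega> t) (\<rho> t))"
        using i1 i2 by (intro Henstock_Kurzweil_Integration.integral_add) (auto simp: absolutely_integrable_on_def)
      also have "integral {0..1} (\<lambda>t. c \<bullet> cross3 (\<omega> t) (\<rho> t)) = c \<bullet> integral {0..1} (\<lambda>t. cross3 (\<omega> t) (\<rho> t))"
        using integral_linear[OF integrable_continuous_real[OF cc] bounded_linear_inner_right[of c]] by (simp add: o_def)
      also have "\<dots> = a \<bullet> \<omega> 1" using ortho[OF \<omega>] by (simp add: \<rho>_def)
      finally show ?thesis by (simp add: q_def inner_commute)
    qed
    have cQ: "continuous_on {0..1} (\<lambda>t. Q t $ i)" for i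
      by (intro continuous_intros primitive_continuous[OF pQ])
    have aiM: "(\<lambda>t. M t $ i $ j) absolutely_integrable_on {0..1}" for i j
      by (rule sqint_ai, rule sqint_linear[OF M, of "\<lambda>N. N $ i $ j"])
         (intro bounded_linear_compose[OF bounded_linear_vec_nth] bounded_linear_vec_nth)
    \<comment> \<open>Sorted by the two parameters: testing with \<open>\<phi>\<close> alone and
      with \<open>\<psi>\<close> alone makes the two coefficients vanish almost everywhere.\<close>
    have bQ: "bvec (varfield p s N) \<bullet> x = (N$1$1 * x$2 - N$1$2 * x$1) * p - (N$1$1 * x$1) * s" for p s N x
      by (simp add: bvec_def varfield_entries inner_vec_def sum_3 algebra_simps)
    have N6: "negligible {t\<in>{0..1}. M t$1$1 * Q t$2 - M t$1$2 * Q t$1 \<noteq> 0}"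
    proof (rule smooth0_fundamental)
      show "(\<lambda>t. M t$1$1 * Q t$2 - M t$1$2 * Q t$1) absolutely_integrable_on {0..1}"
        by (intro set_integral_diff(1) ai_bilinear[OF bounded_bilinear_mult aiM] cQ)
      show "integral {0..1} (\<lambda>t. (M t$1$1 * Q t$2 - M t$1$2 * Q t$1) * \<phi> t) = 0" if "smooth0 \<phi>" for \<phi>
        using test[OF that smooth0_const_0] by (simp add: bQ)
    qed
    have N5: "negligible {t\<in>{0..1}. M t$1$1 * Q t$1 \<noteq> 0}"
    proof (rule smooth0_fundamental)
      show "(\<lambda>t. M t$1$1 * Q t$1) absolutely_integrable_on {0..1}"
        by (intro ai_bilinear[OF bounded_bilinear_mult aiM] cQ)
      show "integral {0..1} (\<lambda>t. M t$1$1 * Q t$1 * \<psi> t) = 0" if "smooth0 \<psi>" for \<psi>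
        using test[OF smooth0_const_0 that] by (simp add: bQ)
    qed
    have Qi: "negligible {t\<in>{0..1}. Q t $ i = 0 \<and> (A_of (M t) *v Q t + cross3 (axis 1 1) (C t)) $ i \<noteq> 0}" for i
      by (rule primitive_zero_set[OF primitive_linear[OF pQ bounded_linear_vec_nth]])
    have Ci: "negligible {t\<in>{0..1}. C t $ i = 0 \<and> (A_of (M t) *v C t) $ i \<noteq> 0}" for i
      by (rule primitive_zero_set[OF primitive_linear[OF pC bounded_linear_vec_nth]])
    have "negligible ({t\<in>{0..1}. M t$1$1 * Q t$2 - M t$1$2 * Q t$1 \<noteq> 0} \<union> {t\<in>{0..1}. M t$1$1 * Q t$1 \<noteq> 0}
       \<union> (\<Union>i. {t\<in>{0..1}. Q t $ i = 0 \<and> (A_of (M t) *v Q t + cross3 (axis 1 1) (C t)) $ i \<noteq> 0})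
       \<union> (\<Union>i. {t\<in>{0..1}. C t $ i = 0 \<and> (A_of (M t) *v C t) $ i \<noteq> 0}))" (is "negligible ?N")
    proof (intro negligible_Un N5 N6)
      show "negligible (\<Union>i. {t\<in>{0..1}. Q t $ i = 0 \<and> (A_of (M t) *v Q t + cross3 (axis 1 1) (C t)) $ i \<noteq> 0})"
        by (rule negligible_Union, simp, elim imageE, simp only: Qi)
      show "negligible (\<Union>i. {t\<in>{0..1}. C t $ i = 0 \<and> (A_of (M t) *v C t) $ i \<noteq> 0})"
        by (rule negligible_Union, simp, elim imageE, simp only: Ci)
    qed
    then have "\<not> {t\<in>{0..1}. M t $ 1 $ 1 \<noteq> 0} \<subseteq> ?N" using S negligible_subset by blast
    then obtain t where t: "t \<in> {0..1}" "M t $ 1 $ 1 \<noteq> 0" "t \<notin> ?N" by blast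
    have Q1: "Q t $ 1 = 0" using t by auto
    have Q2: "Q t $ 2 = 0" using t Q1 by auto
    have n: "Q t $ i = 0 \<Longrightarrow> (A_of (M t) *v Q t + cross3 (axis 1 1) (C t)) $ i = 0"
      "C t $ i = 0 \<Longrightarrow> (A_of (M t) *v C t) $ i = 0" for i using t by blast+
    \<comment> \<open>The equations read Q1' = M11 Q3, Q2' = M12 Q3 - C3, Q3' = - M11 Q1 - M12 Q2 +
      C2 and C3' = - M11 C1 - M12 C2. At \<open>t\<close> each component already known to vanish
      also has vanishing right-hand side; M11 is divided out in the first and in the last
      step.\<close>
    have Q3: "Q t $ 3 = 0" using n(1)[OF Q1] t(2) by (simp add: A_of_mult_vec cross3_def axis_def)
    have C3: "C t $ 3 = 0" using n(1)[OF Q2] Q3 by (simp add: A_of_mult_vec cross3_def axis_def)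
    have C2: "C t $ 2 = 0" using n(1)[OF Q3] Q1 Q2 by (simp add: A_of_mult_vec cross3_def axis_def)
    have C1: "C t $ 1 = 0" using n(2)[OF C3] C2 t(2) by (simp add: A_of_mult_vec)
    have inj: "x = 0" if "r t *v x = 0" for x
    proof -
      have "transpose (r t) ** r t = mat 1" using rot[OF t(1)] by (simp add: rotation_matrix_def orthogonal_matrix_def)
      then have "x = transpose (r t) *v (r t *v x)" by (simp add: matrix_vector_mul_assoc)
      then show ?thesis using that by simp
    qed
    have "C t = 0" "Q t = 0" using Q1 Q2 Q3 C1 C2 C3 by (simp_all add: vec_eq_iff forall_3)
    \<comment> \<open>One time suffices: \<open>r t\<close> is invertible and \<open>c\<close> is
      constant, and once \<open>c = 0\<close> the function \<open>q\<close> is constantly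
      \<open>a\<close>.\<close>
    then have "c = 0" "q t = 0" using inj by (auto simp: C_def Q_def)
    then have "l = 0" by (simp add: q_def ac zero_prod_def)
    then show False using l(1) by simp
  qed
  then have "w \<in> R" by simp
  then show ?thesis unfolding R_def by force
qed

subsection \<open>Approximation by degenerate fields\<close>

text \<open>For symmetric \<open>N\<close> this is the squared nuclear norm, the convex envelope of the squared
  Frobenius norm restricted to degenerate matrices.\<close>
definition nuc :: "real^2^2 \<Rightarrow> real" where
  "nuc N = (norm N)\<^sup>2 + 2 * \<bar>det N\<bar>"

lemma norm_square_22: "(norm N)\<^sup>2 = (N$1$1)\<^sup>2 + (N$1$2)\<^sup>2 + (N$2$1)\<^sup>2 + (N$2$2)\<^sup>2" for N :: "real^2^2"
  by (simp only: power2_norm_eq_inner inner_vec_def) (simp add: sum_2 power2_eq_square)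

lemma Sym2_iff: "N \<in> Sym2 \<longleftrightarrow> N$2$1 = N$1$2"
  unfolding Sym2_def vec_eq_iff forall_2 transpose_def by auto

lemma nuc_nonneg: "0 \<le> nuc N"
  by (simp add: nuc_def)

lemma nuc_le: "nuc N \<le> 2 * (norm N)\<^sup>2"
proof -
  have "2 * (N$1$1 * N$2$2 - N$1$2 * N$2$1) \<le> (norm N)\<^sup>2"
    unfolding norm_square_22 using zero_le_power2[of "N$1$1 - N$2$2"] zero_le_power2[of "N$1$2 + N$2$1"]
    by (simp add: power2_sum power2_diff)
  moreover have "- 2 * (N$1$1 * N$2$2 - N$1$2 * N$2$1) \<le> (norm N)\<^sup>2"
    unfolding norm_square_22 using zero_le_power2[of "N$1$1 + N$2$2"] zero_le_power2[of "N$1$2 - N$2$1"]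
    by (simp add: power2_sum power2_diff)
  ultimately show ?thesis by (simp add: nuc_def det_2 abs_if)
qed

lemma continuous_nuc: "continuous_on UNIV nuc"
  unfolding nuc_def[abs_def] det_2 by (intro continuous_intros)

lemma nuc_measurable:
  assumes "f \<in> borel_measurable M" shows "(\<lambda>t. nuc (f t)) \<in> borel_measurable M"
  by (rule borel_measurable_continuous_on[OF continuous_nuc assms])

lemma nuc_ai:
  assumes "sqint M" shows "(\<lambda>t. nuc (M t)) absolutely_integrable_on {0..1}"
proof (rule ai_bounded_by)
  show "(\<lambda>t. nuc (M t)) \<in> borel_measurable (lebesgue_on {0..1})"
    using assms by (intro nuc_measurable) (simp add: sqint_def)
  show "(\<lambda>t. 2 * (norm (M t))\<^sup>2) absolutely_integrable_on {0..1}" using assms by (auto simp: sqint_def)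
  show "norm (nuc (M t)) \<le> 2 * (norm (M t))\<^sup>2" for t using nuc_le nuc_nonneg by simp
qed

lemma calF_eq:
  assumes "sqint M" shows "calF M = integral {0..1} (\<lambda>t. nuc (M t))"
  using LINT_01[OF nuc_ai[OF assms], of 1] by (simp add: calF_def nuc_def)

text \<open>Written as a combination of constant matrices, so that continuity and measurability
  follow from those of the scalar coefficients.\<close>

definition dyad :: "real \<Rightarrow> real \<Rightarrow> real^2^2" where
  "dyad m s = m *\<^sub>R vector [vector [1, 0], vector [0, 0]]
     + (m * s) *\<^sub>R vector [vector [0, 1], vector [1, 0]]
     + (m * s\<^sup>2) *\<^sub>R vector [vector [0, 0], vector [0, 1]]"

lemma dyad_entries [simp]:
  "dyad m s $ 1 $ 1 = m" "dyad m s $ 1 $ 2 = m * s" "dyad m s $ 2 $ 1 = m * s" "dyad m s $ 2 $ 2 = m * s\<^sup>2"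
  by (simp_all add: dyad_def)

lemma norm_dyad: "(norm (dyad m s))\<^sup>2 = (m * (1 + s\<^sup>2))\<^sup>2"
  unfolding norm_square_22 by (simp add: power2_eq_square algebra_simps)

lemma nuc_dyad: "nuc (dyad m s) = (norm (dyad m s))\<^sup>2"
  by (simp add: nuc_def det_2 power2_eq_square)

lemma measurable_dyad:
  assumes "m \<in> borel_measurable M" "s \<in> borel_measurable M"
  shows "(\<lambda>t. dyad (m t) (s t)) \<in> borel_measurable M"
  unfolding dyad_def using assms by measurable

lemma sqint_dyad_bounded:
  assumes "m \<in> borel_measurable (lebesgue_on {0..1})" "s \<in> borel_measurable (lebesgue_on {0..1})"
    and b: "\<And>t. t \<in> {0..1} \<Longrightarrow> \<bar>m t\<bar> \<le> K" "\<And>t. t \<in> {0..1} \<Longrightarrow> \<bar>s t\<bar> \<le> K"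
  shows "sqint (\<lambda>t. dyad (m t) (s t))" "\<And>t. t \<in> {0..1} \<Longrightarrow> norm (dyad (m t) (s t)) \<le> K * (1 + K\<^sup>2)"
proof -
  show n: "norm (dyad (m t) (s t)) \<le> K * (1 + K\<^sup>2)" if t: "t \<in> {0..1}" for t
  proof -
    have "norm (dyad (m t) (s t)) = \<bar>m t\<bar> * (1 + (s t)\<^sup>2)"
    proof (rule power2_eq_imp_eq)
      show "(norm (dyad (m t) (s t)))\<^sup>2 = (\<bar>m t\<bar> * (1 + (s t)\<^sup>2))\<^sup>2" by (simp add: norm_dyad power_mult_distrib)
    qed (simp_all add: add_nonneg_nonneg)
    also have "\<dots> \<le> K * (1 + K\<^sup>2)"
    proof (intro mult_mono add_left_mono b t)
      show "(s t)\<^sup>2 \<le> K\<^sup>2" using power_mono[OF b(2)[OF t], of 2] by simp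
      show "0 \<le> K" using b(1)[OF t] by linarith
    qed simp
    finally show ?thesis .
  qed
  have "sqint (\<lambda>_::real. 1 :: real)" by (rule sqint_continuous) simp
  then show "sqint (\<lambda>t. dyad (m t) (s t))"
    by (rule sqint_bound[where c = "K * (1 + K\<^sup>2)"]) (use measurable_dyad[OF assms(1,2)] n in auto)
qed

lemma approximation_limit:
  fixes F :: "nat \<Rightarrow> real \<Rightarrow> real^2^2"
  assumes F: "\<And>n. sqint (F n)" and M: "sqint M" and G: "sqint G"
    and b: "\<And>n t. t \<in> {0..1} \<Longrightarrow> norm (F n t) \<le> G t" "\<And>t. t \<in> {0..1} \<Longrightarrow> norm (M t) \<le> G t"
    and N: "negligible N" and l: "\<And>t. t \<in> {0..1} - N \<Longrightarrow> (\<lambda>n. F n t) \<longlonglongrightarrow> M t"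
  shows "(\<lambda>n. integral {0..1} (\<lambda>t. norm (F n t - M t))) \<longlonglongrightarrow> 0"
    and "(\<lambda>n. integral {0..1} (\<lambda>t. nuc (F n t))) \<longlonglongrightarrow> integral {0..1} (\<lambda>t. nuc (M t))"
proof -
  have "(\<lambda>n. integral {0..1} (\<lambda>t. norm (F n t - M t))) \<longlonglongrightarrow> integral {0..1} (\<lambda>t. norm (M t - M t))"
  proof (rule dominated_convergence_ae[OF _ _ _ N])
    show "(\<lambda>t. norm (F n t - M t)) absolutely_integrable_on {0..1}" for n
      by (intro sqint_norm_ai sqint_diff F M)
    show "(\<lambda>t. 2 * G t) absolutely_integrable_on {0..1}" using sqint_ai[OF G] by auto
    show "norm (norm (F n t - M t)) \<le> 2 * G t" if "t \<in> {0..1}" for n t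
      using norm_triangle_ineq4[of "F n t" "M t"] b(1)[OF that, of n] b(2)[OF that] by simp
    show "(\<lambda>n. norm (F n t - M t)) \<longlonglongrightarrow> norm (M t - M t)" if "t \<in> {0..1} - N" for t
      by (intro tendsto_intros l that)
  qed
  then show "(\<lambda>n. integral {0..1} (\<lambda>t. norm (F n t - M t))) \<longlonglongrightarrow> 0" by simp
  show "(\<lambda>n. integral {0..1} (\<lambda>t. nuc (F n t))) \<longlonglongrightarrow> integral {0..1} (\<lambda>t. nuc (M t))"
  proof (rule dominated_convergence_ae[OF _ _ _ N])
    show "(\<lambda>t. nuc (F n t)) absolutely_integrable_on {0..1}" for n by (intro nuc_ai F)
    show "(\<lambda>t. 2 * (G t)\<^sup>2) absolutely_integrable_on {0..1}" using G by (auto simp: sqint_def)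
    show "norm (nuc (F n t)) \<le> 2 * (G t)\<^sup>2" if "t \<in> {0..1}" for n t
      using nuc_le[of "F n t"] nuc_nonneg[of "F n t"] power_mono[OF b(1)[OF that, of n], of 2] by simp
    show "(\<lambda>n. nuc (F n t)) \<longlonglongrightarrow> nuc (M t)" if "t \<in> {0..1} - N" for t
      using continuous_on_tendsto_compose[OF continuous_nuc l[OF that]] by simp
  qed
qed

lemma approximation_limit_eps:
  fixes F :: "nat \<Rightarrow> real \<Rightarrow> real^2^2"
  assumes F: "\<And>n. sqint (F n)" and M: "sqint M" and G: "sqint G"
    and b: "\<And>n t. t \<in> {0..1} \<Longrightarrow> norm (F n t) \<le> G t" "\<And>t. t \<in> {0..1} \<Longrightarrow> norm (M t) \<le> G t"
    and N: "negligible N" and l: "\<And>t. t \<in> {0..1} - N \<Longrightarrow> (\<lambda>n. F n t) \<longlonglongrightarrow> M t"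
    and e: "e > 0"
  shows "\<exists>n. integral {0..1} (\<lambda>t. norm (F n t - M t)) \<le> e
    \<and> \<bar>integral {0..1} (\<lambda>t. nuc (F n t)) - integral {0..1} (\<lambda>t. nuc (M t))\<bar> \<le> e"
proof -
  note lim = approximation_limit[OF F M G b N l]
  have "\<forall>\<^sub>F n in sequentially. dist (integral {0..1} (\<lambda>t. norm (F n t - M t))) 0 < e"
    using lim(1) e by (rule tendstoD)
  moreover have "\<forall>\<^sub>F n in sequentially. dist (integral {0..1} (\<lambda>t. nuc (F n t))) (integral {0..1} (\<lambda>t. nuc (M t))) < e"
    using lim(2) e by (rule tendstoD)
  ultimately have "\<forall>\<^sub>F n in sequentially. integral {0..1} (\<lambda>t. norm (F n t - M t)) \<le> e
    \<and> \<bar>integral {0..1} (\<lambda>t. nuc (F n t)) - integral {0..1} (\<lambda>t. nuc (M t))\<bar> \<le> e"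
    by eventually_elim (auto simp: dist_real_def)
  then show ?thesis using eventually_happens by force
qed

lemma integral_norm_diff_triangle:
  assumes "sqint A" "sqint B" "sqint C"
  shows "integral {0..1} (\<lambda>t. norm (A t - C t))
    \<le> integral {0..1} (\<lambda>t. norm (A t - B t)) + integral {0..1} (\<lambda>t. norm (B t - C t))"
proof -
  have i: "(\<lambda>t. norm (A t - B t)) integrable_on {0..1}" "(\<lambda>t. norm (B t - C t)) integrable_on {0..1}"
    "(\<lambda>t. norm (A t - C t)) integrable_on {0..1}"
    using sqint_norm_ai[OF sqint_diff] assms by (auto simp: absolutely_integrable_on_def)
  have "integral {0..1} (\<lambda>t. norm (A t - C t)) \<le> integral {0..1} (\<lambda>t. norm (A t - B t) + norm (B t - C t))"
  proof (intro integral_le integrable_add i)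
    show "norm (A t - C t) \<le> norm (A t - B t) + norm (B t - C t)" for t
      using norm_triangle_ineq[of "A t - B t" "B t - C t"] by simp
  qed
  then show ?thesis by (simp add: Henstock_Kurzweil_Integration.integral_add[OF i(1,2)])
qed

lemma approx_bounded:
  fixes M :: "real \<Rightarrow> real^2^2"
  assumes M: "sqint M" and e: "e > 0"
  shows "\<exists>k::nat. let N = (\<lambda>t. if norm (M t) \<le> real k then M t else 0) in sqint N
    \<and> integral {0..1} (\<lambda>t. norm (N t - M t)) \<le> e
    \<and> \<bar>integral {0..1} (\<lambda>t. nuc (N t)) - integral {0..1} (\<lambda>t. nuc (M t))\<bar> \<le> e"
proof -
  define F where "F = (\<lambda>(k::nat) t. if norm (M t) \<le> real k then M t else 0)"
  have mM: "M \<in> borel_measurable (lebesgue_on {0..1})" using M by (simp add: sqint_def)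
  have nM: "sqint (\<lambda>t. norm (M t))"
    by (rule sqint_bound[OF M, of _ 1]) (use mM in auto)
  have F: "sqint (F k)" for k
  proof (rule sqint_bound[OF M, of _ 1])
    show "F k \<in> borel_measurable (lebesgue_on {0..1})" unfolding F_def using mM by measurable
  qed (simp add: F_def)
  have "\<exists>n. integral {0..1} (\<lambda>t. norm (F n t - M t)) \<le> e
    \<and> \<bar>integral {0..1} (\<lambda>t. nuc (F n t)) - integral {0..1} (\<lambda>t. nuc (M t))\<bar> \<le> e"
  proof (rule approximation_limit_eps[OF F M nM _ _ negligible_empty _ e])
    show "norm (F n t) \<le> norm (M t)" for n t by (simp add: F_def)
    show "(\<lambda>n. F n t) \<longlonglongrightarrow> M t" for t
    proof (rule tendsto_eventually)
      obtain k0 :: nat where "norm (M t) \<le> real k0" using real_arch_simple by blast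
      then show "\<forall>\<^sub>F n in sequentially. F n t = M t"
        unfolding eventually_sequentially F_def by (intro exI[of _ k0]) (auto intro: order_trans)
    qed
  qed simp
  then show ?thesis unfolding Let_def using F unfolding F_def by blast
qed

lemma approx_continuous:
  assumes M: "sqint M" and sym: "negligible {t\<in>{0..1}. M t \<notin> Sym2}" and e: "e > 0"
  obtains N where "continuous_on {0..1} N" "\<And>t. N t \<in> Sym2"
    "integral {0..1} (\<lambda>t. norm (N t - M t)) \<le> e"
    "\<bar>integral {0..1} (\<lambda>t. nuc (N t)) - integral {0..1} (\<lambda>t. nuc (M t))\<bar> \<le> e"
proof -
  obtain k :: nat where k: "let N = (\<lambda>t. if norm (M t) \<le> real k then M t else 0) in sqint N
    \<and> integral {0..1} (\<lambda>t. norm (N t - M t)) \<le> e/2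
    \<and> \<bar>integral {0..1} (\<lambda>t. nuc (N t)) - integral {0..1} (\<lambda>t. nuc (M t))\<bar> \<le> e/2"
    using approx_bounded[OF M, of "e/2"] e by auto
  define P where "P = (\<lambda>t. if norm (M t) \<le> real k then M t else 0)"
  have P: "sqint P" "integral {0..1} (\<lambda>t. norm (P t - M t)) \<le> e/2"
    "\<bar>integral {0..1} (\<lambda>t. nuc (P t)) - integral {0..1} (\<lambda>t. nuc (M t))\<bar> \<le> e/2"
    using k unfolding P_def Let_def by auto
  define K where "K = real k + 1"
  have K: "K > 0" and PK: "norm (P t) \<le> K" for t by (auto simp: K_def P_def)
  have "P measurable_on {0..1}" using P(1) by (simp add: sqint_def measurable_on_iff_borel_measurable)
  then obtain Z g where Z: "negligible Z" and g: "\<And>n. continuous_on UNIV (g n)"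
      "\<And>t. t \<notin> Z \<Longrightarrow> (\<lambda>n. g n t) \<longlonglongrightarrow> (if t \<in> {0..1} then P t else 0)"
    unfolding measurable_on_def by blast
  \<comment> \<open>Symmetrising restores the linear constraint, and the radial rescaling in
    \<open>F\<close> keeps the fields below the constant \<open>K\<close>. Neither changes the
    limit, because \<open>P\<close> is almost everywhere symmetric and bounded by
    \<open>K\<close>.\<close>
  define h where "h = (\<lambda>n t. (1/2) *\<^sub>R (g n t + transpose (g n t)))"
  define F where "F = (\<lambda>n t. (K / max K (norm (h n t))) *\<^sub>R h n t)"
  have blt: "bounded_linear (transpose :: real^2^2 \<Rightarrow> real^2^2)"
    unfolding linear_conv_bounded_linear[symmetric]
    by (rule linearI) (simp_all add: transpose_def vec_eq_iff)
  have hc: "continuous_on {0..1} (h n)" for n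
    unfolding h_def using continuous_on_subset[OF g(1)[of n], of "{0..1}"]
    by (intro continuous_intros bounded_linear.continuous_on[OF blt]) auto
  have Fc: "continuous_on {0..1} (F n)" for n
    unfolding F_def by (intro continuous_intros hc) (use K in \<open>auto simp: max_def\<close>)
  have FK: "norm (F n t) \<le> K" for n t
    using K by (simp add: F_def max_def field_simps)
  have hs: "h n t \<in> Sym2" for n t by (simp add: h_def Sym2_def transpose_def vec_eq_iff)
  then have Fs: "F n t \<in> Sym2" for n t
    by (simp add: F_def Sym2_def transpose_def vec_eq_iff)
  have "\<exists>n. integral {0..1} (\<lambda>t. norm (F n t - P t)) \<le> e/2
    \<and> \<bar>integral {0..1} (\<lambda>t. nuc (F n t)) - integral {0..1} (\<lambda>t. nuc (P t))\<bar> \<le> e/2"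
  proof (rule approximation_limit_eps[OF _ P(1), where G = "\<lambda>_. K"])
    show "sqint (F n)" for n by (rule sqint_continuous[OF Fc])
    show "sqint (\<lambda>_. K)" by (rule sqint_continuous) simp
    show "negligible (Z \<union> {t\<in>{0..1}. M t \<notin> Sym2})" by (intro negligible_Un Z sym)
    fix t assume t: "t \<in> {0..1} - (Z \<union> {t\<in>{0..1}. M t \<notin> Sym2})"
    have s: "transpose (P t) = P t" using t by (auto simp: P_def Sym2_def transpose_def vec_eq_iff)
    have "(\<lambda>n. g n t) \<longlonglongrightarrow> P t" using g(2)[of t] t by auto
    then have "(\<lambda>n. h n t) \<longlonglongrightarrow> (1/2) *\<^sub>R (P t + transpose (P t))"
      unfolding h_def by (intro tendsto_intros bounded_linear.tendsto[OF blt])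
    then have hl: "(\<lambda>n. h n t) \<longlonglongrightarrow> P t" unfolding s by (simp flip: scaleR_2)
    have "(\<lambda>n. F n t) \<longlonglongrightarrow> (K / max K (norm (P t))) *\<^sub>R P t"
      unfolding F_def by (intro tendsto_intros hl) (use K in \<open>auto simp: max_def\<close>)
    then show "(\<lambda>n. F n t) \<longlonglongrightarrow> P t" using K PK[of t] by (simp add: max_def split: if_splits)
  qed (use e FK PK in auto)
  then obtain n where n: "integral {0..1} (\<lambda>t. norm (F n t - P t)) \<le> e/2"
    "\<bar>integral {0..1} (\<lambda>t. nuc (F n t)) - integral {0..1} (\<lambda>t. nuc (P t))\<bar> \<le> e/2" by blast
  show ?thesis
  proof (rule that[OF Fc Fs])
    show "integral {0..1} (\<lambda>t. norm (F n t - M t)) \<le> e"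
      using integral_norm_diff_triangle[OF sqint_continuous[OF Fc] P(1) M, of n] n(1) P(2) by simp
    show "\<bar>integral {0..1} (\<lambda>t. nuc (F n t)) - integral {0..1} (\<lambda>t. nuc (M t))\<bar> \<le> e"
      using n(2) P(3) by linarith
  qed
qed

text \<open>Factor and slope are smoothed separately, since smoothing the matrix field itself would
  leave the set of degenerate matrices.\<close>

lemma approx_smooth_dyad:
  assumes m: "m \<in> borel_measurable (lebesgue_on {0..1})" and s: "s \<in> borel_measurable (lebesgue_on {0..1})"
    and b: "\<And>t. t \<in> {0..1} \<Longrightarrow> \<bar>m t\<bar> \<le> K" "\<And>t. t \<in> {0..1} \<Longrightarrow> \<bar>s t\<bar> \<le> K" and e: "e > 0"
  obtains m' s' where "smooth0 m'" "smooth0 s'"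
    "integral {0..1} (\<lambda>t. norm (dyad (m' t) (s' t) - dyad (m t) (s t))) \<le> e"
    "\<bar>integral {0..1} (\<lambda>t. nuc (dyad (m' t) (s' t))) - integral {0..1} (\<lambda>t. nuc (dyad (m t) (s t)))\<bar> \<le> e"
proof -
  obtain p N where p: "\<And>n. smooth0 (p n)" "\<And>n t. t \<in> {0..1} \<Longrightarrow> \<bar>p n t\<bar> \<le> K + 1"
    "negligible N" "\<And>t. t \<in> {0..1} - N \<Longrightarrow> (\<lambda>n. p n t) \<longlonglongrightarrow> m t" using smooth0_approx[OF m b(1)] by blast
  obtain q N' where q: "\<And>n. smooth0 (q n)" "\<And>n t. t \<in> {0..1} \<Longrightarrow> \<bar>q n t\<bar> \<le> K + 1"
    "negligible N'" "\<And>t. t \<in> {0..1} - N' \<Longrightarrow> (\<lambda>n. q n t) \<longlonglongrightarrow> s t" using smooth0_approx[OF s b(2)] by blast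
  have mes: "f \<in> borel_measurable (lebesgue_on {0..1})" if "smooth0 f" for f
    using that smooth_cl_continuous by (intro continuous_imp_measurable_on_sets_lebesgue) (auto simp: smooth0_def)
  have b': "\<And>t. t \<in> {0..1} \<Longrightarrow> \<bar>m t\<bar> \<le> K + 1" "\<And>t. t \<in> {0..1} \<Longrightarrow> \<bar>s t\<bar> \<le> K + 1"
    using b by fastforce+
  note P = sqint_dyad_bounded[OF mes[OF p(1)] mes[OF q(1)] p(2) q(2)]
  note Q = sqint_dyad_bounded[OF m s b']
  have "\<exists>n. integral {0..1} (\<lambda>t. norm (dyad (p n t) (q n t) - dyad (m t) (s t))) \<le> e
    \<and> \<bar>integral {0..1} (\<lambda>t. nuc (dyad (p n t) (q n t))) - integral {0..1} (\<lambda>t. nuc (dyad (m t) (s t)))\<bar> \<le> e"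
  proof (rule approximation_limit_eps[where F = "\<lambda>n t. dyad (p n t) (q n t)" and M = "\<lambda>t. dyad (m t) (s t)", OF P(1) Q(1) _ P(2) Q(2)])
    show "sqint (\<lambda>_. (K + 1) * (1 + (K + 1)\<^sup>2))" by (rule sqint_continuous) simp
    show "negligible (N \<union> N')" using p(3) q(3) by (rule negligible_Un)
    show "(\<lambda>n. dyad (p n t) (q n t)) \<longlonglongrightarrow> dyad (m t) (s t)" if "t \<in> {0..1} - (N \<union> N')" for t
      unfolding dyad_def using that by (intro tendsto_intros p(4) q(4)) auto
  qed (use e in auto)
  then show ?thesis using that p(1) q(1) by blast
qed

text \<open>The equation says that (1, s) is an eigenvector, with eigenvalue a + b s, of the
  symmetric matrix with rows (a, b) and (b, d). For nonzero b the discriminant (d - a)^2 + 4 b^2 is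
  positive and neither eigenvector is a coordinate axis.\<close>

lemma quadratic_root:
  fixes a b d :: real
  assumes "b \<noteq> 0" shows "\<exists>s. s \<noteq> 0 \<and> d = a + b * s - b / s"
proof -
  define h where "h = sqrt ((d - a)\<^sup>2 + 4 * b\<^sup>2)"
  have h2: "h\<^sup>2 = (d - a)\<^sup>2 + 4 * b\<^sup>2" by (simp add: h_def)
  have "sqrt ((d - a)\<^sup>2) < h" unfolding h_def using assms by (intro real_sqrt_less_mono) simp
  then have pos: "(d - a) + h > 0" by simp
  define s where "s = ((d - a) + h) / (2 * b)"
  have s0: "s \<noteq> 0" using pos assms by (simp add: s_def)
  have "2 * b * s = (d - a) + h" using assms by (simp add: s_def)
  then have "(2 * b * s - (d - a))\<^sup>2 = (d - a)\<^sup>2 + 4 * b\<^sup>2" using h2 by simp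
  then have "4 * b * (b * s\<^sup>2 - (d - a) * s - b) = 0" by (simp add: power2_eq_square algebra_simps)
  then have "b * s\<^sup>2 - (d - a) * s - b = 0" using assms by simp
  then have "b * (s * s) = b + (d - a) * s" by (simp add: power2_eq_square)
  then have "b * s = (b + (d - a) * s) / s" unfolding eq_divide_eq mult.assoc using s0 by simp
  also have "\<dots> = b / s + (d - a)" using s0 by (simp add: add_divide_distrib)
  finally have "b * s = b / s + (d - a)" .
  then have "d = a + b * s - b / s" by simp
  with s0 show ?thesis by blast
qed

text \<open>The two dyads are multiples of the spectral projections. Each has norm equal to the nuclear norm
  of \<open>N\<close>, whose square is \<open>nuc N\<close>.\<close>
lemma dyad_decomposition_exact:
  assumes sym: "N \<in> Sym2" and b0: "N$1$2 \<noteq> 0"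
  shows "\<exists>\<theta> m s m' s'. 0 \<le> \<theta> \<and> \<theta> \<le> 1 \<and> \<theta> *\<^sub>R dyad m s + (1 - \<theta>) *\<^sub>R dyad m' s' = N
    \<and> (norm (dyad m s))\<^sup>2 = nuc N \<and> (norm (dyad m' s'))\<^sup>2 = nuc N"
proof -
  define a b d where "a = N$1$1" "b = N$1$2" "d = N$2$2"
  have b: "b \<noteq> 0" "N$2$1 = b" using b0 sym unfolding a_b_d_def Sym2_iff by auto
  obtain s where s: "s \<noteq> 0" "d = a + b * s - b / s" using quadratic_root[OF b(1)] by blast
  \<comment> \<open>The eigenvalues for the orthogonal eigenvectors (1, s) and (1, - 1 / s);
    \<open>T\<close> is then the nuclear norm.\<close>
  define l k where "l = a + b * s" "k = a - b / s"
  define T where "T = \<bar>l\<bar> + \<bar>k\<bar>"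
  have "T \<noteq> 0"
  proof
    assume "T = 0"
    then have "l = 0" "k = 0" by (auto simp: T_def)
    then have "b * s + b / s = 0" by (simp add: l_k_def)
    then have "b * (s * s + 1) = 0" using s(1) by (simp add: field_simps)
    moreover have "s * s + 1 > 0" by (simp add: add_nonneg_pos)
    ultimately show False using b(1) by simp
  qed
  then have T: "T > 0" by (simp add: T_def)
  \<comment> \<open>The value 1 at 0 gives \<open>sg\<close> square 1 everywhere, so both dyads have
    norm \<open>T\<close> even when an eigenvalue vanishes; its weight is then 0.\<close>
  define sg :: "real \<Rightarrow> real" where "sg x = (if x \<ge> 0 then 1 else -1)" for x
  have sg: "sg x * \<bar>x\<bar> = x" "\<bar>x\<bar> * sg x = x" "(sg x)\<^sup>2 = 1" for x by (auto simp: sg_def)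
  have p: "1 + s\<^sup>2 > 0" "1 + (- 1 / s)\<^sup>2 > 0" by (simp_all add: add_pos_nonneg)
  define m where "m = sg l * T / (1 + s\<^sup>2)"
  define m' where "m' = sg k * T / (1 + (- 1 / s)\<^sup>2)"
  define \<theta> where "\<theta> = \<bar>l\<bar> / T"
  have \<theta>: "0 \<le> \<theta>" "\<theta> \<le> 1" "1 - \<theta> = \<bar>k\<bar> / T" using T by (auto simp: \<theta>_def T_def field_simps)
  have tm: "\<theta> * m = l / (1 + s\<^sup>2)" "(1 - \<theta>) * m' = k * s\<^sup>2 / (1 + s\<^sup>2)"
  proof -
    have "\<theta> * m = (sg l * \<bar>l\<bar>) / (1 + s\<^sup>2)" using T by (simp add: \<theta>_def m_def field_simps)
    then show "\<theta> * m = l / (1 + s\<^sup>2)" by (simp add: sg)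
    have "(1 - \<theta>) * m' = (sg k * \<bar>k\<bar>) / (1 + (- 1 / s)\<^sup>2)" using T by (simp add: \<theta>(3) m'_def)
    also have "\<dots> = k * s\<^sup>2 / (1 + s\<^sup>2)" using s(1) p by (simp add: sg field_simps)
    finally show "(1 - \<theta>) * m' = k * s\<^sup>2 / (1 + s\<^sup>2)" .
  qed
  have "(\<theta> *\<^sub>R dyad m s + (1 - \<theta>) *\<^sub>R dyad m' (- 1 / s)) $ i $ j = N $ i $ j" for i j
  proof -
    have "l + k * s\<^sup>2 = a * (1 + s\<^sup>2)" using s(1) by (simp add: l_k_def field_simps power2_eq_square)
    then have e11: "l / (1 + s\<^sup>2) + k * s\<^sup>2 / (1 + s\<^sup>2) = a"
      using p(1) by (simp add: add_divide_distrib[symmetric])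
    have "l / (1 + s\<^sup>2) * s + k * s\<^sup>2 / (1 + s\<^sup>2) * (- 1 / s) = (l * s - k * s) / (1 + s\<^sup>2)"
      using s(1) by (simp add: diff_divide_distrib power2_eq_square)
    also have "l * s - k * s = b * (1 + s\<^sup>2)" using s(1) by (simp add: l_k_def field_simps power2_eq_square)
    finally have e12: "l / (1 + s\<^sup>2) * s + k * s\<^sup>2 / (1 + s\<^sup>2) * (- 1 / s) = b"
      using p(1) by simp
    have e22: "l / (1 + s\<^sup>2) * s\<^sup>2 + k * s\<^sup>2 / (1 + s\<^sup>2) * (- 1 / s)\<^sup>2 = d"
    proof -
      have "l / (1 + s\<^sup>2) * s\<^sup>2 + k * s\<^sup>2 / (1 + s\<^sup>2) * (- 1 / s)\<^sup>2 = (l * s\<^sup>2 + k) / (1 + s\<^sup>2)"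
        using s(1) by (simp add: power_divide add_divide_distrib)
      also have "l * s\<^sup>2 + k = (a + b * s - b / s) * (1 + s\<^sup>2)"
        using s(1) by (simp add: l_k_def field_simps power2_eq_square)
      finally show ?thesis using p(1) s(2) by simp
    qed
    have "(\<theta> *\<^sub>R dyad m s + (1 - \<theta>) *\<^sub>R dyad m' (- 1 / s)) $ 1 $ 1 = N $ 1 $ 1"
      using e11 by (simp add: tm a_b_d_def)
    moreover have "(\<theta> *\<^sub>R dyad m s + (1 - \<theta>) *\<^sub>R dyad m' (- 1 / s)) $ 1 $ 2 = N $ 1 $ 2"
      "(\<theta> *\<^sub>R dyad m s + (1 - \<theta>) *\<^sub>R dyad m' (- 1 / s)) $ 2 $ 1 = N $ 2 $ 1"
      using e12 b(2) by (simp_all add: mult.assoc[symmetric] tm a_b_d_def)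
    moreover have "(\<theta> *\<^sub>R dyad m s + (1 - \<theta>) *\<^sub>R dyad m' (- 1 / s)) $ 2 $ 2 = N $ 2 $ 2"
      using e22 by (simp add: mult.assoc[symmetric] tm a_b_d_def)
    ultimately show ?thesis using exhaust_2[of i] exhaust_2[of j] by auto
  qed
  then have eq: "\<theta> *\<^sub>R dyad m s + (1 - \<theta>) *\<^sub>R dyad m' (- 1 / s) = N" by (simp add: vec_eq_iff)
  have sb: "s * (b / s) = b" using s(1) by simp
  have det: "det N = l * k"
    using sb s(1) by (simp add: det_2 b(2) a_b_d_def[symmetric] s(2) l_k_def algebra_simps)
  have tr: "a + d = l + k" by (simp add: s(2) l_k_def)
  have "(norm N)\<^sup>2 = (a + d)\<^sup>2 - 2 * det N"
    unfolding norm_square_22 det_2 b(2) a_b_d_def[symmetric] by (simp add: power2_eq_square algebra_simps)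
  then have "nuc N = (l + k)\<^sup>2 - 2 * (l * k) + 2 * \<bar>l * k\<bar>" by (simp add: nuc_def det tr)
  also have "\<dots> = T\<^sup>2" by (simp add: T_def power2_eq_square abs_mult algebra_simps)
  finally have nT: "nuc N = T\<^sup>2" .
  have "(norm (dyad m s))\<^sup>2 = nuc N"
    using p(1) unfolding norm_dyad nT m_def by (simp add: power_mult_distrib sg)
  moreover have "(norm (dyad m' (- 1 / s)))\<^sup>2 = nuc N"
    using p(2) unfolding norm_dyad nT m'_def by (simp add: power_mult_distrib sg)
  ultimately show ?thesis using eq \<theta>(1,2) by blast
qed

text \<open>If the off-diagonal entry vanishes, one spectral projection is that onto e2, which has
  no finite slope. An off-diagonal entry \<open>\<delta>\<close> is added instead; it changes
  \<open>nuc\<close> by at most 4 \<delta>^2, which explains the choice of \<open>\<delta>\<close>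
  below e / 4.\<close>

lemma dyad_decomposition:
  assumes sym: "N \<in> Sym2" and e: "e > 0"
  shows "\<exists>\<theta> m s m' s'. 0 \<le> \<theta> \<and> \<theta> \<le> 1 \<and> norm (\<theta> *\<^sub>R dyad m s + (1 - \<theta>) *\<^sub>R dyad m' s' - N) \<le> e
    \<and> \<bar>(norm (dyad m s))\<^sup>2 - nuc N\<bar> \<le> e \<and> \<bar>(norm (dyad m' s'))\<^sup>2 - nuc N\<bar> \<le> e"
proof (cases "N$1$2 = 0")
  case False
  obtain \<theta> m s m' s' where "0 \<le> \<theta>" "\<theta> \<le> 1" "\<theta> *\<^sub>R dyad m s + (1 - \<theta>) *\<^sub>R dyad m' s' = N"
    "(norm (dyad m s))\<^sup>2 = nuc N" "(norm (dyad m' s'))\<^sup>2 = nuc N"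
    using dyad_decomposition_exact[OF sym False] by blast
  then show ?thesis using e by (intro exI[of _ \<theta>] exI[of _ m] exI[of _ s] exI[of _ m'] exI[of _ s']) simp
next
  case True
  define \<delta> where "\<delta> = min 1 (e / 4)"
  have \<delta>: "0 < \<delta>" "\<delta> \<le> 1" "4 * \<delta> \<le> e" using e by (auto simp: \<delta>_def)
  have d2: "\<delta>\<^sup>2 \<le> \<delta>" using \<delta> by (simp add: power2_eq_square mult_left_le)
  define P where "P = N + \<delta> *\<^sub>R vector [vector [0, 1], vector [1, 0]]"
  have N21: "N$2$1 = 0" using True sym unfolding Sym2_iff by simp
  have Pe: "P$1$1 = N$1$1" "P$1$2 = \<delta>" "P$2$1 = \<delta>" "P$2$2 = N$2$2" by (simp_all add: P_def True N21)
  have "P \<in> Sym2" unfolding Sym2_iff Pe ..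
  moreover have "P$1$2 \<noteq> 0" using \<delta> Pe by simp
  ultimately obtain \<theta> m s m' s' where D: "0 \<le> \<theta>" "\<theta> \<le> 1" "\<theta> *\<^sub>R dyad m s + (1 - \<theta>) *\<^sub>R dyad m' s' = P"
    "(norm (dyad m s))\<^sup>2 = nuc P" "(norm (dyad m' s'))\<^sup>2 = nuc P"
    using dyad_decomposition_exact by blast
  have "(norm (P - N))\<^sup>2 = 2 * \<delta>\<^sup>2" by (simp add: norm_square_22 Pe True N21)
  also have "\<dots> \<le> e\<^sup>2"
  proof -
    have "16 * \<delta>\<^sup>2 \<le> e\<^sup>2" using power_mono[OF \<delta>(3), of 2] \<delta>(1) by (simp add: power_mult_distrib)
    then show ?thesis using zero_le_power2[of \<delta>] by linarith
  qed
  finally have n: "norm (P - N) \<le> e" by (rule power2_le_imp_le) (use e in simp)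
  define X where "X = \<bar>N$1$1 * N$2$2 - \<delta>\<^sup>2\<bar> - \<bar>N$1$1 * N$2$2\<bar>"
  have "nuc P - nuc N = 2 * \<delta>\<^sup>2 + 2 * X"
    unfolding X_def nuc_def norm_square_22 det_2 Pe True N21 by (simp add: power2_eq_square)
  moreover have "\<bar>X\<bar> \<le> \<delta>\<^sup>2"
    unfolding X_def using abs_triangle_ineq3[of "N$1$1 * N$2$2 - \<delta>\<^sup>2" "N$1$1 * N$2$2"] by simp
  ultimately have "\<bar>nuc P - nuc N\<bar> \<le> e" using d2 \<delta>(3) by linarith
  then show ?thesis using D n by (intro exI[of _ \<theta>] exI[of _ m] exI[of _ s] exI[of _ m'] exI[of _ s']) auto
qed

section \<open>Oscillation between two dyads on a fine partition\<close>

lemma has_integral_switch: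
  fixes X Y :: "'a::euclidean_space"
  assumes n: "n > 0" and \<theta>: "0 \<le> \<theta>" "\<theta> \<le> 1"
    and X: "\<And>t. t \<in> {real i / real n<..<(real i + \<theta>) / real n} \<Longrightarrow> f t = X"
    and Y: "\<And>t. t \<in> {(real i + \<theta>) / real n<..<(real i + 1) / real n} \<Longrightarrow> f t = Y"
  shows "(f has_integral (1 / real n) *\<^sub>R (\<theta> *\<^sub>R X + (1 - \<theta>) *\<^sub>R Y)) {real i / real n..(real i + 1) / real n}"
proof -
  let ?a = "real i / real n" and ?c = "(real i + \<theta>) / real n" and ?b = "(real i + 1) / real n"
  have le: "?a \<le> ?c" "?c \<le> ?b" using \<theta> n by (auto simp: divide_right_mono)
  have "(f has_integral (?c - ?a) *\<^sub>R X) {?a..?c}"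
    by (rule has_integral_spike_finite[OF _ _ has_integral_const_real[of X ?a ?c, simplified content_real[OF le(1)]], of "{?a, ?c}"])
       (use X in auto)
  moreover have "(f has_integral (?b - ?c) *\<^sub>R Y) {?c..?b}"
    by (rule has_integral_spike_finite[OF _ _ has_integral_const_real[of Y ?c ?b, simplified content_real[OF le(2)]], of "{?c, ?b}"])
       (use Y in auto)
  ultimately have "(f has_integral (?c - ?a) *\<^sub>R X + (?b - ?c) *\<^sub>R Y) {?a..?b}"
    using le by (rule_tac has_integral_combine[of ?a ?c ?b])
  moreover have "?c - ?a = (1 / real n) * \<theta>" "?b - ?c = (1 / real n) * (1 - \<theta>)" using n by (simp_all add: field_simps)
  ultimately show ?thesis by (simp only: scaleR_add_right scaleR_scaleR)
qed

text \<open>Up to \<open>t\<close> there are at most \<open>n\<close> complete cells, which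
  contribute at most \<open>e\<close> in total, and one incomplete cell of length at most 1 /
  n.\<close>

lemma partition_primitive_bound:
  fixes f :: "real \<Rightarrow> 'a::euclidean_space"
  assumes f: "f absolutely_integrable_on {0..1}" and n: "n > 0" and e: "e \<ge> 0"
    and i: "\<And>i. i < n \<Longrightarrow> norm (integral {real i / real n..(real i + 1) / real n} f) \<le> e / real n"
    and C: "\<And>t. t \<in> {0..1} \<Longrightarrow> norm (f t) \<le> C" and t: "t \<in> {0..1}"
  shows "norm (integral {0..t} f) \<le> e + C / real n"
proof -
  note p = primitive_increment[OF primitive_integral[OF f]]
  have C0: "C \<ge> 0" using C[OF t] norm_ge_zero order_trans by blast
  have A: "norm (integral {0..real k / real n} f) \<le> real k * (e / real n)" if "k \<le> n" for k
    using that
  proof (induction k)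
    case (Suc k)
    have "integral {0..real (Suc k) / real n} f = integral {0..real k / real n} f + integral {real k / real n..(real k + 1) / real n} f"
      using p[of "real k / real n" "(real k + 1) / real n"] Suc.prems n by (simp add: divide_right_mono algebra_simps)
    then have "norm (integral {0..real (Suc k) / real n} f) \<le> real k * (e / real n) + e / real n"
      using norm_triangle_le[OF add_mono[OF Suc.IH i[of k]]] Suc.prems by simp
    then show ?case by (simp add: algebra_simps add_divide_distrib)
  qed simp
  define k where "k = nat \<lfloor>real n * t\<rfloor>"
  have k: "real k \<le> real n * t" "real n * t < real k + 1" using t by (auto simp: k_def)
  have kn: "k \<le> n"
  proof -
    have "real k \<le> real n * 1" using k(1) t by (meson atLeastAtMost_iff mult_left_mono of_nat_0_le_iff order_trans)
    then show ?thesis by simp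
  qed
  have kt: "real k / real n \<le> t" "t - real k / real n \<le> 1 / real n"
  proof -
    show "real k / real n \<le> t" using k n by (simp add: field_simps)
    have "t \<le> (real k + 1) / real n" using k n by (simp add: pos_le_divide_eq mult.commute)
    then show "t - real k / real n \<le> 1 / real n" by (simp add: add_divide_distrib)
  qed
  have "norm (integral {real k / real n..t} f) \<le> integral {real k / real n..t} (\<lambda>_. C)"
  proof (rule norm_integral_le)
    have "0 \<le> real k / real n" by simp
    then show "norm (f u) \<le> C" if "u \<in> {real k / real n..t}" for u
      using that t by (intro C) (meson atLeastAtMost_iff order_trans)
  qed (use t in \<open>auto intro: ai_subinterval[OF f]\<close>)
  also have "\<dots> = (t - real k / real n) * C" using kt(1) by simp
  also have "\<dots> \<le> 1 / real n * C" using kt(2) C0 by (rule mult_right_mono)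
  finally have B: "norm (integral {real k / real n..t} f) \<le> C / real n" by simp
  have "integral {0..t} f = integral {0..real k / real n} f + integral {real k / real n..t} f"
    using p[of "real k / real n" t] kt(1) t by (simp add: algebra_simps)
  moreover have "real k * (e / real n) \<le> e"
  proof -
    have "real k * e \<le> real n * e" using kn e by (intro mult_right_mono) auto
    then show ?thesis using n by (simp add: field_simps)
  qed
  ultimately show ?thesis
    using norm_triangle_le[OF add_mono[OF A[OF kn] B]] by simp
qed

text \<open>On a short cell both \<open>N\<close> and its energy density are nearly constant. Using
  the first dyad of the left endpoint matrix on a fraction \<open>\<theta>\<close> of the cell and
  the second on the rest gives the right mean of the field, while the energy density is nearly right
  at every point.\<close>

lemma approx_laminate:
  fixes N :: "real \<Rightarrow> real^2^2"
  assumes N: "continuous_on {0..1} N" and sym: "\<And>t. N t \<in> Sym2" and e: "e > 0"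
  obtains m s K where "m \<in> borel_measurable (lebesgue_on {0..1})" "s \<in> borel_measurable (lebesgue_on {0..1})"
    "\<And>t. t \<in> {0..1} \<Longrightarrow> \<bar>m t\<bar> \<le> K" "\<And>t. t \<in> {0..1} \<Longrightarrow> \<bar>s t\<bar> \<le> K"
    "\<And>t. t \<in> {0..1} \<Longrightarrow> norm (integral {0..t} (\<lambda>t. dyad (m t) (s t) - N t)) \<le> e"
    "\<bar>integral {0..1} (\<lambda>t. nuc (dyad (m t) (s t))) - integral {0..1} (\<lambda>t. nuc (N t))\<bar> \<le> e"
proof -
  \<comment> \<open>Of the budget 4 d, the complete cells use 2 d, one for the decomposition and one
    for the oscillation of \<open>N\<close>; the incomplete cell uses the other 2 d.\<close>
  define d where "d = e / 4"
  have d: "d > 0" using e by (simp add: d_def)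
  have cn: "continuous_on {0..1} (\<lambda>t. nuc (N t))"
    by (rule continuous_on_compose2[OF continuous_nuc N]) simp
  have "bounded (N ` {0..1})" "bounded ((\<lambda>t. nuc (N t)) ` {0..1})"
    by (auto intro!: compact_imp_bounded compact_continuous_image compact_Icc N cn)
  then obtain B1 B2 where B12: "\<And>t. t \<in> {0..1} \<Longrightarrow> norm (N t) \<le> B1" "\<And>t. t \<in> {0..1} \<Longrightarrow> \<bar>nuc (N t)\<bar> \<le> B2"
    unfolding bounded_iff by (metis image_eqI real_norm_def)
  define B where "B = max B1 B2"
  have B: "norm (N t) \<le> B" "nuc (N t) \<le> B" if "t \<in> {0..1}" for t
    using B12[OF that] by (auto simp: B_def)
  have B0: "B \<ge> 0" using B(1)[of 0] norm_ge_zero order_trans by (metis atLeastAtMost_iff order_refl zero_le_one)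
  \<comment> \<open>Bounds both differences: a dyad has norm at most 1 + B + d and \<open>N\<close>
    at most \<open>B\<close>, while the energy densities are at most B + d and
    \<open>B\<close>.\<close>
  define C where "C = 1 + 2 * B + d"
  have "uniformly_continuous_on {0..1} N" "uniformly_continuous_on {0..1} (\<lambda>t. nuc (N t))"
    by (auto intro!: compact_uniformly_continuous compact_Icc N cn)
  then obtain r1 r2 where r1: "r1 > 0" "\<And>t t'. t \<in> {0..1} \<Longrightarrow> t' \<in> {0..1} \<Longrightarrow> dist t' t < r1 \<Longrightarrow> dist (N t') (N t) < d"
    and r2: "r2 > 0" "\<And>t t'. t \<in> {0..1} \<Longrightarrow> t' \<in> {0..1} \<Longrightarrow> dist t' t < r2 \<Longrightarrow> dist (nuc (N t')) (nuc (N t)) < d"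
    unfolding uniformly_continuous_on_def using d by metis
  obtain n :: nat where n0: "n > 0" "1 / real n < min (min r1 r2) (d / (C + 1))"
  proof -
    have "min (min r1 r2) (d / (C + 1)) > 0" using r1(1) r2(1) d B0 by (simp add: C_def)
    then show ?thesis using that reals_Archimedean[of "min (min r1 r2) (d / (C + 1))"] by (metis inverse_eq_divide zero_less_Suc)
  qed
  have n: "n > 0" "1 / real n < r1" "1 / real n < r2" using n0 by auto
  have Cn: "C / real n \<le> 2 * d"
  proof -
    have "C + 1 > 0" using B0 d by (simp add: C_def)
    have "1 / real n < d / (C + 1)" using n0(2) by simp
    then have "(C + 1) * (1 / real n) \<le> d" using \<open>C + 1 > 0\<close> by (simp add: field_simps)
    moreover have "C / real n \<le> (C + 1) * (1 / real n)" using n(1) by (simp add: field_simps)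
    ultimately show ?thesis using d by linarith
  qed
  define ok where "ok = (\<lambda>\<theta> m s m' s' i. 0 \<le> \<theta> \<and> \<theta> \<le> 1
    \<and> norm (\<theta> *\<^sub>R dyad m s + (1 - \<theta>) *\<^sub>R dyad m' s' - N (real i / real n)) \<le> d
    \<and> \<bar>(norm (dyad m s))\<^sup>2 - nuc (N (real i / real n))\<bar> \<le> d \<and> \<bar>(norm (dyad m' s'))\<^sup>2 - nuc (N (real i / real n))\<bar> \<le> d)"
  have "\<exists>\<theta> m s m' s'. ok \<theta> m s m' s' i" for i
    unfolding ok_def by (rule dyad_decomposition[OF sym d])
  then obtain \<theta> m1 s1 m2 s2 where ok: "\<And>i::nat. ok (\<theta> i) (m1 i) (s1 i) (m2 i) (s2 i) i" by metis
  define idx where "idx = (\<lambda>t. nat \<lfloor>real n * t\<rfloor>)"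
  define sw :: "(nat \<Rightarrow> real) \<Rightarrow> (nat \<Rightarrow> real) \<Rightarrow> real \<Rightarrow> real"
    where "sw = (\<lambda>X Y t. if real n * t - real (idx t) < \<theta> (idx t) then X (idx t) else Y (idx t))"
  have idxm: "(\<lambda>t. X (idx t)) \<in> borel_measurable borel" for X :: "nat \<Rightarrow> real"
    unfolding idx_def by measurable
  have swm: "sw X Y \<in> borel_measurable (lebesgue_on {0..1})" for X Y
  proof -
    have "sw X Y \<in> borel_measurable borel" unfolding sw_def using idxm by measurable
    then have "sw X Y \<in> borel_measurable lebesgue" by (intro measurable_completion) simp
    then show ?thesis by (rule measurable_restrict_space1)
  qed
  have idxn: "idx t \<le> n" if "t \<in> {0..1}" for t
  proof -
    have "real n * t \<le> real n * 1" using that by (intro mult_left_mono) auto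
    then have "\<lfloor>real n * t\<rfloor> \<le> int n" by (simp add: floor_le_iff)
    then show ?thesis by (simp add: idx_def)
  qed
  \<comment> \<open>The index \<open>n\<close> is included because \<open>idx t = n\<close> at
    \<open>t = 1\<close>.\<close>
  define K where "K = (\<Sum>i\<le>n. \<bar>m1 i\<bar> + \<bar>m2 i\<bar> + \<bar>s1 i\<bar> + \<bar>s2 i\<bar>)"
  have K: "\<bar>m1 i\<bar> + \<bar>m2 i\<bar> + \<bar>s1 i\<bar> + \<bar>s2 i\<bar> \<le> K" if "i \<le> n" for i
    unfolding K_def using that member_le_sum[of i "{..n}" "\<lambda>i. \<bar>m1 i\<bar> + \<bar>m2 i\<bar> + \<bar>s1 i\<bar> + \<bar>s2 i\<bar>"] by simp
  define m where "m = sw m1 m2"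
  define s where "s = sw s1 s2"
  have mK: "\<bar>m t\<bar> \<le> K" and sK: "\<bar>s t\<bar> \<le> K" if "t \<in> {0..1}" for t
    using K[OF idxn[OF that]] by (auto simp: m_def s_def sw_def)
  have mm: "m \<in> borel_measurable (lebesgue_on {0..1})" "s \<in> borel_measurable (lebesgue_on {0..1})"
    unfolding m_def s_def by (rule swm)+
  note sq = sqint_dyad_bounded(1)[OF mm mK sK]
  have okE: "0 \<le> \<theta> i" "\<theta> i \<le> 1"
    "norm (\<theta> i *\<^sub>R dyad (m1 i) (s1 i) + (1 - \<theta> i) *\<^sub>R dyad (m2 i) (s2 i) - N (real i / real n)) \<le> d"
    "\<bar>nuc (dyad (m1 i) (s1 i)) - nuc (N (real i / real n))\<bar> \<le> d"
    "\<bar>nuc (dyad (m2 i) (s2 i)) - nuc (N (real i / real n))\<bar> \<le> d" for i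
    using ok[of i] unfolding ok_def nuc_dyad by auto
  have nd: "nuc (dyad (m t) (s t)) \<le> B + d" if t: "t \<in> {0..1}" for t
  proof -
    have "real (idx t) / real n \<in> {0..1}" using idxn[OF t] n(1) by simp
    from B(2)[OF this] show ?thesis
      using okE(4,5)[of "idx t"] by (auto simp: m_def s_def sw_def)
  qed
  have ndn: "norm (dyad (m t) (s t)) \<le> 1 + B + d" if t: "t \<in> {0..1}" for t
  proof -
    have "(norm (dyad (m t) (s t)))\<^sup>2 \<le> B + d" using nd[OF t] by (simp add: nuc_dyad)
    then show ?thesis
      using zero_le_power2[of "norm (dyad (m t) (s t)) - 1/2"] by (simp add: power2_eq_square algebra_simps)
  qed
  have idxi: "idx t = i" if "t \<in> {real i / real n<..<(real i + 1) / real n}" for t i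
  proof -
    have "real i < real n * t" "real n * t < real i + 1" using that n(1) by (auto simp: field_simps)
    then have "\<lfloor>real n * t\<rfloor> = int i" by (intro floor_unique) auto
    then show ?thesis by (simp add: idx_def)
  qed
  have piece1: "m t = m1 i \<and> s t = s1 i" if t: "t \<in> {real i / real n<..<(real i + \<theta> i) / real n}" for t i
  proof -
    have "(real i + \<theta> i) / real n \<le> (real i + 1) / real n" using okE(2)[of i] n(1) by (simp add: divide_right_mono)
    then have "idx t = i" using t by (intro idxi) auto
    moreover have "real n * t - real i < \<theta> i" using t n(1) by (simp add: field_simps)
    ultimately show ?thesis by (simp add: m_def s_def sw_def)
  qed
  have piece2: "m t = m2 i \<and> s t = s2 i" if t: "t \<in> {(real i + \<theta> i) / real n<..<(real i + 1) / real n}" for t i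
  proof -
    have "real i / real n \<le> (real i + \<theta> i) / real n" using okE(1)[of i] n(1) by (simp add: divide_right_mono)
    then have "idx t = i" using t by (intro idxi) auto
    moreover have "\<not> real n * t - real i < \<theta> i" using t n(1) by (simp add: field_simps)
    ultimately show ?thesis by (simp add: m_def s_def sw_def)
  qed
  have hD: "((\<lambda>t. dyad (m t) (s t)) has_integral (1 / real n) *\<^sub>R (\<theta> i *\<^sub>R dyad (m1 i) (s1 i) + (1 - \<theta> i) *\<^sub>R dyad (m2 i) (s2 i)))
      {real i / real n..(real i + 1) / real n}" for i
    by (rule has_integral_switch[OF n(1) okE(1,2)]) (use piece1 piece2 in auto)
  have hn: "((\<lambda>t. nuc (dyad (m t) (s t))) has_integral (1 / real n) *\<^sub>R (\<theta> i *\<^sub>R nuc (dyad (m1 i) (s1 i)) + (1 - \<theta> i) *\<^sub>R nuc (dyad (m2 i) (s2 i))))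
      {real i / real n..(real i + 1) / real n}" for i
    by (rule has_integral_switch[OF n(1) okE(1,2)]) (use piece1 piece2 in auto)
  \<comment> \<open>Stated for a general target \<open>g\<close>, because it is used both for the
    field and for its energy density.\<close>
  have piece_bound: "norm (integral {real i / real n..(real i + 1) / real n} (\<lambda>t. f t - g t)) \<le> 2 * d / real n"
    if i: "i < n" and f: "(f has_integral (1 / real n) *\<^sub>R F) {real i / real n..(real i + 1) / real n}"
      and F: "norm (F - g (real i / real n)) \<le> d" and g: "continuous_on {0..1} g"
      and near: "\<And>t. t \<in> {real i / real n..(real i + 1) / real n} \<Longrightarrow> norm (g t - g (real i / real n)) \<le> d"
    for f g :: "real \<Rightarrow> 'b::euclidean_space" and F i
  proof -
    let ?a = "real i / real n" and ?b = "(real i + 1) / real n"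
    have ab: "?a \<le> ?b" "?b - ?a = 1 / real n" "0 \<le> ?a" "?b \<le> 1" using n(1) i by (auto simp: field_simps)
    have gi: "continuous_on {?a..?b} (\<lambda>t. g t - g ?a)"
      using ab by (intro continuous_intros continuous_on_subset[OF g]) auto
    have ig: "((\<lambda>t. g t - g ?a) has_integral integral {?a..?b} (\<lambda>t. g t - g ?a)) {?a..?b}"
      using integrable_continuous_real[OF gi] by (rule integrable_integral)
    have ic: "((\<lambda>t. g ?a) has_integral (1 / real n) *\<^sub>R g ?a) {?a..?b}"
      using has_integral_const_real[of "g ?a" ?a ?b] ab by simp
    have "((\<lambda>t. f t - g ?a - (g t - g ?a)) has_integral (1 / real n) *\<^sub>R F - (1 / real n) *\<^sub>R g ?a - integral {?a..?b} (\<lambda>t. g t - g ?a)) {?a..?b}"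
      by (intro has_integral_diff f ic ig)
    then have "integral {?a..?b} (\<lambda>t. f t - g t) = (1 / real n) *\<^sub>R (F - g ?a) - integral {?a..?b} (\<lambda>t. g t - g ?a)"
      by (simp add: integral_unique scaleR_diff_right)
    moreover have "norm ((1 / real n) *\<^sub>R (F - g ?a)) \<le> d / real n"
      using F n(1) by (simp add: divide_right_mono)
    moreover have "norm (integral {?a..?b} (\<lambda>t. g t - g ?a)) \<le> d / real n"
    proof -
      have "norm (integral {?a..?b} (\<lambda>t. g t - g ?a)) \<le> integral {?a..?b} (\<lambda>_. d)"
        by (intro norm_integral_le absolutely_integrable_continuous_real gi near) auto
      also have "\<dots> = d / real n" using ab by simp
      finally show ?thesis .
    qed
    ultimately show ?thesis
      using norm_triangle_ineq4[of "(1 / real n) *\<^sub>R (F - g ?a)" "integral {?a..?b} (\<lambda>t. g t - g ?a)"] by simp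
  qed
  have near: "norm (N t - N (real i / real n)) \<le> d \<and> norm (nuc (N t) - nuc (N (real i / real n))) \<le> d"
    if i: "i < n" and t: "t \<in> {real i / real n..(real i + 1) / real n}" for t i
  proof -
    have "0 \<le> real i / real n" "(real i + 1) / real n \<le> 1" using n(1) i by (auto simp: field_simps)
    then have m: "real i / real n \<in> {0..1}" "t \<in> {0..1}"
      using t by (meson atLeastAtMost_iff order_trans order_refl)+
    have "dist t (real i / real n) \<le> 1 / real n" using t by (auto simp: dist_real_def add_divide_distrib)
    then have "dist t (real i / real n) < r1" "dist t (real i / real n) < r2" using n by auto
    from r1(2)[OF m this(1)] r2(2)[OF m this(2)] show ?thesis by (simp add: dist_norm)
  qed
  have res1: "norm (integral {0..t} (\<lambda>t. dyad (m t) (s t) - N t)) \<le> 2 * d + C / real n" if t: "t \<in> {0..1}" for t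
  proof (rule partition_primitive_bound[OF _ n(1)])
    show "(\<lambda>t. dyad (m t) (s t) - N t) absolutely_integrable_on {0..1}"
      by (intro sqint_ai sqint_diff sq sqint_continuous N)
    show "norm (integral {real i / real n..(real i + 1) / real n} (\<lambda>t. dyad (m t) (s t) - N t)) \<le> 2 * d / real n" if "i < n" for i
      by (rule piece_bound[OF that hD okE(3) N]) (use near that in blast)
    show "norm (dyad (m t) (s t) - N t) \<le> C" if "t \<in> {0..1}" for t
      using norm_triangle_ineq4[of "dyad (m t) (s t)" "N t"] ndn[OF that] B(1)[OF that] by (simp add: C_def)
  qed (use d t in auto)
  have res2: "norm (integral {0..1} (\<lambda>t. nuc (dyad (m t) (s t)) - nuc (N t))) \<le> 2 * d + C / real n"
  proof (rule partition_primitive_bound[OF _ n(1)])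
    show "(\<lambda>t. nuc (dyad (m t) (s t)) - nuc (N t)) absolutely_integrable_on {0..1}"
      by (intro set_integral_diff(1) nuc_ai sq sqint_continuous N)
    show "norm (integral {real i / real n..(real i + 1) / real n} (\<lambda>t. nuc (dyad (m t) (s t)) - nuc (N t))) \<le> 2 * d / real n" if "i < n" for i
    proof (rule piece_bound[OF that hn _ cn])
      let ?x = "nuc (dyad (m1 i) (s1 i))" and ?y = "nuc (dyad (m2 i) (s2 i))" and ?z = "nuc (N (real i / real n))"
      have "\<theta> i *\<^sub>R ?x + (1 - \<theta> i) *\<^sub>R ?y - ?z = \<theta> i * (?x - ?z) + (1 - \<theta> i) * (?y - ?z)"
        by (simp add: algebra_simps)
      also have "\<bar>\<dots>\<bar> \<le> \<theta> i * \<bar>?x - ?z\<bar> + (1 - \<theta> i) * \<bar>?y - ?z\<bar>"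
        using okE(1,2)[of i] by (intro order_trans[OF abs_triangle_ineq]) (simp add: abs_mult)
      also have "\<dots> \<le> \<theta> i * d + (1 - \<theta> i) * d"
        using okE[of i] by (intro add_mono mult_left_mono) auto
      finally show "norm (\<theta> i *\<^sub>R ?x + (1 - \<theta> i) *\<^sub>R ?y - ?z) \<le> d" by (simp add: algebra_simps)
    qed (use near that in blast)
    show "norm (nuc (dyad (m t) (s t)) - nuc (N t)) \<le> C" if "t \<in> {0..1}" for t
      using nd[OF that] B(2)[OF that] nuc_nonneg[of "N t"] nuc_nonneg[of "dyad (m t) (s t)"] B0 d
      by (simp add: C_def abs_le_iff)
  qed (use d in auto)
  have "integral {0..1} (\<lambda>t. nuc (dyad (m t) (s t)) - nuc (N t)) = integral {0..1} (\<lambda>t. nuc (dyad (m t) (s t))) - integral {0..1} (\<lambda>t. nuc (N t))"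
    using nuc_ai[OF sq] nuc_ai[OF sqint_continuous[OF N]]
    by (intro Henstock_Kurzweil_Integration.integral_diff) (auto simp: absolutely_integrable_on_def)
  then have "\<bar>integral {0..1} (\<lambda>t. nuc (dyad (m t) (s t))) - integral {0..1} (\<lambda>t. nuc (N t))\<bar> \<le> e"
    using res2 Cn unfolding d_def real_norm_def by linarith
  moreover have "norm (integral {0..t} (\<lambda>t. dyad (m t) (s t) - N t)) \<le> e" if "t \<in> {0..1}" for t
    using res1[OF that] Cn unfolding d_def by linarith
  ultimately show ?thesis using that[OF mm mK sK] by blast
qed

lemma norm_primitive_le_integral_norm:
  assumes "sqint D" "t \<in> {0..1}"
  shows "norm (integral {0..t} D) \<le> integral {0..1} (\<lambda>t. norm (D t))"
proof -
  note i = ai_integrable_sub[OF sqint_norm_ai[OF assms(1)]]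
  have "norm (integral {0..t} D) \<le> integral {0..t} (\<lambda>t. norm (D t))"
    using assms(2) by (intro norm_integral_le ai_subinterval[OF sqint_ai[OF assms(1)]] i) auto
  also have "\<dots> \<le> integral {0..1} (\<lambda>t. norm (D t))"
    using assms(2) by (intro integral_subset_le i) auto
  finally show ?thesis .
qed

text \<open>Regularising \<open>M\<close> and smoothing the coefficients are approximations in L1,
  which controls the primitives uniformly; only the lamination between them is merely weakly close.
  Each of the three errors receives e / 3.\<close>

lemma dyad_approximation:
  assumes M: "sqint M" and sym: "negligible {t\<in>{0..1}. M t \<notin> Sym2}" and e: "e > 0"
  obtains m s where "smooth0 m" "smooth0 s"
    "\<And>t. t \<in> {0..1} \<Longrightarrow> norm (integral {0..t} (\<lambda>t. dyad (m t) (s t) - M t)) \<le> e"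
    "\<bar>integral {0..1} (\<lambda>t. nuc (dyad (m t) (s t))) - integral {0..1} (\<lambda>t. nuc (M t))\<bar> \<le> e"
proof -
  have e3: "e / 3 > 0" using e by simp
  obtain N where N: "continuous_on {0..1} N" "\<And>t. N t \<in> Sym2"
    "integral {0..1} (\<lambda>t. norm (N t - M t)) \<le> e/3"
    "\<bar>integral {0..1} (\<lambda>t. nuc (N t)) - integral {0..1} (\<lambda>t. nuc (M t))\<bar> \<le> e/3"
    using approx_continuous[OF M sym e3] by blast
  obtain p q K where pq: "p \<in> borel_measurable (lebesgue_on {0..1})" "q \<in> borel_measurable (lebesgue_on {0..1})"
    "\<And>t. t \<in> {0..1} \<Longrightarrow> \<bar>p t\<bar> \<le> K" "\<And>t. t \<in> {0..1} \<Longrightarrow> \<bar>q t\<bar> \<le> K"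
    "\<And>t. t \<in> {0..1} \<Longrightarrow> norm (integral {0..t} (\<lambda>t. dyad (p t) (q t) - N t)) \<le> e/3"
    "\<bar>integral {0..1} (\<lambda>t. nuc (dyad (p t) (q t))) - integral {0..1} (\<lambda>t. nuc (N t))\<bar> \<le> e/3"
    using approx_laminate[OF N(1,2) e3] by blast
  obtain m s where ms: "smooth0 m" "smooth0 s"
    "integral {0..1} (\<lambda>t. norm (dyad (m t) (s t) - dyad (p t) (q t))) \<le> e/3"
    "\<bar>integral {0..1} (\<lambda>t. nuc (dyad (m t) (s t))) - integral {0..1} (\<lambda>t. nuc (dyad (p t) (q t)))\<bar> \<le> e/3"
    using approx_smooth_dyad[OF pq(1-4) e3] by blast
  have c: "continuous_on {0..1} m" "continuous_on {0..1} s" using ms by (auto simp: smooth0_def intro: smooth_cl_continuous)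
  have sq: "sqint (\<lambda>t. dyad (m t) (s t))" unfolding dyad_def by (intro sqint_continuous continuous_intros c)
  note sq' = sqint_dyad_bounded(1)[OF pq(1-4)] and sN = sqint_continuous[OF N(1)]
  show ?thesis
  proof (rule that[OF ms(1,2)])
    fix t :: real assume t: "t \<in> {0..1}"
    let ?D1 = "\<lambda>t. dyad (m t) (s t) - dyad (p t) (q t)" and ?D2 = "\<lambda>t. dyad (p t) (q t) - N t" and ?D3 = "\<lambda>t. N t - M t"
    have i: "?D1 integrable_on {0..t}" "?D2 integrable_on {0..t}" "?D3 integrable_on {0..t}"
      using t by (auto intro!: ai_integrable_sub sqint_ai sqint_diff sq sq' sN M)
    have "integral {0..t} (\<lambda>t. dyad (m t) (s t) - M t) = integral {0..t} (\<lambda>t. ?D1 t + ?D2 t + ?D3 t)" by simp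
    also have "\<dots> = integral {0..t} ?D1 + integral {0..t} ?D2 + integral {0..t} ?D3"
      by (simp only: Henstock_Kurzweil_Integration.integral_add[OF integrable_add[OF i(1,2)] i(3)] Henstock_Kurzweil_Integration.integral_add[OF i(1,2)])
    finally have eq: "integral {0..t} (\<lambda>t. dyad (m t) (s t) - M t) = integral {0..t} ?D1 + integral {0..t} ?D2 + integral {0..t} ?D3" .
    have "norm (integral {0..t} ?D1) \<le> e/3"
      using norm_primitive_le_integral_norm[OF sqint_diff[OF sq sq'] t] ms(3) by linarith
    moreover have "norm (integral {0..t} ?D3) \<le> e/3"
      using norm_primitive_le_integral_norm[OF sqint_diff[OF sN M] t] N(3) by linarith
    ultimately show "norm (integral {0..t} (\<lambda>t. dyad (m t) (s t) - M t)) \<le> e"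
      unfolding eq using pq(5)[OF t] norm_triangle_ineq[of "integral {0..t} ?D1 + integral {0..t} ?D2" "integral {0..t} ?D3"]
        norm_triangle_ineq[of "integral {0..t} ?D1" "integral {0..t} ?D2"] by linarith
  next
    show "\<bar>integral {0..1} (\<lambda>t. nuc (dyad (m t) (s t))) - integral {0..1} (\<lambda>t. nuc (M t))\<bar> \<le> e"
      using ms(4) pq(6) N(4) by linarith
  qed
qed

subsection \<open>Repairing the endpoint data\<close>

text \<open>\<open>(1 + p) G N G\<^sup>T\<close> for symmetric \<open>N\<close>, where \<open>G\<close> is the lower triangular shear that maps \<open>(1, s)\<close> to
  \<open>(1, s + q)\<close>.\<close>
definition pert :: "real \<Rightarrow> real \<Rightarrow> real^2^2 \<Rightarrow> real^2^2" where
  "pert p q N = (1 + p) *\<^sub>R N + ((1 + p) * q) *\<^sub>R shear1 N + ((1 + p) * q\<^sup>2) *\<^sub>R shear2 N"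

lemma pert_dyad: "pert p q (dyad m s) = dyad ((1 + p) * m) (s + q)"
  by (simp add: pert_def shear1_def shear2_def vec_eq_iff forall_2 power2_eq_square algebra_simps)

lemma pert_0 [simp]: "pert 0 0 N = N"
  by (simp add: pert_def)

lemma pert_diff: "pert p q (N - N') = pert p q N - pert p q N'"
  by (simp add: pert_def linear_diff[OF bounded_linear.linear[OF bounded_linear_shear1]]
      linear_diff[OF bounded_linear.linear[OF bounded_linear_shear2]] algebra_simps)

lemma norm_shear1: "norm (shear1 N) \<le> 2 * norm N"
proof (rule power2_le_imp_le)
  show "(norm (shear1 N))\<^sup>2 \<le> (2 * norm N)\<^sup>2"
    unfolding power_mult_distrib norm_square_22 by (simp add: shear1_def)
qed simp

lemma norm_shear2: "norm (shear2 N) \<le> norm N"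
proof (rule power2_le_imp_le)
  show "(norm (shear2 N))\<^sup>2 \<le> (norm N)\<^sup>2"
    unfolding norm_square_22 by (simp add: shear2_def)
qed simp

lemma norm_A_of: "norm (A_of N) \<le> 2 * norm N"
proof (rule power2_le_imp_le)
  have "(norm (A_of N))\<^sup>2 = 2 * (N$1$1)\<^sup>2 + 2 * (N$1$2)\<^sup>2"
    by (simp only: power2_norm_eq_inner inner_vec_def)
       (simp add: sum_3 A_of_def outer_def axis_def power2_eq_square)
  then show "(norm (A_of N))\<^sup>2 \<le> (2 * norm N)\<^sup>2"
    unfolding power_mult_distrib norm_square_22 by simp
qed simp

lemma norm_pert_diff:
  assumes "\<bar>p\<bar> \<le> 1" "\<bar>q\<bar> \<le> 1" "\<bar>p'\<bar> \<le> 1" "\<bar>q'\<bar> \<le> 1"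
  shows "norm (pert p q N - pert p' q' N) \<le> 8 * (\<bar>p - p'\<bar> + \<bar>q - q'\<bar>) * norm N"
proof -
  have q1: "\<bar>q\<^sup>2\<bar> \<le> 1" using assms(2) by (simp add: abs_square_le_1)
  have qq: "\<bar>q\<^sup>2 - q'\<^sup>2\<bar> \<le> 2 * \<bar>q - q'\<bar>"
  proof -
    have "\<bar>q\<^sup>2 - q'\<^sup>2\<bar> = \<bar>q + q'\<bar> * \<bar>q - q'\<bar>" by (simp add: power2_eq_square abs_mult[symmetric] algebra_simps)
    also have "\<dots> \<le> 2 * \<bar>q - q'\<bar>" using assms by (intro mult_right_mono) auto
    finally show ?thesis .
  qed
  have s1: "norm (shear1 N) \<le> 2 * norm N" and s2: "norm (shear2 N) \<le> norm N" by (rule norm_shear1 norm_shear2)+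
  define X where "X = N + q *\<^sub>R shear1 N + q\<^sup>2 *\<^sub>R shear2 N"
  define Y where "Y = (q - q') *\<^sub>R shear1 N + (q\<^sup>2 - q'\<^sup>2) *\<^sub>R shear2 N"
  \<comment> \<open>Telescoping: \<open>p\<close> is varied at slope shift \<open>q\<close>, then
    \<open>q\<close> is varied under the factor 1 + p', which is at most 2.\<close>
  have e: "pert p q N - pert p' q' N = (p - p') *\<^sub>R X + (1 + p') *\<^sub>R Y"
    by (simp add: pert_def X_def Y_def algebra_simps)
  have "norm (q *\<^sub>R shear1 N) \<le> 1 * (2 * norm N)" unfolding norm_scaleR using assms(2) s1 by (intro mult_mono) auto
  moreover have "norm (q\<^sup>2 *\<^sub>R shear2 N) \<le> 1 * norm N" unfolding norm_scaleR using q1 s2 by (intro mult_mono) auto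
  ultimately have nX: "norm X \<le> 4 * norm N"
    unfolding X_def using norm_triangle_ineq[of "N + q *\<^sub>R shear1 N" "q\<^sup>2 *\<^sub>R shear2 N"] norm_triangle_ineq[of N "q *\<^sub>R shear1 N"] by linarith
  have "norm ((q - q') *\<^sub>R shear1 N) \<le> \<bar>q - q'\<bar> * (2 * norm N)" unfolding norm_scaleR using s1 by (intro mult_left_mono) auto
  moreover have "norm ((q\<^sup>2 - q'\<^sup>2) *\<^sub>R shear2 N) \<le> (2 * \<bar>q - q'\<bar>) * norm N" unfolding norm_scaleR using qq s2 by (intro mult_mono) auto
  ultimately have nY: "norm Y \<le> 4 * \<bar>q - q'\<bar> * norm N"
    unfolding Y_def using norm_triangle_ineq[of "(q - q') *\<^sub>R shear1 N" "(q\<^sup>2 - q'\<^sup>2) *\<^sub>R shear2 N"] by linarith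
  have "norm ((p - p') *\<^sub>R X) \<le> \<bar>p - p'\<bar> * (4 * norm N)" unfolding norm_scaleR using nX by (intro mult_left_mono) auto
  moreover have "norm ((1 + p') *\<^sub>R Y) \<le> 2 * (4 * \<bar>q - q'\<bar> * norm N)"
    unfolding norm_scaleR using nY assms(3) by (intro mult_mono) auto
  moreover have "0 \<le> \<bar>p - p'\<bar> * norm N" by simp
  moreover have "8 * (\<bar>p - p'\<bar> + \<bar>q - q'\<bar>) * norm N = 8 * (\<bar>p - p'\<bar> * norm N) + 8 * (\<bar>q - q'\<bar> * norm N)"
    by (simp add: algebra_simps)
  ultimately show ?thesis
    unfolding e using norm_triangle_ineq[of "(p - p') *\<^sub>R X" "(1 + p') *\<^sub>R Y"] by linarith
qed

lemma norm_pert_linear: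
  assumes "\<bar>p\<bar> \<le> 1" "\<bar>q\<bar> \<le> 1"
  shows "norm (pert p q N - N - varfield p q N) \<le> 2 * (\<bar>p\<bar> + \<bar>q\<bar>)\<^sup>2 * norm N"
proof -
  have e: "pert p q N - N - varfield p q N = (p * q) *\<^sub>R shear1 N + ((1 + p) * q\<^sup>2) *\<^sub>R shear2 N"
    by (simp add: pert_def varfield_def algebra_simps)
  have "norm ((p * q) *\<^sub>R shear1 N) \<le> (\<bar>p\<bar> * \<bar>q\<bar>) * (2 * norm N)"
    unfolding norm_scaleR abs_mult by (intro mult_left_mono norm_shear1) auto
  moreover have "norm (((1 + p) * q\<^sup>2) *\<^sub>R shear2 N) \<le> (2 * \<bar>q\<bar>\<^sup>2) * norm N"
    unfolding norm_scaleR abs_mult using assms by (intro mult_mono norm_shear2) auto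
  ultimately have "norm (pert p q N - N - varfield p q N) \<le> (2 * (\<bar>p\<bar> * \<bar>q\<bar>) + 2 * \<bar>q\<bar>\<^sup>2) * norm N"
    unfolding e using norm_triangle_ineq[of "(p * q) *\<^sub>R shear1 N" "((1 + p) * q\<^sup>2) *\<^sub>R shear2 N"] by (simp add: algebra_simps)
  also have "\<dots> \<le> 2 * (\<bar>p\<bar> + \<bar>q\<bar>)\<^sup>2 * norm N"
  proof (rule mult_right_mono)
    have "2 * (a * b) + 2 * b\<^sup>2 \<le> 2 * (a + b)\<^sup>2" if "0 \<le> a" "0 \<le> b" for a b :: real
    proof -
      have "0 \<le> 2 * a\<^sup>2 + 2 * (a * b)" using that by simp
      then show ?thesis by (simp add: power2_sum algebra_simps)
    qed
    then show "2 * (\<bar>p\<bar> * \<bar>q\<bar>) + 2 * \<bar>q\<bar>\<^sup>2 \<le> 2 * (\<bar>p\<bar> + \<bar>q\<bar>)\<^sup>2"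
      by this auto
  qed simp
  finally show ?thesis .
qed

lemma sqint_pert:
  assumes "sqint M" "continuous_on {0..1} \<phi>" "continuous_on {0..1} \<psi>"
  shows "sqint (\<lambda>t. pert (\<phi> t) (\<psi> t) (M t))"
  unfolding pert_def
  by (intro sqint_add sqint_scaleR sqint_linear[OF _ bounded_linear_shear1] sqint_linear[OF _ bounded_linear_shear2]
      continuous_intros assms)

text \<open>Integration by parts moves the derivative to the multiplier, so a small primitive of
  \<open>D\<close> stays small after multiplication by a function with bounded derivative, even if
  \<open>D\<close> itself is large.\<close>

lemma multiplier_bound:
  fixes D :: "real \<Rightarrow> 'a::euclidean_space"
  assumes D: "D absolutely_integrable_on {0..1}" and \<eta>: "primitive \<eta>' \<eta>" "continuous_on {0..1} \<eta>'"
    and a: "\<And>t. t \<in> {0..1} \<Longrightarrow> \<bar>\<eta> t\<bar> \<le> a" "\<And>t. t \<in> {0..1} \<Longrightarrow> \<bar>\<eta>' t\<bar> \<le> a"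
    and d: "\<And>t. t \<in> {0..1} \<Longrightarrow> norm (integral {0..t} D) \<le> \<delta>" and t: "t \<in> {0..1}"
  shows "norm (integral {0..t} (\<lambda>t. \<eta> t *\<^sub>R D t)) \<le> 2 * a * \<delta>"
proof -
  define F where "F = (\<lambda>t. integral {0..t} D)"
  have pF: "primitive D F" unfolding F_def by (rule primitive_integral[OF D])
  have F: "norm (F t) \<le> \<delta>" if "t \<in> {0..1}" for t using d[OF that] by (simp add: F_def)
  have F0: "F 0 = 0" by (simp add: F_def)
  have a0: "a \<ge> 0" using a(1)[OF t] by linarith
  have d0: "\<delta> \<ge> 0" using F[OF t] norm_ge_zero order_trans by blast
  have p: "primitive (\<lambda>t. \<eta>' t *\<^sub>R F t + \<eta> t *\<^sub>R D t) (\<lambda>t. \<eta> t *\<^sub>R F t)"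
    by (rule primitive_bilinear[OF bounded_bilinear_scaleR \<eta>(1) pF])
  have c: "continuous_on {0..1} (\<lambda>t. \<eta>' t *\<^sub>R F t)"
    by (intro continuous_intros \<eta> primitive_continuous[OF pF])
  have ai: "(\<lambda>t. \<eta> t *\<^sub>R D t) absolutely_integrable_on {0..1}"
    by (rule ai_bilinear[OF bounded_bilinear.flip[OF bounded_bilinear_scaleR] D primitive_continuous[OF \<eta>(1)]])
  have i: "(\<lambda>t. \<eta>' t *\<^sub>R F t) integrable_on {0..t}" "(\<lambda>t. \<eta> t *\<^sub>R D t) integrable_on {0..t}"
    using ai_integrable_sub[OF absolutely_integrable_continuous_real[OF c], of 0 t] ai_integrable_sub[OF ai, of 0 t] t by auto
  have "\<eta> t *\<^sub>R F t = integral {0..t} (\<lambda>t. \<eta>' t *\<^sub>R F t) + integral {0..t} (\<lambda>t. \<eta> t *\<^sub>R D t)"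
    using primitive_value[OF p, of t] t F0 Henstock_Kurzweil_Integration.integral_add[OF i] by simp
  then have eq: "integral {0..t} (\<lambda>t. \<eta> t *\<^sub>R D t) = \<eta> t *\<^sub>R F t - integral {0..t} (\<lambda>t. \<eta>' t *\<^sub>R F t)"
    by (simp add: algebra_simps)
  have 1: "norm (\<eta> t *\<^sub>R F t) \<le> a * \<delta>"
    unfolding norm_scaleR using a(1)[OF t] F[OF t] a0 by (intro mult_mono) auto
  have "norm (integral {0..t} (\<lambda>t. \<eta>' t *\<^sub>R F t)) \<le> integral {0..t} (\<lambda>_. a * \<delta>)"
  proof (rule norm_integral_le)
    show "(\<lambda>t. \<eta>' t *\<^sub>R F t) absolutely_integrable_on {0..t}"
      using ai_subinterval[OF absolutely_integrable_continuous_real[OF c], of 0 t] t by auto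
    show "norm (\<eta>' u *\<^sub>R F u) \<le> a * \<delta>" if "u \<in> {0..t}" for u
      unfolding norm_scaleR using a(2)[of u] F[of u] a0 that t by (intro mult_mono) auto
  qed (rule integrable_const_ivl)
  also have "\<dots> = t * (a * \<delta>)" using t by simp
  also have "\<dots> \<le> 1 * (a * \<delta>)" using t a0 d0 by (intro mult_right_mono) auto
  finally show ?thesis
    unfolding eq using 1 norm_triangle_ineq4[of "\<eta> t *\<^sub>R F t" "integral {0..t} (\<lambda>t. \<eta>' t *\<^sub>R F t)"] by (simp add: algebra_simps)
qed

lemma integral_linear_bound:
  fixes D :: "real \<Rightarrow> 'a::euclidean_space" and h :: "'a \<Rightarrow> 'b::euclidean_space"
  assumes "D absolutely_integrable_on {0..1}" "bounded_linear h" "\<And>x. norm (h x) \<le> c * norm x"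
    and "norm (integral {0..t} D) \<le> \<delta>" "t \<in> {0..1}" "c \<ge> 0"
  shows "norm (integral {0..t} (\<lambda>s. h (D s))) \<le> c * \<delta>"
proof -
  have "integral {0..t} (\<lambda>s. h (D s)) = h (integral {0..t} D)"
    using integral_linear[OF ai_integrable_sub[OF assms(1), of 0 t] assms(2)] assms(5) by (simp add: o_def)
  then show ?thesis using assms(3)[of "integral {0..t} D"] mult_left_mono[OF assms(4,6)] by simp
qed

text \<open>The perturbed field is a sum of \<open>D\<close>, \<open>shear1 (D t)\<close> and
  \<open>shear2 (D t)\<close> with multipliers that, like their derivatives, are bounded by 5. The
  primitives of the three fields are bounded by 1, 2 and 1 times \<open>\<delta>\<close>, and 2 * 5
  * (1 + 2 + 1) = 40.\<close>

lemma primitive_pert_bound: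
  assumes D: "sqint D" and d: "\<And>t. t \<in> {0..1} \<Longrightarrow> norm (integral {0..t} D) \<le> \<delta>"
    and \<phi>: "primitive \<phi>' \<phi>" "continuous_on {0..1} \<phi>'" and \<psi>: "primitive \<psi>' \<psi>" "continuous_on {0..1} \<psi>'"
    and b: "\<And>t. t \<in> {0..1} \<Longrightarrow> \<bar>\<phi> t\<bar> \<le> 1" "\<And>t. t \<in> {0..1} \<Longrightarrow> \<bar>\<phi>' t\<bar> \<le> 1"
      "\<And>t. t \<in> {0..1} \<Longrightarrow> \<bar>\<psi> t\<bar> \<le> 1" "\<And>t. t \<in> {0..1} \<Longrightarrow> \<bar>\<psi>' t\<bar> \<le> 1"
    and t: "t \<in> {0..1}"
  shows "norm (integral {0..t} (\<lambda>t. pert (\<phi> t) (\<psi> t) (D t))) \<le> 40 * \<delta>"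
proof -
  note ai = sqint_ai[OF D]
  note c\<phi> = primitive_continuous[OF \<phi>(1)] and c\<psi> = primitive_continuous[OF \<psi>(1)]
  have aiS: "(\<lambda>t. shear1 (D t)) absolutely_integrable_on {0..1}" "(\<lambda>t. shear2 (D t)) absolutely_integrable_on {0..1}"
    by (intro sqint_ai sqint_linear[OF D] bounded_linear_shear1 bounded_linear_shear2)+
  have S1: "norm (integral {0..t} (\<lambda>t. shear1 (D t))) \<le> 2 * \<delta>" if "t \<in> {0..1}" for t
    by (rule integral_linear_bound[OF ai bounded_linear_shear1 norm_shear1 d[OF that] that]) simp
  have S2: "norm (integral {0..t} (\<lambda>t. shear2 (D t))) \<le> 1 * \<delta>" if "t \<in> {0..1}" for t
    by (rule integral_linear_bound[OF ai bounded_linear_shear2 _ d[OF that] that]) (simp_all add: norm_shear2)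
  have p0: "primitive \<phi>' (\<lambda>t. 1 + \<phi> t)" using primitive_add[OF primitive_const \<phi>(1), of 1] by simp
  have p1: "primitive (\<lambda>t. \<phi>' t * \<psi> t + (1 + \<phi> t) * \<psi>' t) (\<lambda>t. (1 + \<phi> t) * \<psi> t)"
    by (rule primitive_bilinear[OF bounded_bilinear_mult p0 \<psi>(1)])
  have p2: "primitive (\<lambda>t. (\<phi>' t * \<psi> t + (1 + \<phi> t) * \<psi>' t) * \<psi> t + ((1 + \<phi> t) * \<psi> t) * \<psi>' t) (\<lambda>t. ((1 + \<phi> t) * \<psi> t) * \<psi> t)"
    by (rule primitive_bilinear[OF bounded_bilinear_mult p1 \<psi>(1)])
  have c0: "continuous_on {0..1} (\<lambda>t. \<phi>' t * \<psi> t + (1 + \<phi> t) * \<psi>' t)"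
    by (intro continuous_intros c\<phi> c\<psi> \<phi> \<psi>)
  have c2: "continuous_on {0..1} (\<lambda>t. (\<phi>' t * \<psi> t + (1 + \<phi> t) * \<psi>' t) * \<psi> t + ((1 + \<phi> t) * \<psi> t) * \<psi>' t)"
    by (intro continuous_intros c\<phi> c\<psi> \<phi> \<psi>)
  have b0: "\<bar>1 + \<phi> t\<bar> \<le> 2" "\<bar>(1 + \<phi> t) * \<psi> t\<bar> \<le> 2" "\<bar>\<phi>' t * \<psi> t + (1 + \<phi> t) * \<psi>' t\<bar> \<le> 3"
    "\<bar>((1 + \<phi> t) * \<psi> t) * \<psi> t\<bar> \<le> 2" "\<bar>(\<phi>' t * \<psi> t + (1 + \<phi> t) * \<psi>' t) * \<psi> t + ((1 + \<phi> t) * \<psi> t) * \<psi>' t\<bar> \<le> 5" if "t \<in> {0..1}" for t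
  proof -
    note b = b[OF that]
    show 1: "\<bar>1 + \<phi> t\<bar> \<le> 2" using b by linarith
    have m: "\<bar>x * y\<bar> \<le> c" if "\<bar>x\<bar> \<le> c" "\<bar>y\<bar> \<le> 1" for x y c :: real
      using mult_mono[OF that] that by (simp add: abs_mult)
    show 2: "\<bar>(1 + \<phi> t) * \<psi> t\<bar> \<le> 2" using m[OF 1 b(3)] .
    have 3: "\<bar>(1 + \<phi> t) * \<psi>' t\<bar> \<le> 2" using m[OF 1 b(4)] .
    show 4: "\<bar>\<phi>' t * \<psi> t + (1 + \<phi> t) * \<psi>' t\<bar> \<le> 3" using m[OF b(2,3)] 3 by linarith
    show "\<bar>((1 + \<phi> t) * \<psi> t) * \<psi> t\<bar> \<le> 2" using m[OF 2 b(3)] .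
    show "\<bar>(\<phi>' t * \<psi> t + (1 + \<phi> t) * \<psi>' t) * \<psi> t + ((1 + \<phi> t) * \<psi> t) * \<psi>' t\<bar> \<le> 5"
      using m[OF 4 b(3)] m[OF 2 b(4)] by linarith
  qed
  let ?I0 = "\<lambda>t. (1 + \<phi> t) *\<^sub>R D t" and ?I1 = "\<lambda>t. ((1 + \<phi> t) * \<psi> t) *\<^sub>R shear1 (D t)"
    and ?I2 = "\<lambda>t. (((1 + \<phi> t) * \<psi> t) * \<psi> t) *\<^sub>R shear2 (D t)"
  have "norm (integral {0..t} ?I0) \<le> 2 * 5 * \<delta>"
    by (rule multiplier_bound[OF ai p0 \<phi>(2) _ _ d t]) (use b0(1) b(2) in fastforce)+
  moreover have "norm (integral {0..t} ?I1) \<le> 2 * 5 * (2 * \<delta>)"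
    by (rule multiplier_bound[OF aiS(1) p1 c0 _ _ S1 t]) (use b0(2,3) in fastforce)+
  moreover have "norm (integral {0..t} ?I2) \<le> 2 * 5 * (1 * \<delta>)"
    by (rule multiplier_bound[OF aiS(2) p2 c2 _ _ S2 t]) (use b0(4,5) in fastforce)+
  moreover have "integral {0..t} (\<lambda>t. pert (\<phi> t) (\<psi> t) (D t)) = integral {0..t} ?I0 + integral {0..t} ?I1 + integral {0..t} ?I2"
  proof -
    have "?I0 integrable_on {0..t}" "?I1 integrable_on {0..t}" "?I2 integrable_on {0..t}"
      using t by (auto intro!: ai_integrable_sub sqint_ai sqint_scaleR sqint_linear[OF D] D bounded_linear_shear1 bounded_linear_shear2 continuous_intros c\<phi> c\<psi>)
    then show ?thesis
      by (simp only: pert_def power2_eq_square mult.assoc[symmetric] Henstock_Kurzweil_Integration.integral_add integrable_add)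
  qed
  moreover have "\<delta> \<ge> 0" using d[OF t] norm_ge_zero order_trans by blast
  ultimately show ?thesis
    using norm_triangle_ineq[of "integral {0..t} ?I0 + integral {0..t} ?I1" "integral {0..t} ?I2"]
      norm_triangle_ineq[of "integral {0..t} ?I0" "integral {0..t} ?I1"] by simp
qed

text \<open>The axial vector of the skew part, a linear left inverse of \<open>crossmat\<close>. It
  serves as a coordinate for rotations near the identity.\<close>

definition axial :: "real^3^3 \<Rightarrow> real^3" where
  "axial Q = (1/2) *\<^sub>R vector [Q$3$2 - Q$2$3, Q$1$3 - Q$3$1, Q$2$1 - Q$1$2]"

lemma bounded_linear_axial: "bounded_linear axial"
  unfolding linear_conv_bounded_linear[symmetric]
  by (rule linearI) (simp_all add: axial_def vec_eq_iff forall_3 algebra_simps)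

lemma axial_crossmat: "axial (crossmat w) = w"
  by (simp add: axial_def crossmat_def vec_eq_iff forall_3)

lemma axial_zero_symmetric: "axial Q = 0 \<Longrightarrow> transpose Q = Q"
  unfolding axial_def vec_eq_iff forall_3 transpose_def by simp

text \<open>Defined for arbitrary matrix-valued curves and linear in \<open>Y\<close>, so that it
  can be applied to differences of frames and to the linearised curve, which are not rotations.
  Relative to \<open>R\<close>, the first component describes the final value by three
  coordinates.\<close>

definition endpoint :: "real^3^3 \<Rightarrow> (real \<Rightarrow> real^3^3) \<Rightarrow> (real^3) \<times> (real^3)" where
  "endpoint R Y = (axial (transpose R ** Y 1), integral {0..1} (\<lambda>t. transpose (Y t) *v axis 1 1))"

lemma continuous_on_transpose_e1:
  fixes Y :: "real \<Rightarrow> real^3^3"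
  assumes "continuous_on S Y" shows "continuous_on S (\<lambda>t. transpose (Y t) *v axis 1 1)"
  by (intro bounded_bilinear.continuous_on[OF bounded_bilinear_matrix_vector_mult] continuous_on_transpose assms continuous_intros)

lemma endpoint_diff:
  assumes "continuous_on {0..1} Y" "continuous_on {0..1} Z"
  shows "endpoint R (\<lambda>t. Y t - Z t) = endpoint R Y - endpoint R Z"
proof -
  have i: "(\<lambda>t. transpose (Y t) *v axis 1 1) integrable_on {0..1}" "(\<lambda>t. transpose (Z t) *v axis 1 1) integrable_on {0..1}"
    by (intro integrable_continuous_real continuous_on_transpose_e1 assms)+
  have "transpose (Y t - Z t) *v axis 1 1 = transpose (Y t) *v axis 1 1 - transpose (Z t) *v axis 1 1" for t
    by (simp only: linear_diff[OF bounded_linear.linear[OF bounded_linear_transpose]]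
        bounded_bilinear.diff_left[OF bounded_bilinear_matrix_vector_mult])
  then show ?thesis
    by (simp only: endpoint_def matrix_mult_diff_right linear_diff[OF bounded_linear.linear[OF bounded_linear_axial]]
        Henstock_Kurzweil_Integration.integral_diff[OF i] diff_Pair)
qed

lemma endpoint_bound:
  obtains c where "c > 0" "\<And>R Y \<sigma>. \<lbrakk>norm R \<le> 2; continuous_on {0..1} Y; \<And>t. t \<in> {0..1} \<Longrightarrow> norm (Y t) \<le> \<sigma>\<rbrakk>
    \<Longrightarrow> norm (endpoint R Y) \<le> c * \<sigma>"
proof -
  obtain c1 where c1: "c1 > 0" "\<And>x. norm (axial x) \<le> norm x * c1"
    using bounded_linear.pos_bounded[OF bounded_linear_axial] by blast
  obtain c2 where c2: "c2 > 0" "\<And>x::real^3^3. norm (transpose x) \<le> norm x * c2"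
    using bounded_linear.pos_bounded[OF bounded_linear_transpose] by blast
  obtain c3 where c3: "c3 > 0" "\<And>(x::real^3^3) y. norm (x *v y) \<le> norm x * norm y * c3"
    using bounded_bilinear.pos_bounded[OF bounded_bilinear_matrix_vector_mult] by blast
  have e1: "norm (axis 1 1 :: real^3) = 1" by (simp add: norm_eq_1 inner_axis_axis)
  show ?thesis
  proof (rule that[of "2 * c2 * c1 + c2 * c3"])
    show "2 * c2 * c1 + c2 * c3 > 0" using c1(1) c2(1) c3(1) by (simp add: add_pos_pos)
    fix R :: "real^3^3" and Y :: "real \<Rightarrow> real^3^3" and \<sigma> :: real
    assume R: "norm R \<le> 2" and Y: "continuous_on {0..1} Y" "\<And>t. t \<in> {0..1} \<Longrightarrow> norm (Y t) \<le> \<sigma>"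
    have s0: "\<sigma> \<ge> 0" using order_trans[OF norm_ge_zero Y(2)[of 0]] by simp
    have "norm (transpose R ** Y 1) \<le> norm (transpose R) * norm (Y 1)" by (rule norm_matrix_mult_le)
    also have "\<dots> \<le> (2 * c2) * \<sigma>"
    proof (rule mult_mono)
      show "norm (transpose R) \<le> 2 * c2" using order_trans[OF c2(2)[of R] mult_right_mono[OF R, of c2]] c2(1) by linarith
      show "norm (Y 1) \<le> \<sigma>" using Y(2)[of 1] by simp
    qed (use c2 in auto)
    finally have "norm (transpose R ** Y 1) * c1 \<le> 2 * c2 * \<sigma> * c1"
      using c1(1) by (intro mult_right_mono) auto
    then have "norm (axial (transpose R ** Y 1)) \<le> 2 * c2 * \<sigma> * c1"
      by (rule order_trans[OF c1(2)])
    moreover have "norm (integral {0..1} (\<lambda>t. transpose (Y t) *v axis 1 1)) \<le> integral {0..1::real} (\<lambda>_. \<sigma> * c2 * c3)"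
    proof (rule norm_integral_le)
      show "(\<lambda>t. transpose (Y t) *v axis 1 1) absolutely_integrable_on {0..1}"
        by (intro absolutely_integrable_continuous_real continuous_on_transpose_e1 Y)
      fix t :: real assume t: "t \<in> {0..1}"
      have "norm (transpose (Y t) *v axis 1 1) \<le> norm (transpose (Y t)) * norm (axis 1 1 :: real^3) * c3" by (rule c3)
      also have "\<dots> = norm (transpose (Y t)) * c3" by (simp add: e1)
      also have "\<dots> \<le> (\<sigma> * c2) * c3"
        using order_trans[OF c2(2)[of "Y t"] mult_right_mono[OF Y(2)[OF t], of c2]] c2(1) c3(1)
        by (intro mult_right_mono) linarith+
      finally show "norm (transpose (Y t) *v axis 1 1) \<le> \<sigma> * c2 * c3" .
    qed auto
    ultimately show "norm (endpoint R Y) \<le> (2 * c2 * c1 + c2 * c3) * \<sigma>"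
      unfolding endpoint_def using norm_Pair_le[of "axial (transpose R ** Y 1)" "integral {0..1} (\<lambda>t. transpose (Y t) *v axis 1 1)"]
      by (simp add: algebra_simps)
  qed
qed

text \<open>With vanishing axial vector, Q = R^T R' is a symmetric rotation, so Q^2 = 1 and (Q -
  1)^2 = - 2 (Q - 1). Submultiplicativity leaves only Q = 1 or a distance of at least 2 from the
  identity. The latter occurs for half turns, hence the smallness assumption.\<close>

lemma rotation_eq_of_axial_zero:
  assumes R: "rotation_matrix R" and R': "rotation_matrix R'" and a: "axial (transpose R ** R') = 0"
    and n: "norm (R' - R) < 1"
  shows "R' = R"
proof -
  define Q where "Q = transpose R ** R'"
  have RR: "transpose R ** R = mat 1" "R ** transpose R = mat 1"
    and RR': "transpose R' ** R' = mat 1" "R' ** transpose R' = mat 1"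
    using R R' by (auto simp: rotation_matrix_def orthogonal_matrix_def)
  have "transpose Q ** Q = transpose R' ** (R ** transpose R) ** R'"
    by (simp add: Q_def matrix_transpose_mul matrix_mul_assoc)
  then have "transpose Q ** Q = mat 1" by (simp add: RR RR')
  moreover have "transpose Q = Q" using a by (intro axial_zero_symmetric) (simp add: Q_def)
  ultimately have QQ: "Q ** Q = mat 1" by simp
  have "(Q - mat 1) ** (Q - mat 1) = - 2 *\<^sub>R (Q - mat 1)"
    by (simp add: matrix_mult_diff_left matrix_mult_diff_right QQ scaleR_2 algebra_simps)
  then have "2 * norm (Q - mat 1) = norm ((Q - mat 1) ** (Q - mat 1))" by simp
  also have "\<dots> \<le> norm (Q - mat 1) * norm (Q - mat 1)" by (rule norm_matrix_mult_le)
  finally have 1: "2 * norm (Q - mat 1) \<le> norm (Q - mat 1) * norm (Q - mat 1)" .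
  have "Q - mat 1 = transpose R ** (R' - R)" by (simp add: Q_def matrix_mult_diff_right RR)
  then have "norm (Q - mat 1) \<le> norm (transpose R) * norm (R' - R)" using norm_matrix_mult_le by metis
  also have "\<dots> \<le> 2 * norm (R' - R)"
    by (intro mult_right_mono norm_rotation rotation_matrix_transpose R) simp
  also have "\<dots> < 2" using n by simp
  finally have 2: "norm (Q - mat 1) < 2" .
  have "norm (Q - mat 1) = 0"
  proof (rule ccontr)
    assume "norm (Q - mat 1) \<noteq> 0"
    then have "norm (Q - mat 1) > 0" by simp
    then have "norm (Q - mat 1) * norm (Q - mat 1) < 2 * norm (Q - mat 1)" using 2 by (intro mult_strict_right_mono)
    then show False using 1 by simp
  qed
  then have "Q = mat 1" by simp
  then have "R ** Q = R" by simp
  then show ?thesis by (simp add: Q_def matrix_mul_assoc RR)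
qed

lemma variation_sum:
  assumes r: "continuous_on {0..1} r" and I: "finite I"
    and v: "\<And>i. i \<in> I \<Longrightarrow> variation r M (\<phi> i) (\<psi> i) (\<omega> i)"
  shows "variation r M (\<lambda>t. \<Sum>i\<in>I. c i * \<phi> i t) (\<lambda>t. \<Sum>i\<in>I. c i * \<psi> i t) (\<lambda>t. \<Sum>i\<in>I. c i *\<^sub>R \<omega> i t)
    \<and> endpoint_variation r (\<lambda>t. \<Sum>i\<in>I. c i *\<^sub>R \<omega> i t) = (\<Sum>i\<in>I. c i *\<^sub>R endpoint_variation r (\<omega> i))"
  using I v
proof (induction I rule: finite_induct)
  case empty
  have "variation r M (\<lambda>_. 0) (\<lambda>_. 0) (\<lambda>_. 0)"
    by (simp add: variation_def smooth0_const_0 varfield_def primitive_const linear_0[OF bounded_linear.linear[OF bounded_linear_bvec]])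
  then show ?case by (simp add: endpoint_variation_def zero_prod_def)
next
  case (insert i I)
  have 1: "variation r M (\<lambda>t. c i * \<phi> i t) (\<lambda>t. c i * \<psi> i t) (\<lambda>t. c i *\<^sub>R \<omega> i t)"
    "endpoint_variation r (\<lambda>t. c i *\<^sub>R \<omega> i t) = c i *\<^sub>R endpoint_variation r (\<omega> i)"
    using variation_scale[OF r insert.prems[of i]] by auto
  have 2: "variation r M (\<lambda>t. \<Sum>i\<in>I. c i * \<phi> i t) (\<lambda>t. \<Sum>i\<in>I. c i * \<psi> i t) (\<lambda>t. \<Sum>i\<in>I. c i *\<^sub>R \<omega> i t)"
    "endpoint_variation r (\<lambda>t. \<Sum>i\<in>I. c i *\<^sub>R \<omega> i t) = (\<Sum>i\<in>I. c i *\<^sub>R endpoint_variation r (\<omega> i))"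
    using insert.IH insert.prems by auto
  show ?case
    using variation_add[OF r 1(1) 2(1)] insert.hyps by (simp add: 1(2) 2(2))
qed

lemma endpoint_variation_eq:
  assumes v: "variation r M \<phi> \<psi> \<omega>" and r: "continuous_on {0..1} r" and rot: "rotation_matrix (r 1)"
  shows "endpoint (r 1) (\<lambda>t. r t ** crossmat (\<omega> t)) = endpoint_variation r \<omega>"
proof -
  have "transpose (r 1) ** (r 1 ** crossmat (\<omega> 1)) = crossmat (\<omega> 1)"
    using rot by (simp add: matrix_mul_assoc rotation_matrix_def orthogonal_matrix_def)
  moreover have "transpose (r t ** crossmat (\<omega> t)) *v axis 1 1 = - cross3 (\<omega> t) (transpose (r t) *v axis 1 1)" for t
  proof -
    have "transpose (crossmat w) = - crossmat w" for w
      by (simp add: crossmat_def transpose_def vec_eq_iff forall_3)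
    then have "transpose (r t ** crossmat (\<omega> t)) = - crossmat (\<omega> t) ** transpose (r t)" by (simp add: matrix_transpose_mul)
    then have "transpose (r t ** crossmat (\<omega> t)) *v axis 1 1 = - crossmat (\<omega> t) *v (transpose (r t) *v axis 1 1)"
      by (simp only: matrix_vector_mul_assoc)
    then show ?thesis
      by (simp only: bounded_bilinear.minus_left[OF bounded_bilinear_matrix_vector_mult] crossmat_mult_vec)
  qed
  ultimately show ?thesis
    by (simp only: endpoint_def endpoint_variation_def axial_crossmat integral_neg)
qed

section \<open>Weak convergence from small primitives and an L2 bound\<close>

lemma sqint_integrable_products:
  fixes f g :: "real \<Rightarrow> 'a::euclidean_space"
  assumes "sqint f" "sqint g"
  shows "(\<lambda>t. f t \<bullet> g t) absolutely_integrable_on {0..1}"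
proof (rule ai_bounded_by)
  show "(\<lambda>t. f t \<bullet> g t) \<in> borel_measurable (lebesgue_on {0..1})"
    using assms by (auto simp: sqint_def)
  show "(\<lambda>t. (norm (f t))\<^sup>2 + (norm (g t))\<^sup>2) absolutely_integrable_on {0..1}"
    using assms by (intro set_integral_add(1)) (auto simp: sqint_def)
  show "norm (f t \<bullet> g t) \<le> (norm (f t))\<^sup>2 + (norm (g t))\<^sup>2" for t
  proof -
    have "2 * (norm (f t) * norm (g t)) \<le> (norm (f t))\<^sup>2 + (norm (g t))\<^sup>2"
      using zero_le_power2[of "norm (f t) - norm (g t)"] by (simp add: power2_diff)
    moreover have "norm (f t \<bullet> g t) \<le> norm (f t) * norm (g t)" by (simp add: Cauchy_Schwarz_ineq2)
    moreover have "0 \<le> norm (f t) * norm (g t)" by simp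
    ultimately show ?thesis by linarith
  qed
qed

lemma integral_eventually_le:
  fixes F :: "nat \<Rightarrow> real \<Rightarrow> real"
  assumes "\<And>n. F n absolutely_integrable_on {0..1}" "g absolutely_integrable_on {0..1}"
    "\<And>n t. t \<in> {0..1} \<Longrightarrow> norm (F n t) \<le> g t" "negligible N"
    "\<And>t. t \<in> {0..1} - N \<Longrightarrow> (\<lambda>n. F n t) \<longlonglongrightarrow> 0" "e > 0"
  shows "\<exists>n. integral {0..1} (F n) \<le> e"
proof -
  have "(\<lambda>n. integral {0..1} (F n)) \<longlonglongrightarrow> integral {0..1::real} (\<lambda>_. 0 :: real)"
    by (rule dominated_convergence_ae[OF assms(1-5)])
  then have "\<forall>\<^sub>F n in sequentially. dist (integral {0..1} (F n)) 0 < e"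
    using assms(6) by (simp add: tendsto_iff)
  then obtain n where "dist (integral {0..1} (F n)) 0 < e"
    using eventually_happens by force
  then show ?thesis by (intro exI[of _ n]) (simp add: dist_real_def)
qed

text \<open>Truncation makes the function bounded, after which bounded smooth approximation and
  dominated convergence apply. Both squared errors are at most e / 4 because squaring their sum
  doubles them.\<close>

lemma smooth0_dense_L2:
  fixes f :: "real \<Rightarrow> real"
  assumes f: "sqint f" and e: "e > 0"
  shows "\<exists>q. smooth0 q \<and> integral {0..1} (\<lambda>t. (f t - q t)\<^sup>2) \<le> e"
proof -
  have fm: "f \<in> borel_measurable (lebesgue_on {0..1})" and f2: "(\<lambda>t. (f t)\<^sup>2) absolutely_integrable_on {0..1}"
    using f by (auto simp: sqint_def)
  define F where "F = (\<lambda>(k::nat) t. if \<bar>f t\<bar> \<le> real k then f t else 0)"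
  have Fs: "sqint (F k)" for k
  proof (rule sqint_bound[OF f, of _ 1])
    show "F k \<in> borel_measurable (lebesgue_on {0..1})" unfolding F_def using fm by measurable
  qed (simp add: F_def)
  have sq2: "(\<lambda>t. (g t)\<^sup>2) absolutely_integrable_on {0..1}" if "sqint g" for g :: "real \<Rightarrow> real"
    using that by (simp add: sqint_def)
  have "\<exists>k. integral {0..1} (\<lambda>t. (f t - F k t)\<^sup>2) \<le> e / 4"
  proof (rule integral_eventually_le[OF _ f2 _ negligible_empty])
    show "(\<lambda>t. (f t - F k t)\<^sup>2) absolutely_integrable_on {0..1}" for k by (intro sq2 sqint_diff f Fs)
    show "norm ((f t - F k t)\<^sup>2) \<le> (f t)\<^sup>2" for k t by (simp add: F_def)
    show "(\<lambda>k. (f t - F k t)\<^sup>2) \<longlonglongrightarrow> 0" for t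
    proof (rule tendsto_eventually)
      obtain k0 :: nat where "\<bar>f t\<bar> \<le> real k0" using real_arch_simple by blast
      then show "\<forall>\<^sub>F k in sequentially. (f t - F k t)\<^sup>2 = 0"
        unfolding eventually_sequentially F_def by (intro exI[of _ k0]) auto
    qed
  qed (use e in auto)
  then obtain k where k: "integral {0..1} (\<lambda>t. (f t - F k t)\<^sup>2) \<le> e / 4" by blast
  have Fk: "\<bar>F k t\<bar> \<le> real k" for t by (simp add: F_def)
  have "F k \<in> borel_measurable (lebesgue_on {0..1})" using Fs[of k] by (simp add: sqint_def)
  then obtain q N where q: "\<And>n. smooth0 (q n)" "\<And>n t. t \<in> {0..1} \<Longrightarrow> \<bar>q n t\<bar> \<le> real k + 1"
    "negligible N" "\<And>t. t \<in> {0..1} - N \<Longrightarrow> (\<lambda>n. q n t) \<longlonglongrightarrow> F k t"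
    using smooth0_approx[of "F k" "real k"] Fk by blast
  have qs: "sqint (q n)" for n using q(1)[of n] by (intro sqint_continuous smooth_cl_continuous) (simp add: smooth0_def)
  have "\<exists>n. integral {0..1} (\<lambda>t. (F k t - q n t)\<^sup>2) \<le> e / 4"
  proof (rule integral_eventually_le[OF _ _ _ q(3), where g = "\<lambda>_. (2 * real k + 1)\<^sup>2"])
    show "(\<lambda>t. (F k t - q n t)\<^sup>2) absolutely_integrable_on {0..1}" for n by (intro sq2 sqint_diff qs Fs)
    show "norm ((F k t - q n t)\<^sup>2) \<le> (2 * real k + 1)\<^sup>2" if "t \<in> {0..1}" for n t
    proof -
      have "\<bar>F k t - q n t\<bar> \<le> 2 * real k + 1" using Fk[of t] q(2)[OF that, of n] by linarith
      from power_mono[OF this, of 2] show ?thesis by simp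
    qed
    show "(\<lambda>n. (F k t - q n t)\<^sup>2) \<longlonglongrightarrow> 0" if "t \<in> {0..1} - N" for t
      using tendsto_power[OF tendsto_diff[OF tendsto_const q(4)[OF that]], of "F k t" 2] by simp
  qed (use e in auto)
  then obtain n where n: "integral {0..1} (\<lambda>t. (F k t - q n t)\<^sup>2) \<le> e / 4" by blast
  have i: "(\<lambda>t. (f t - F k t)\<^sup>2) integrable_on {0..1}" "(\<lambda>t. (F k t - q n t)\<^sup>2) integrable_on {0..1}"
    "(\<lambda>t. (f t - q n t)\<^sup>2) integrable_on {0..1}"
    using sq2[OF sqint_diff[OF f Fs[of k]]] sq2[OF sqint_diff[OF Fs[of k] qs[of n]]] sq2[OF sqint_diff[OF f qs[of n]]]
    by (auto simp: absolutely_integrable_on_def)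
  have "integral {0..1} (\<lambda>t. (f t - q n t)\<^sup>2) \<le> integral {0..1} (\<lambda>t. 2 * (f t - F k t)\<^sup>2 + 2 * (F k t - q n t)\<^sup>2)"
  proof (rule integral_le[OF i(3)])
    show "(\<lambda>t. 2 * (f t - F k t)\<^sup>2 + 2 * (F k t - q n t)\<^sup>2) integrable_on {0..1}"
      using integrable_add[OF integrable_cmul[OF i(1), of 2] integrable_cmul[OF i(2), of 2]] by simp
    show "(f t - q n t)\<^sup>2 \<le> 2 * (f t - F k t)\<^sup>2 + 2 * (F k t - q n t)\<^sup>2" for t
    proof -
      have "(x + y)\<^sup>2 \<le> 2 * x\<^sup>2 + 2 * y\<^sup>2" for x y :: real
        using zero_le_power2[of "x - y"] by (simp add: power2_sum power2_diff)
      from this[of "f t - F k t" "F k t - q n t"] show ?thesis by simp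
    qed
  qed
  also have "\<dots> = 2 * integral {0..1} (\<lambda>t. (f t - F k t)\<^sup>2) + 2 * integral {0..1} (\<lambda>t. (F k t - q n t)\<^sup>2)"
    using Henstock_Kurzweil_Integration.integral_add[OF integrable_cmul[OF i(1), of 2] integrable_cmul[OF i(2), of 2]] by simp
  also have "\<dots> \<le> e" using k n by simp
  finally show ?thesis using q(1)[of n] by blast
qed

text \<open>The test function is split into a smooth part, for which the small primitive is decisive
  by integration by parts, and a part small in L2, which is paired with the bounded sequence by
  Young's inequality.\<close>

lemma weak_convergence_scalar:
  fixes d :: "nat \<Rightarrow> real \<Rightarrow> real"
  assumes d: "\<And>n. sqint (d n)" "\<And>n. integral {0..1} (\<lambda>t. (d n t)\<^sup>2) \<le> K"
    and p: "\<And>n t. t \<in> {0..1} \<Longrightarrow> \<bar>integral {0..t} (d n)\<bar> \<le> \<epsilon> n" and \<epsilon>: "\<epsilon> \<longlonglongrightarrow> 0" and f: "sqint f"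
  shows "(\<lambda>n. integral {0..1} (\<lambda>t. d n t * f t)) \<longlonglongrightarrow> 0"
proof (rule LIMSEQ_I)
  fix e :: real assume e: "e > 0"
  have "0 \<le> integral {0..1} (\<lambda>t. (d 0 t)\<^sup>2)" using d(1)[of 0] by (intro integral_nonneg) (auto simp: sqint_def absolutely_integrable_on_def)
  then have K: "K \<ge> 0" using d(2)[of 0] by linarith
  \<comment> \<open>The weight in Young's inequality: the bounded sequence contributes \<tau> K, at
    most e / 4, and the L2 error \<tau> e / 2 of the test function contributes e / 8.\<close>
  define \<tau> where "\<tau> = e / (4 * (K + 1))"
  have \<tau>: "\<tau> > 0" "\<tau> * K \<le> e / 4"
    using e K by (auto simp: \<tau>_def field_simps)
  obtain q where q: "smooth0 q" "integral {0..1} (\<lambda>t. (f t - q t)\<^sup>2) \<le> \<tau> * e / 2"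
    using smooth0_dense_L2[OF f, of "\<tau> * e / 2"] \<tau>(1) e by auto
  obtain q' where q': "continuous_on {0..1} q'" "primitive q' q"
    using smooth_cl_primitive[of q] q(1) by (auto simp: smooth0_def)
  have "bounded (q ` {0..1})" "bounded (q' ` {0..1})"
    by (auto intro!: compact_imp_bounded compact_continuous_image compact_Icc q' primitive_continuous[OF q'(2)])
  then obtain a1 a2 where "\<And>t. t \<in> {0..1} \<Longrightarrow> \<bar>q t\<bar> \<le> a1" "\<And>t. t \<in> {0..1} \<Longrightarrow> \<bar>q' t\<bar> \<le> a2"
    unfolding bounded_iff by (metis image_eqI real_norm_def)
  then have a: "\<bar>q t\<bar> \<le> max a1 a2" "\<bar>q' t\<bar> \<le> max a1 a2" if "t \<in> {0..1}" for t using that by (auto simp: le_max_iff_disj)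
  define b where "b = max a1 a2"
  have qs: "sqint q" by (intro sqint_continuous primitive_continuous[OF q'(2)])
  have main: "\<bar>integral {0..1} (\<lambda>t. d n t * f t)\<bar> \<le> e * 3 / 4 + 2 * b * \<epsilon> n" for n
  proof -
    have i1: "(\<lambda>t. q t *\<^sub>R d n t) absolutely_integrable_on {0..1}"
      using sqint_ai[OF sqint_scaleR[OF primitive_continuous[OF q'(2)] d(1)]] .
    have i2: "(\<lambda>t. d n t * (f t - q t)) absolutely_integrable_on {0..1}"
      using sqint_integrable_products[OF d(1)[of n] sqint_diff[OF f qs]] by simp
    have i3: "(\<lambda>t. (d n t)\<^sup>2) integrable_on {0..1}" "(\<lambda>t. (f t - q t)\<^sup>2) integrable_on {0..1}"
      using d(1)[of n] sqint_diff[OF f qs] by (auto simp: sqint_def absolutely_integrable_on_def)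
    have "integral {0..1} (\<lambda>t. d n t * f t) = integral {0..1} (\<lambda>t. q t *\<^sub>R d n t + d n t * (f t - q t))"
      by (simp add: algebra_simps)
    also have "\<dots> = integral {0..1} (\<lambda>t. q t *\<^sub>R d n t) + integral {0..1} (\<lambda>t. d n t * (f t - q t))"
      using i1 i2 by (intro Henstock_Kurzweil_Integration.integral_add) (auto simp: absolutely_integrable_on_def)
    finally have eq: "integral {0..1} (\<lambda>t. d n t * f t) = integral {0..1} (\<lambda>t. q t *\<^sub>R d n t) + integral {0..1} (\<lambda>t. d n t * (f t - q t))" .
    have 1: "norm (integral {0..1} (\<lambda>t. q t *\<^sub>R d n t)) \<le> 2 * b * \<epsilon> n"
      by (rule multiplier_bound[OF sqint_ai[OF d(1)] q'(2,1)]) (use a p in \<open>auto simp: b_def\<close>)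
    have "norm (integral {0..1} (\<lambda>t. d n t * (f t - q t))) \<le> integral {0..1} (\<lambda>t. \<tau> * (d n t)\<^sup>2 + (1 / (4 * \<tau>)) * (f t - q t)\<^sup>2)"
    proof (rule norm_integral_le[OF i2])
      show "(\<lambda>t. \<tau> * (d n t)\<^sup>2 + (1 / (4 * \<tau>)) * (f t - q t)\<^sup>2) integrable_on {0..1}"
        using integrable_add[OF integrable_cmul[OF i3(1), of \<tau>] integrable_cmul[OF i3(2), of "1 / (4 * \<tau>)"]] by simp
      show "norm (d n t * (f t - q t)) \<le> \<tau> * (d n t)\<^sup>2 + (1 / (4 * \<tau>)) * (f t - q t)\<^sup>2" for t
      proof -
        have "\<bar>x\<bar> * \<bar>y\<bar> \<le> \<tau> * x\<^sup>2 + (1 / (4 * \<tau>)) * y\<^sup>2" for x y :: real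
        proof -
          have "0 \<le> (2 * \<tau> * \<bar>x\<bar> - \<bar>y\<bar>)\<^sup>2 / (4 * \<tau>)" using \<tau>(1) by simp
          also have "\<dots> = \<tau> * x\<^sup>2 + (1 / (4 * \<tau>)) * y\<^sup>2 - \<bar>x\<bar> * \<bar>y\<bar>"
            using \<tau>(1) by (simp add: power2_diff power_mult_distrib field_simps) (simp add: power2_eq_square)
          finally show ?thesis by simp
        qed
        then show ?thesis by (simp add: abs_mult)
      qed
    qed
    also have "\<dots> = \<tau> * integral {0..1} (\<lambda>t. (d n t)\<^sup>2) + (1 / (4 * \<tau>)) * integral {0..1} (\<lambda>t. (f t - q t)\<^sup>2)"
      using Henstock_Kurzweil_Integration.integral_add[OF integrable_cmul[OF i3(1), of \<tau>] integrable_cmul[OF i3(2), of "1 / (4 * \<tau>)"]] by simp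
    also have "\<dots> \<le> \<tau> * K + (1 / (4 * \<tau>)) * (\<tau> * e / 2)"
      using \<tau>(1) by (intro add_mono mult_left_mono d q) auto
    also have "(1 / (4 * \<tau>)) * (\<tau> * e / 2) = e / 8" using \<tau>(1) by simp
    finally have 2: "norm (integral {0..1} (\<lambda>t. d n t * (f t - q t))) \<le> e * 3 / 4"
      using \<tau>(2) e by linarith
    show ?thesis unfolding eq using 1 2 by (simp add: abs_le_iff) linarith
  qed
  have "(\<lambda>n. 2 * b * \<epsilon> n) \<longlonglongrightarrow> 2 * b * 0" by (intro tendsto_intros \<epsilon>)
  then have "\<forall>\<^sub>F n in sequentially. dist (2 * b * \<epsilon> n) (2 * b * 0) < e / 4" by (rule tendstoD) (use e in simp)
  then have "\<forall>\<^sub>F n in sequentially. 2 * b * \<epsilon> n < e / 4" by (rule eventually_mono) (simp add: dist_real_def)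
  then have "\<forall>\<^sub>F n in sequentially. norm (integral {0..1} (\<lambda>t. d n t * f t) - 0) < e"
  proof (rule eventually_mono)
    fix n assume "2 * b * \<epsilon> n < e / 4"
    then show "norm (integral {0..1} (\<lambda>t. d n t * f t) - 0) < e" using main[of n] by simp
  qed
  then show "\<exists>no. \<forall>n\<ge>no. norm (integral {0..1} (\<lambda>t. d n t * f t) - 0) < e"
    unfolding eventually_sequentially .
qed

lemma weak_convergence_matrix:
  fixes M :: "real \<Rightarrow> real^2^2"
  assumes F: "\<And>n. sqint (F n)" "\<And>n. integral {0..1} (\<lambda>t. (norm (F n t))\<^sup>2) \<le> K" and M: "sqint M"
    and p: "\<And>n t. t \<in> {0..1} \<Longrightarrow> norm (integral {0..t} (\<lambda>t. F n t - M t)) \<le> \<epsilon> n" and \<epsilon>: "\<epsilon> \<longlonglongrightarrow> 0" and \<phi>: "sqint \<phi>"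
  shows "(\<lambda>n. integral {0..1} (\<lambda>t. F n t \<bullet> \<phi> t)) \<longlonglongrightarrow> integral {0..1} (\<lambda>t. M t \<bullet> \<phi> t)"
proof -
  have bl: "bounded_linear (\<lambda>N::real^2^2. N $ i $ j)" for i j
    by (intro bounded_linear_compose[OF bounded_linear_vec_nth] bounded_linear_vec_nth)
  have entry: "\<bar>N $ i $ j\<bar> \<le> norm N" for N :: "real^2^2" and i j
    by (rule order_trans[OF component_le_norm_cart Finite_Cartesian_Product.norm_nth_le])
  have entry2: "(N $ i $ j)\<^sup>2 \<le> (norm N)\<^sup>2" for N :: "real^2^2" and i j
    using power_mono[OF entry[of N i j], of 2] by simp
  define D where "D = (\<lambda>n t. F n t - M t)"
  have Ds: "sqint (D n)" for n unfolding D_def by (intro sqint_diff F M)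
  define KD where "KD = 2 * K + 2 * integral {0..1} (\<lambda>t. (norm (M t))\<^sup>2)"
  have KD: "integral {0..1} (\<lambda>t. (norm (D n t))\<^sup>2) \<le> KD" for n
  proof -
    have i: "(\<lambda>t. (norm (D n t))\<^sup>2) integrable_on {0..1}" "(\<lambda>t. (norm (F n t))\<^sup>2) integrable_on {0..1}" "(\<lambda>t. (norm (M t))\<^sup>2) integrable_on {0..1}"
      using Ds[of n] F(1)[of n] M by (auto simp: sqint_def absolutely_integrable_on_def)
    have "integral {0..1} (\<lambda>t. (norm (D n t))\<^sup>2) \<le> integral {0..1} (\<lambda>t. 2 * (norm (F n t))\<^sup>2 + 2 * (norm (M t))\<^sup>2)"
    proof (rule integral_le[OF i(1)])
      show "(\<lambda>t. 2 * (norm (F n t))\<^sup>2 + 2 * (norm (M t))\<^sup>2) integrable_on {0..1}"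
        using integrable_add[OF integrable_cmul[OF i(2), of 2] integrable_cmul[OF i(3), of 2]] by simp
      fix t
      have "(norm (D n t))\<^sup>2 \<le> (norm (F n t) + norm (M t))\<^sup>2"
        unfolding D_def by (intro power_mono norm_triangle_ineq4) simp
      also have "\<dots> \<le> 2 * (norm (F n t))\<^sup>2 + 2 * (norm (M t))\<^sup>2"
        using zero_le_power2[of "norm (F n t) - norm (M t)"] by (simp add: power2_sum power2_diff)
      finally show "(norm (D n t))\<^sup>2 \<le> 2 * (norm (F n t))\<^sup>2 + 2 * (norm (M t))\<^sup>2" .
    qed
    also have "\<dots> = 2 * integral {0..1} (\<lambda>t. (norm (F n t))\<^sup>2) + 2 * integral {0..1} (\<lambda>t. (norm (M t))\<^sup>2)"
      using Henstock_Kurzweil_Integration.integral_add[OF integrable_cmul[OF i(2), of 2] integrable_cmul[OF i(3), of 2]] by simp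
    finally show ?thesis using F(2)[of n] by (simp add: KD_def)
  qed
  have "(\<lambda>n. integral {0..1} (\<lambda>t. D n t $ i $ j * \<phi> t $ i $ j)) \<longlonglongrightarrow> 0" for i j
  proof (rule weak_convergence_scalar[OF _ _ _ \<epsilon>])
    show s: "sqint (\<lambda>t. D n t $ i $ j)" for n by (rule sqint_linear[OF Ds bl])
    show "sqint (\<lambda>t. \<phi> t $ i $ j)" by (rule sqint_linear[OF \<phi> bl])
    show "integral {0..1} (\<lambda>t. (D n t $ i $ j)\<^sup>2) \<le> KD" for n
    proof -
      have "integral {0..1} (\<lambda>t. (D n t $ i $ j)\<^sup>2) \<le> integral {0..1} (\<lambda>t. (norm (D n t))\<^sup>2)"
        using s[of n] Ds[of n] by (intro integral_le entry2) (auto simp: sqint_def absolutely_integrable_on_def)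
      then show ?thesis using KD[of n] by linarith
    qed
    show "\<bar>integral {0..t} (\<lambda>t. D n t $ i $ j)\<bar> \<le> \<epsilon> n" if "t \<in> {0..1}" for n t
    proof -
      have "norm (integral {0..t} (\<lambda>t. D n t $ i $ j)) \<le> 1 * \<epsilon> n"
        by (rule integral_linear_bound[OF sqint_ai[OF Ds] bl _ _ that]) (use entry p[OF that] in \<open>auto simp: D_def\<close>)
      then show ?thesis by simp
    qed
  qed
  then have "(\<lambda>n. \<Sum>i\<in>UNIV. \<Sum>j\<in>UNIV. integral {0..1} (\<lambda>t. D n t $ i $ j * \<phi> t $ i $ j)) \<longlonglongrightarrow> (\<Sum>(i::2)\<in>UNIV. \<Sum>(j::2)\<in>UNIV. 0)"
    by (intro tendsto_sum)
  moreover have "(\<Sum>i\<in>UNIV. \<Sum>j\<in>UNIV. integral {0..1} (\<lambda>t. D n t $ i $ j * \<phi> t $ i $ j))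
      = integral {0..1} (\<lambda>t. F n t \<bullet> \<phi> t) - integral {0..1} (\<lambda>t. M t \<bullet> \<phi> t)" for n
  proof -
    have i: "(\<lambda>t. D n t $ i $ j * \<phi> t $ i $ j) integrable_on {0..1}" for i j
    proof -
      have "sqint (\<lambda>t. D n t $ i $ j)" "sqint (\<lambda>t. \<phi> t $ i $ j)"
        by (rule sqint_linear[OF Ds bl] sqint_linear[OF \<phi> bl])+
      from sqint_integrable_products[OF this] show ?thesis by (simp add: absolutely_integrable_on_def)
    qed
    have "(\<Sum>i\<in>UNIV. \<Sum>j\<in>UNIV. integral {0..1} (\<lambda>t. D n t $ i $ j * \<phi> t $ i $ j))
       = integral {0..1} (\<lambda>t. \<Sum>i\<in>UNIV. \<Sum>j\<in>UNIV. D n t $ i $ j * \<phi> t $ i $ j)"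
      by (simp add: Henstock_Kurzweil_Integration.integral_sum i integrable_sum)
    also have "(\<lambda>t. \<Sum>i\<in>UNIV. \<Sum>j\<in>UNIV. D n t $ i $ j * \<phi> t $ i $ j) = (\<lambda>t. F n t \<bullet> \<phi> t - M t \<bullet> \<phi> t)"
      by (simp add: D_def inner_vec_def sum_subtractf left_diff_distrib)
    also have "integral {0..1} \<dots> = integral {0..1} (\<lambda>t. F n t \<bullet> \<phi> t) - integral {0..1} (\<lambda>t. M t \<bullet> \<phi> t)"
      using sqint_integrable_products[OF F(1)[of n] \<phi>] sqint_integrable_products[OF M \<phi>]
      by (intro Henstock_Kurzweil_Integration.integral_diff) (auto simp: absolutely_integrable_on_def)
    finally show ?thesis .
  qed
  ultimately show ?thesis by (simp add: LIM_zero_iff)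
qed

lemma primitive_sum:
  fixes f F :: "'i \<Rightarrow> real \<Rightarrow> real"
  assumes "finite I" "\<And>i. i \<in> I \<Longrightarrow> primitive (f i) (F i)"
  shows "primitive (\<lambda>t. \<Sum>i\<in>I. c i * f i t) (\<lambda>t. \<Sum>i\<in>I. c i * F i t)"
  using assms
proof (induction I rule: finite_induct)
  case (insert i I)
  have "primitive (\<lambda>t. c i * f i t) (\<lambda>t. c i * F i t)"
    by (rule primitive_linear[OF insert.prems[of i] bounded_linear_mult_right]) simp
  moreover have "primitive (\<lambda>t. \<Sum>i\<in>I. c i * f i t) (\<lambda>t. \<Sum>i\<in>I. c i * F i t)"
    using insert by simp
  ultimately show ?case
    using insert.hyps primitive_add[of "\<lambda>t. c i * f i t" "\<lambda>t. c i * F i t"] by simp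
qed (simp add: primitive_const)

section \<open>Frames of perturbed matrix fields\<close>

definition fr :: "(real \<Rightarrow> real^2^2) \<Rightarrow> real \<Rightarrow> real^3^3" where
  "fr N = frame (\<lambda>t. A_of (N t))"

lemma fr_solves: "sqint N \<Longrightarrow> solves (\<lambda>t. A_of (N t)) (fr N)"
  unfolding fr_def by (intro frame_solves sqint_linear[OF _ bounded_linear_A_of] transpose_A_of)

lemma fr_continuous: "sqint N \<Longrightarrow> continuous_on {0..1} (fr N)"
  by (rule solves_continuous[OF fr_solves])

lemma fr_rotation: "sqint N \<Longrightarrow> t \<in> {0..1} \<Longrightarrow> rotation_matrix (fr N t)"
  by (rule sol_rotation[OF fr_solves transpose_A_of])

lemma Gam_eq: "sqint N \<Longrightarrow> Gam (\<lambda>t. A_of (N t)) = integral {0..1} (\<lambda>t. transpose (fr N t) *v axis 1 1)"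
  unfolding Gam_def fr_def[symmetric]
  by (rule LINT_01[OF absolutely_integrable_continuous_real[OF continuous_on_transpose_e1[OF fr_continuous]]]) auto

lemma integral_norm_bound_by:
  fixes f :: "real \<Rightarrow> 'a::euclidean_space" and g :: "real \<Rightarrow> 'b::euclidean_space"
  assumes "sqint f" "sqint g" "\<And>t. t \<in> {0..1} \<Longrightarrow> norm (f t) \<le> c * norm (g t)"
  shows "integral {0..1} (\<lambda>t. norm (f t)) \<le> c * integral {0..1} (\<lambda>t. norm (g t))"
proof -
  have i: "(\<lambda>t. norm (f t)) integrable_on {0..1}" "(\<lambda>t. norm (g t)) integrable_on {0..1}"
    using sqint_norm_ai[OF assms(1)] sqint_norm_ai[OF assms(2)] by (auto simp: absolutely_integrable_on_def)
  have "integral {0..1} (\<lambda>t. norm (f t)) \<le> integral {0..1} (\<lambda>t. c * norm (g t))"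
    using integrable_cmul[OF i(2), of c] by (intro integral_le i assms) auto
  then show ?thesis by simp
qed

lemma integral_norm_square_bound_by:
  fixes f :: "real \<Rightarrow> 'a::euclidean_space" and g :: "real \<Rightarrow> 'b::euclidean_space"
  assumes "sqint f" "sqint g" "\<And>t. t \<in> {0..1} \<Longrightarrow> norm (f t) \<le> c * norm (g t)"
  shows "integral {0..1} (\<lambda>t. (norm (f t))\<^sup>2) \<le> c\<^sup>2 * integral {0..1} (\<lambda>t. (norm (g t))\<^sup>2)"
proof -
  have i: "(\<lambda>t. (norm (f t))\<^sup>2) integrable_on {0..1}" "(\<lambda>t. (norm (g t))\<^sup>2) integrable_on {0..1}"
    using assms by (auto simp: absolutely_integrable_on_def sqint_def)
  have "integral {0..1} (\<lambda>t. (norm (f t))\<^sup>2) \<le> integral {0..1} (\<lambda>t. c\<^sup>2 * (norm (g t))\<^sup>2)"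
  proof (rule integral_le[OF i(1)])
    show "(\<lambda>t. c\<^sup>2 * (norm (g t))\<^sup>2) integrable_on {0..1}" using integrable_cmul[OF i(2), of "c\<^sup>2"] by simp
    show "(norm (f t))\<^sup>2 \<le> c\<^sup>2 * (norm (g t))\<^sup>2" if "t \<in> {0..1}" for t
      using power_mono[OF assms(3)[OF that], of 2] by (simp add: power_mult_distrib)
  qed
  then show ?thesis by simp
qed

text \<open>Passing from \<open>N\<close> to \<open>A_of\<close> at most doubles norms, so the
  squared bound becomes 4 K and the primitive bound 2 \<delta> in
  \<open>sol_stability\<close>.\<close>

lemma fr_close:
  assumes N: "sqint N" "integral {0..1} (\<lambda>t. (norm (N t))\<^sup>2) \<le> K"
    and N': "sqint N'" "integral {0..1} (\<lambda>t. (norm (N' t))\<^sup>2) \<le> K" and K: "K > 0"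
    and d: "\<And>t. t \<in> {0..1} \<Longrightarrow> norm (integral {0..t} (\<lambda>t. N t - N' t)) \<le> \<delta>"
    and t: "t \<in> {0..1}"
  shows "norm (fr N t - fr N' t) \<le> 2 * ((4 + 2 * (4 * K)) * (2 * \<delta>)) * exp (2 * (4 * K))"
proof (rule sol_stability[OF _ _ _ _ _ fr_solves[OF N(1)] fr_solves[OF N'(1)] _ _ t])
  have A: "integral {0..1} (\<lambda>t. (norm (A_of (X t)))\<^sup>2) \<le> 4 * K" if "sqint X" "integral {0..1} (\<lambda>t. (norm (X t))\<^sup>2) \<le> K" for X
    using integral_norm_square_bound_by[OF sqint_linear[OF that(1) bounded_linear_A_of] that(1) norm_A_of] that(2) by simp
  show "integral {0..1} (\<lambda>t. (norm (A_of (N t)))\<^sup>2) \<le> 4 * K" "integral {0..1} (\<lambda>t. (norm (A_of (N' t)))\<^sup>2) \<le> 4 * K"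
    by (intro A N N')+
  show "norm (fr N' t) \<le> 2" if "t \<in> {0..1}" for t by (intro norm_rotation fr_rotation N' that)
  show "norm (integral {0..t} (\<lambda>s. A_of (N s) - A_of (N' s))) \<le> 2 * \<delta>" if "t \<in> {0..1}" for t
    using integral_linear_bound[OF sqint_ai[OF sqint_diff[OF N(1) N'(1)]] bounded_linear_A_of norm_A_of d[OF that] that]
    by (simp add: linear_diff[OF bounded_linear.linear[OF bounded_linear_A_of]])
qed (use K N N' sqint_linear[OF _ bounded_linear_A_of] in auto)

text \<open>The comparison is with the parameters (0, 0), for which \<open>pert\<close> is the
  identity; 9 is 1 + 8 \<eta> rounded up, and 81 its square.\<close>

lemma pert_integrals:
  assumes N: "sqint N" and c: "continuous_on {0..1} \<phi>" "continuous_on {0..1} \<psi>"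
    and b: "\<And>t. t \<in> {0..1} \<Longrightarrow> \<bar>\<phi> t\<bar> + \<bar>\<psi> t\<bar> \<le> \<eta>" and \<eta>: "\<eta> \<le> 1"
  shows "integral {0..1} (\<lambda>t. norm (pert (\<phi> t) (\<psi> t) (N t) - N t)) \<le> 8 * \<eta> * integral {0..1} (\<lambda>t. norm (N t))"
    and "\<And>t. t \<in> {0..1} \<Longrightarrow> norm (pert (\<phi> t) (\<psi> t) (N t) - N t) \<le> 8 * \<eta> * norm (N t)"
    and "\<And>t. t \<in> {0..1} \<Longrightarrow> norm (pert (\<phi> t) (\<psi> t) (N t)) \<le> 9 * norm (N t)"
    and "integral {0..1} (\<lambda>t. (norm (pert (\<phi> t) (\<psi> t) (N t)))\<^sup>2) \<le> 81 * integral {0..1} (\<lambda>t. (norm (N t))\<^sup>2)"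
proof -
  have b1: "\<bar>\<phi> t\<bar> \<le> 1" "\<bar>\<psi> t\<bar> \<le> 1" if "t \<in> {0..1}" for t using b[OF that] \<eta> by linarith+
  show d: "norm (pert (\<phi> t) (\<psi> t) (N t) - N t) \<le> 8 * \<eta> * norm (N t)" if t: "t \<in> {0..1}" for t
  proof -
    have "norm (pert (\<phi> t) (\<psi> t) (N t) - pert 0 0 (N t)) \<le> 8 * (\<bar>\<phi> t - 0\<bar> + \<bar>\<psi> t - 0\<bar>) * norm (N t)"
      by (rule norm_pert_diff) (use b1[OF t] in auto)
    also have "\<dots> \<le> 8 * \<eta> * norm (N t)" using b[OF t] by (intro mult_right_mono) auto
    finally show ?thesis by simp
  qed
  note s = sqint_pert[OF N c]
  show "integral {0..1} (\<lambda>t. norm (pert (\<phi> t) (\<psi> t) (N t) - N t)) \<le> 8 * \<eta> * integral {0..1} (\<lambda>t. norm (N t))"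
    by (rule integral_norm_bound_by[OF sqint_diff[OF s N] N d])
  show n: "norm (pert (\<phi> t) (\<psi> t) (N t)) \<le> 9 * norm (N t)" if t: "t \<in> {0..1}" for t
  proof -
    have "8 * \<eta> * norm (N t) \<le> 8 * norm (N t)" using \<eta> by (intro mult_right_mono) auto
    then show ?thesis
      using d[OF t] norm_triangle_ineq[of "pert (\<phi> t) (\<psi> t) (N t) - N t" "N t"] by simp
  qed
  show "integral {0..1} (\<lambda>t. (norm (pert (\<phi> t) (\<psi> t) (N t)))\<^sup>2) \<le> 81 * integral {0..1} (\<lambda>t. (norm (N t))\<^sup>2)"
    using integral_norm_square_bound_by[OF s N n] by simp
qed

text \<open>A perturbed dyad is again a dyad, so both energy densities are squared norms. Their
  difference factors into one factor at most 8 \<eta> and one at most 10 times the norm.\<close>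

lemma nuc_pert_dyad_integral:
  fixes m s :: "real \<Rightarrow> real"
  defines "N \<equiv> \<lambda>t. dyad (m t) (s t)"
  assumes D: "sqint N" and c: "continuous_on {0..1} \<phi>" "continuous_on {0..1} \<psi>"
    and b: "\<And>t. t \<in> {0..1} \<Longrightarrow> \<bar>\<phi> t\<bar> + \<bar>\<psi> t\<bar> \<le> \<eta>" and \<eta>: "\<eta> \<le> 1"
  shows "\<bar>integral {0..1} (\<lambda>t. nuc (pert (\<phi> t) (\<psi> t) (N t))) - integral {0..1} (\<lambda>t. nuc (N t))\<bar>
    \<le> 80 * \<eta> * integral {0..1} (\<lambda>t. nuc (N t))"
proof -
  note s = sqint_pert[OF D c]
  have i: "(\<lambda>t. nuc (pert (\<phi> t) (\<psi> t) (N t)) - nuc (N t)) absolutely_integrable_on {0..1}"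
    by (rule set_integral_diff(1)[OF nuc_ai[OF s] nuc_ai[OF D]])
  have i2: "(\<lambda>t. nuc (N t)) integrable_on {0..1}" "(\<lambda>t. nuc (pert (\<phi> t) (\<psi> t) (N t))) integrable_on {0..1}"
    using nuc_ai[OF D] nuc_ai[OF s] by (auto simp: absolutely_integrable_on_def)
  have "norm (integral {0..1} (\<lambda>t. nuc (pert (\<phi> t) (\<psi> t) (N t)) - nuc (N t))) \<le> integral {0..1} (\<lambda>t. 80 * \<eta> * nuc (N t))"
  proof (rule norm_integral_le[OF i])
    show "(\<lambda>t. 80 * \<eta> * nuc (N t)) integrable_on {0..1}" using integrable_cmul[OF i2(1), of "80 * \<eta>"] by simp
    fix t :: real assume t: "t \<in> {0..1}"
    let ?P = "pert (\<phi> t) (\<psi> t) (N t)"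
    have "norm (nuc ?P - nuc (N t)) = \<bar>(norm ?P)\<^sup>2 - (norm (N t))\<^sup>2\<bar>" by (simp add: pert_dyad nuc_dyad N_def)
    also have "\<dots> = \<bar>norm ?P - norm (N t)\<bar> * (norm ?P + norm (N t))"
      by (simp add: power2_eq_square square_diff_square_factored abs_mult)
    also have "\<dots> \<le> (8 * \<eta> * norm (N t)) * (10 * norm (N t))"
    proof (rule mult_mono)
      show "\<bar>norm ?P - norm (N t)\<bar> \<le> 8 * \<eta> * norm (N t)"
        using norm_triangle_ineq3[of ?P "N t"] pert_integrals(2)[OF D c b \<eta> t] by linarith
      show "norm ?P + norm (N t) \<le> 10 * norm (N t)" using pert_integrals(3)[OF D c b \<eta> t] by linarith
      show "0 \<le> 8 * \<eta> * norm (N t)" using b[OF t] by (intro mult_nonneg_nonneg) auto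
    qed auto
    also have "\<dots> = 80 * \<eta> * nuc (N t)" by (simp add: nuc_dyad N_def power2_eq_square)
    finally show "norm (nuc ?P - nuc (N t)) \<le> 80 * \<eta> * nuc (N t)" .
  qed
  then show ?thesis
    by (simp add: Henstock_Kurzweil_Integration.integral_diff[OF i2(2,1)])
qed

lemma smooth0_lincomb:
  fixes f :: "'i \<Rightarrow> real \<Rightarrow> real"
  assumes "\<And>i. i \<in> I \<Longrightarrow> smooth0 (f i)" shows "smooth0 (\<lambda>t. \<Sum>i\<in>I. c i * f i t)"
  using assms by (intro smooth0_sum smooth0_cmult)

lemma bound_on_unit_interval:
  fixes f :: "real \<Rightarrow> real"
  assumes "continuous_on {0..1} f" shows "\<exists>a. \<forall>t\<in>{0..1}. \<bar>f t\<bar> \<le> a"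
  using compact_imp_bounded[OF compact_continuous_image[OF assms compact_Icc]] by (auto simp: bounded_iff)

text \<open>With \<open>Y\<close> the sum of finitely many demands \<open>X\<close>, the single
  choice 1 / (1 + Y) satisfies all the conditions \<open>X * \<rho> \<le> 1\<close> at once.\<close>

lemma small_parameter:
  fixes X :: real assumes "X \<ge> 0" "\<rho> > 0" "\<rho> * (1 + Y) \<le> 1" "X \<le> Y" shows "X * \<rho> \<le> 1"
proof -
  have "X * \<rho> \<le> (1 + Y) * \<rho>" using assms by (intro mult_right_mono) auto
  then show ?thesis using assms(3) by (simp add: mult.commute)
qed

text \<open>For dyadic fields near \<open>M\<close> the endpoint map is uniformly close to that of \<open>M\<close>, whose derivative
  in the parameter \<open>x\<close> is the identity at \<open>0\<close>. Brouwer's theorem for \<open>x \<mapsto> x - H x\<close> gives an exact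
  solution.\<close>
lemma admissible_dyad_approximation:
  assumes M: "sqint M" and sym: "negligible {t\<in>{0..1}. M t \<notin> Sym2}"
    and S: "\<not> negligible {t\<in>{0..1}. M t $ 1 $ 1 \<noteq> 0}" and e: "e > 0"
  obtains m s where "smooth_cl m" "smooth0 s"
    "fr (\<lambda>t. dyad (m t) (s t)) 1 = fr M 1" "Gam (\<lambda>t. A_of (dyad (m t) (s t))) = Gam (\<lambda>t. A_of (M t))"
    "\<And>t. t \<in> {0..1} \<Longrightarrow> norm (integral {0..t} (\<lambda>t. dyad (m t) (s t) - M t)) \<le> e"
    "\<bar>integral {0..1} (\<lambda>t. nuc (dyad (m t) (s t))) - integral {0..1} (\<lambda>t. nuc (M t))\<bar> \<le> e"
proof -
  define r where "r = fr M"
  have rs: "solves (\<lambda>t. A_of (M t)) r" unfolding r_def by (rule fr_solves[OF M])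
  have rc: "continuous_on {0..1} r" unfolding r_def by (rule fr_continuous[OF M])
  have rot: "rotation_matrix (r t)" if "t \<in> {0..1}" for t unfolding r_def by (rule fr_rotation[OF M that])
  have rot1: "rotation_matrix (r 1)" by (rule rot) simp
  have r1: "norm (r 1) \<le> 2" by (rule norm_rotation[OF rot1])
  obtain c where c: "c > 0" "\<And>R Y \<sigma>. \<lbrakk>norm R \<le> 2; continuous_on {0..1} Y; \<And>t. t \<in> {0..1} \<Longrightarrow> norm (Y t) \<le> \<sigma>\<rbrakk>
    \<Longrightarrow> norm (endpoint R Y) \<le> c * \<sigma>" using endpoint_bound by blast

  have "\<forall>w. \<exists>\<phi> \<psi> \<omega>. variation r M \<phi> \<psi> \<omega> \<and> endpoint_variation r \<omega> = w"
    using endpoint_variation_surj[OF M rs S] by blast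
  then obtain \<phi> \<psi> \<omega> where var: "\<And>w. variation r M (\<phi> w) (\<psi> w) (\<omega> w)" "\<And>w. endpoint_variation r (\<omega> w) = w"
    by metis
  have sm: "smooth0 (\<phi> w)" "smooth0 (\<psi> w)" for w using var(1)[of w] by (auto simp: variation_def)
  have "\<exists>f'. continuous_on {0..1} f' \<and> primitive f' f" if "smooth0 f" for f
    using smooth_cl_primitive[of f] that by (auto simp: smooth0_def)
  then have "\<forall>w. \<exists>f'. continuous_on {0..1} f' \<and> primitive f' (\<phi> w)" "\<forall>w. \<exists>f'. continuous_on {0..1} f' \<and> primitive f' (\<psi> w)"
    using sm by auto
  then obtain \<phi>' \<psi>' where \<phi>': "\<And>w. continuous_on {0..1} (\<phi>' w)" "\<And>w. primitive (\<phi>' w) (\<phi> w)"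
    and \<psi>': "\<And>w. continuous_on {0..1} (\<psi>' w)" "\<And>w. primitive (\<psi>' w) (\<psi> w)" by metis
  have "\<exists>l. \<forall>t\<in>{0..1}. \<bar>\<phi> w t\<bar> \<le> l \<and> \<bar>\<phi>' w t\<bar> \<le> l \<and> \<bar>\<psi> w t\<bar> \<le> l \<and> \<bar>\<psi>' w t\<bar> \<le> l" for w
  proof -
    obtain a1 a2 a3 a4 where "\<forall>t\<in>{0..1}. \<bar>\<phi> w t\<bar> \<le> a1" "\<forall>t\<in>{0..1}. \<bar>\<phi>' w t\<bar> \<le> a2"
      "\<forall>t\<in>{0..1}. \<bar>\<psi> w t\<bar> \<le> a3" "\<forall>t\<in>{0..1}. \<bar>\<psi>' w t\<bar> \<le> a4"
      using bound_on_unit_interval[OF primitive_continuous[OF \<phi>'(2)]] bound_on_unit_interval[OF \<phi>'(1)]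
        bound_on_unit_interval[OF primitive_continuous[OF \<psi>'(2)]] bound_on_unit_interval[OF \<psi>'(1)] by metis
    then have "\<forall>t\<in>{0..1}. \<bar>\<phi> w t\<bar> \<le> max (max a1 a2) (max a3 a4) \<and> \<bar>\<phi>' w t\<bar> \<le> max (max a1 a2) (max a3 a4)
        \<and> \<bar>\<psi> w t\<bar> \<le> max (max a1 a2) (max a3 a4) \<and> \<bar>\<psi>' w t\<bar> \<le> max (max a1 a2) (max a3 a4)"
      by (auto simp: le_max_iff_disj)
    then show ?thesis by blast
  qed
  then obtain l where l: "\<And>w t. t \<in> {0..1} \<Longrightarrow> \<bar>\<phi> w t\<bar> \<le> l w" "\<And>w t. t \<in> {0..1} \<Longrightarrow> \<bar>\<phi>' w t\<bar> \<le> l w"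
    "\<And>w t. t \<in> {0..1} \<Longrightarrow> \<bar>\<psi> w t\<bar> \<le> l w" "\<And>w t. t \<in> {0..1} \<Longrightarrow> \<bar>\<psi>' w t\<bar> \<le> l w" by metis
  define L where "L = (\<Sum>w\<in>Basis. l w)"
  \<comment> \<open>Only the six basis directions of the target space are used and extended
    linearly. This makes all bounds proportional to \<open>norm x\<close> and the derivative in
    \<open>x\<close> the identity.\<close>
  define comb :: "((real^3) \<times> (real^3) \<Rightarrow> real \<Rightarrow> real) \<Rightarrow> (real^3) \<times> (real^3) \<Rightarrow> real \<Rightarrow> real"
    where "comb = (\<lambda>f x t. \<Sum>w\<in>Basis. (x \<bullet> w) * f w t)"
  have l0: "l w \<ge> 0" for w using l(1)[of 0 w] by simp
  have L0: "L \<ge> 0" unfolding L_def by (intro sum_nonneg l0)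
  have combL: "\<bar>comb f x t\<bar> \<le> L * norm x" if "\<And>w. \<bar>f w t\<bar> \<le> l w" for f x t
  proof -
    have "\<bar>comb f x t\<bar> \<le> (\<Sum>w\<in>Basis. norm x * l w)"
      unfolding comb_def
    proof (rule order_trans[OF sum_abs], rule sum_mono)
      fix w :: "(real^3) \<times> (real^3)" assume "w \<in> Basis"
      then show "\<bar>(x \<bullet> w) * f w t\<bar> \<le> norm x * l w"
        unfolding abs_mult by (intro mult_mono Basis_le_norm that) auto
    qed
    then show ?thesis by (simp add: L_def sum_distrib_left[symmetric] mult.commute)
  qed
  have comb_diff: "comb f x t - comb f y t = comb f (x - y) t" for f x y t
    by (simp add: comb_def inner_diff_left left_diff_distrib sum_subtractf)
  have comb_prim: "primitive (comb \<phi>' x) (comb \<phi> x)" "primitive (comb \<psi>' x) (comb \<psi> x)" for x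
    unfolding comb_def by (intro primitive_sum \<phi>' \<psi>'; simp)+
  have comb_cont: "continuous_on {0..1} (comb \<phi>' x)" "continuous_on {0..1} (comb \<psi>' x)" for x
    unfolding comb_def by (intro continuous_intros \<phi>' \<psi>')+
  note comb_c = primitive_continuous[OF comb_prim(1)] primitive_continuous[OF comb_prim(2)]
  have comb_smooth: "smooth0 (comb \<phi> x)" "smooth0 (comb \<psi> x)" for x
    unfolding comb_def by (intro smooth0_lincomb sm)+
  define \<kappa> where "\<kappa> = 2 * L"
  have \<kappa>0: "\<kappa> \<ge> 0" using L0 by (simp add: \<kappa>_def)
  have comb_b: "\<bar>comb \<phi> x t\<bar> + \<bar>comb \<psi> x t\<bar> \<le> \<kappa> * norm x" if "t \<in> {0..1}" for x t
    using combL[of \<phi> t x] combL[of \<psi> t x] l[OF that] by (simp add: \<kappa>_def)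
  define W where "W = (\<lambda>x t. \<Sum>w\<in>Basis. (x \<bullet> w) *\<^sub>R \<omega> w t)"
  have W: "variation r M (comb \<phi> x) (comb \<psi> x) (W x)" "endpoint_variation r (W x) = x" for x
    using variation_sum[OF rc finite_Basis, of M \<phi> \<psi> \<omega> "\<lambda>w. x \<bullet> w"] var
    by (simp_all add: comb_def W_def euclidean_representation)
  define pt where "pt = (\<lambda>N x t. pert (comb \<phi> x t) (comb \<psi> x t) (N t))"
  have pts: "sqint (pt N x)" if "sqint N" for N x
    unfolding pt_def by (intro sqint_pert that comb_c)

  \<comment> \<open>A common bound for the squared L2 norms of \<open>M\<close> and of the
    approximating dyads, whose energies differ from that of \<open>M\<close> by at most 1;
    \<open>K\<close> is the corresponding bound after a perturbation.\<close>
  define K0 where "K0 = integral {0..1} (\<lambda>t. nuc (M t)) + 1"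
  have "0 \<le> integral {0..1} (\<lambda>t. nuc (M t))"
    using nuc_ai[OF M] by (intro integral_nonneg) (auto simp: nuc_nonneg absolutely_integrable_on_def)
  then have K0: "K0 \<ge> 1" by (simp add: K0_def)
  define K where "K = 81 * K0"
  have K: "K > 0" "K0 \<le> K" using K0 by (auto simp: K_def)
  define J where "J = 1 + K0"
  have J: "J > 0" using K0 by (simp add: J_def)
  have MK: "integral {0..1} (\<lambda>t. (norm (M t))\<^sup>2) \<le> K0"
  proof -
    have "integral {0..1} (\<lambda>t. (norm (M t))\<^sup>2) \<le> integral {0..1} (\<lambda>t. nuc (M t))"
      using M nuc_ai[OF M] by (intro integral_le) (auto simp: sqint_def absolutely_integrable_on_def nuc_def)
    then show ?thesis by (simp add: K0_def)
  qed
  have NJ: "integral {0..1} (\<lambda>t. norm (N t)) \<le> J" if "sqint N" "integral {0..1} (\<lambda>t. (norm (N t))\<^sup>2) \<le> K0" for N :: "real \<Rightarrow> real^2^2"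
    using integral_norm_le[OF that] by (simp add: J_def)
  define D1 where "D1 = 2 * ((4 + 2 * (4 * K)) * 2) * exp (2 * (4 * K))"
  have D1: "D1 > 0" using K by (simp add: D1_def)
  have close: "norm (fr N t - fr N' t) \<le> D1 * \<delta>"
    if "sqint N" "integral {0..1} (\<lambda>t. (norm (N t))\<^sup>2) \<le> K" "sqint N'" "integral {0..1} (\<lambda>t. (norm (N' t))\<^sup>2) \<le> K"
      "\<And>t. t \<in> {0..1} \<Longrightarrow> norm (integral {0..t} (\<lambda>t. N t - N' t)) \<le> \<delta>" "t \<in> {0..1}" for N N' t \<delta>
    using fr_close[OF that(1-4) K(1) that(5,6)] by (simp add: D1_def mult_ac)
  have ptK: "integral {0..1} (\<lambda>t. (norm (pt N x t))\<^sup>2) \<le> K" if "sqint N" "integral {0..1} (\<lambda>t. (norm (N t))\<^sup>2) \<le> K0" "\<kappa> * norm x \<le> 1" for N x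
  proof -
    have "integral {0..1} (\<lambda>t. (norm (pt N x t))\<^sup>2) \<le> 81 * integral {0..1} (\<lambda>t. (norm (N t))\<^sup>2)"
      unfolding pt_def by (rule pert_integrals(4)[OF that(1) comb_c comb_b that(3)])
    then show ?thesis using that(2) by (simp add: K_def)
  qed
  \<comment> \<open>A zero of \<open>H N\<close> is a parameter for which the perturbed field has
    the endpoint data of \<open>M\<close>, the final rotation being compared through its axial
    coordinate.\<close>
  define H where "H = (\<lambda>N x. endpoint (r 1) (\<lambda>t. fr (pt N x) t - r t))"
  have H_diff: "norm (H N x - H N' y) \<le> c * \<sigma>"
    if "sqint N" "sqint N'" "\<And>t. t \<in> {0..1} \<Longrightarrow> norm (fr (pt N x) t - fr (pt N' y) t) \<le> \<sigma>" for N N' x y \<sigma>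
  proof -
    note c1 = fr_continuous[OF pts[OF that(1), of x]] and c2 = fr_continuous[OF pts[OF that(2), of y]]
    have "H N x - H N' y = endpoint (r 1) (\<lambda>t. (fr (pt N x) t - r t) - (fr (pt N' y) t - r t))"
      unfolding H_def by (rule endpoint_diff[symmetric]; intro continuous_intros c1 c2 rc)
    then have "H N x - H N' y = endpoint (r 1) (\<lambda>t. fr (pt N x) t - fr (pt N' y) t)" by simp
    also have "norm \<dots> \<le> c * \<sigma>" by (rule c(2)[OF r1 _ that(3)]) (intro continuous_intros c1 c2)
    finally show ?thesis .
  qed

  have lin: "norm (fr (pt M x) t - r t) \<le> D1 * (8 * (\<kappa> * norm x) * J)" if x: "\<kappa> * norm x \<le> 1" and t: "t \<in> {0..1}" for x t
    unfolding r_def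
  proof (rule close[OF pts[OF M] ptK[OF M MK x] M _ _ t])
    show "integral {0..1} (\<lambda>t. (norm (M t))\<^sup>2) \<le> K" using MK K by simp
    fix t :: real assume t: "t \<in> {0..1}"
    have "norm (integral {0..t} (\<lambda>t. pt M x t - M t)) \<le> integral {0..1} (\<lambda>t. norm (pt M x t - M t))"
      by (rule norm_primitive_le_integral_norm[OF sqint_diff[OF pts[OF M] M] t])
    also have "\<dots> \<le> 8 * (\<kappa> * norm x) * integral {0..1} (\<lambda>t. norm (M t))"
      unfolding pt_def by (rule pert_integrals(1)[OF M comb_c comb_b x])
    also have "\<dots> \<le> 8 * (\<kappa> * norm x) * J"
      using \<kappa>0 by (intro mult_left_mono NJ[OF M MK]) auto
    finally show "norm (integral {0..t} (\<lambda>t. pt M x t - M t)) \<le> 8 * (\<kappa> * norm x) * J" .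
  qed
  \<comment> \<open>From \<open>sol_linearization\<close>: the change of the field, 16 \<kappa> J
    |x|, times the change of the frame, 8 D1 \<kappa> J |x|, and the Taylor remainder 4 \<kappa>^2 J
    |x|^2 of the field. Both are quadratic in x.\<close>
  define C4 where "C4 = c * (2 * (2 * 8 * \<kappa> * J * (D1 * 8 * \<kappa> * J) + 2 * (4 * \<kappa>\<^sup>2 * J)) * exp (2 * (4 * K)))"
  have C40: "C4 \<ge> 0" using c(1) \<kappa>0 J D1 by (simp add: C4_def)
  have HM: "norm (H M x - x) \<le> C4 * (norm x)\<^sup>2" if x: "\<kappa> * norm x \<le> 1" for x
  proof -
    define P where "P = pt M x"
    have Ps: "sqint P" unfolding P_def by (rule pts[OF M])
    define V where "V = (\<lambda>t. varfield (comb \<phi> x t) (comb \<psi> x t) (M t))"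
    have Vs: "sqint V" unfolding V_def by (rule sqint_varfield[OF M comb_smooth])
    note Wc = variation_continuous[OF W(1)[of x]]
    have \<Omega>p: "primitive (\<lambda>t. transpose (r t) ** (A_of (V t) ** r t)) (\<lambda>t. crossmat (W x t))"
    proof (rule primitive_cong[OF primitive_linear[OF _ bounded_linear_crossmat]])
      show "primitive (\<lambda>t. transpose (r t) *v bvec (V t)) (W x)"
        using W(1)[of x] by (simp add: variation_def V_def)
      show "crossmat (transpose (r t) *v bvec (V t)) = transpose (r t) ** (A_of (V t) ** r t)" if "t \<in> {0..1}" for t
        by (rule rotation_conjugate_A_of[OF rot[OF that], symmetric])
    qed simp
    have W0: "crossmat (W x 0) = 0"
      using W(1)[of x] linear_0[OF bounded_linear.linear[OF bounded_linear_crossmat]] by (simp add: variation_def)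
    have A_diff: "A_of (X - Y) = A_of X - A_of Y" for X Y
      by (rule linear_diff[OF bounded_linear.linear[OF bounded_linear_A_of]])
    have b: "norm (fr P t - r t - r t ** crossmat (W x t)) \<le>
        2 * ((2 * 8 * (\<kappa> * norm x) * J) * (D1 * (8 * (\<kappa> * norm x) * J)) + 2 * (2 * (2 * (\<kappa> * norm x)\<^sup>2 * J))) * exp (2 * (4 * K))" if t: "t \<in> {0..1}" for t
    proof (rule sol_linearization[where A = "\<lambda>t. A_of (M t)" and A' = "\<lambda>t. A_of (P t)" and B = "\<lambda>t. A_of (V t)", OF _ _ _ _ _ rs fr_solves[OF Ps] rot \<Omega>p W0 _ _ _ t])
      show "integral {0..1} (\<lambda>t. (norm (A_of (M t)))\<^sup>2) \<le> 4 * K"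
        using integral_norm_square_bound_by[OF sqint_linear[OF M bounded_linear_A_of] M norm_A_of] MK K by simp
      show "norm (fr P t - r t) \<le> D1 * (8 * (\<kappa> * norm x) * J)" if "t \<in> {0..1}" for t
        unfolding P_def by (rule lin[OF x that])
      have "integral {0..1} (\<lambda>t. norm (A_of (P t - M t - V t))) \<le> 2 * integral {0..1} (\<lambda>t. norm (P t - M t - V t))"
        by (rule integral_norm_bound_by[OF sqint_linear[OF _ bounded_linear_A_of] _ norm_A_of]) (intro sqint_diff Ps M Vs)+
      also have "integral {0..1} (\<lambda>t. norm (P t - M t - V t)) \<le> 2 * (\<kappa> * norm x)\<^sup>2 * integral {0..1} (\<lambda>t. norm (M t))"
      proof (rule integral_norm_bound_by[OF sqint_diff[OF sqint_diff[OF Ps M] Vs] M])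
        fix t :: real assume t: "t \<in> {0..1}"
        have "norm (P t - M t - V t) \<le> 2 * (\<bar>comb \<phi> x t\<bar> + \<bar>comb \<psi> x t\<bar>)\<^sup>2 * norm (M t)"
          unfolding P_def pt_def V_def using comb_b[OF t, of x] x by (intro norm_pert_linear) linarith+
        also have "\<dots> \<le> 2 * (\<kappa> * norm x)\<^sup>2 * norm (M t)"
          using comb_b[OF t, of x] by (intro mult_right_mono mult_left_mono power_mono) auto
        finally show "norm (P t - M t - V t) \<le> 2 * (\<kappa> * norm x)\<^sup>2 * norm (M t)" .
      qed
      also have "2 * (\<kappa> * norm x)\<^sup>2 * integral {0..1} (\<lambda>t. norm (M t)) \<le> 2 * (\<kappa> * norm x)\<^sup>2 * J"
        by (intro mult_left_mono NJ[OF M MK]) auto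
      finally show "integral {0..1} (\<lambda>t. norm (A_of (P t) - A_of (M t) - A_of (V t))) \<le> 2 * (2 * (\<kappa> * norm x)\<^sup>2 * J)"
        by (simp add: A_diff)
      have "integral {0..1} (\<lambda>t. norm (A_of (P t - M t))) \<le> 2 * integral {0..1} (\<lambda>t. norm (P t - M t))"
        by (rule integral_norm_bound_by[OF sqint_linear[OF _ bounded_linear_A_of] _ norm_A_of]) (intro sqint_diff Ps M)+
      also have "integral {0..1} (\<lambda>t. norm (P t - M t)) \<le> 8 * (\<kappa> * norm x) * integral {0..1} (\<lambda>t. norm (M t))"
        unfolding P_def pt_def by (rule pert_integrals(1)[OF M comb_c comb_b x])
      also have "\<dots> \<le> 8 * (\<kappa> * norm x) * J"
        using \<kappa>0 by (intro mult_left_mono NJ[OF M MK]) auto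
      finally show "integral {0..1} (\<lambda>t. norm (A_of (P t) - A_of (M t))) \<le> 2 * 8 * (\<kappa> * norm x) * J"
        by (simp add: A_diff)
    qed (use K M Ps Vs sqint_linear[OF _ bounded_linear_A_of] in auto)
    have cO: "continuous_on {0..1} (\<lambda>t. r t ** crossmat (W x t))"
      by (intro bounded_bilinear.continuous_on[OF bounded_bilinear_matrix_mult] rc primitive_continuous[OF \<Omega>p])
    have "x = endpoint (r 1) (\<lambda>t. r t ** crossmat (W x t))"
      using endpoint_variation_eq[OF W(1) rc rot1] W(2) by simp
    then have "H M x - x = endpoint (r 1) (\<lambda>t. (fr P t - r t) - r t ** crossmat (W x t))"
      unfolding H_def P_def[symmetric] by (subst endpoint_diff) (auto intro!: continuous_intros fr_continuous Ps rc cO)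
    also have "norm \<dots> \<le> c * (2 * ((2 * 8 * (\<kappa> * norm x) * J) * (D1 * (8 * (\<kappa> * norm x) * J)) + 2 * (2 * (2 * (\<kappa> * norm x)\<^sup>2 * J))) * exp (2 * (4 * K)))"
      by (rule c(2)[OF r1 _ b]) (intro continuous_intros fr_continuous Ps rc cO)+
    also have "\<dots> = C4 * (norm x)\<^sup>2"
      by (simp add: C4_def power2_eq_square algebra_simps)
    finally show ?thesis .
  qed

  \<comment> \<open>The summands encode in this order: perturbation functions bounded by 1,
    quadratic remainder at most \<rho> / 2, deviation of the frame at most 1 / 4, and changes of the
    primitive and of the energy by at most e / 2 each.\<close>
  define Y where "Y = \<kappa> + 2 * C4 + 4 * (D1 * 8 * \<kappa> * J) + 2 / e * (8 * \<kappa> * J) + 2 / e * (80 * \<kappa> * K0)"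
  have Yp: "0 \<le> \<kappa>" "0 \<le> 2 * C4" "0 \<le> 4 * (D1 * 8 * \<kappa> * J)" "0 \<le> 2 / e * (8 * \<kappa> * J)" "0 \<le> 2 / e * (80 * \<kappa> * K0)"
    using \<kappa>0 C40 D1 J e K0 by simp_all
  define \<rho> where "\<rho> = 1 / (1 + Y)"
  have Y0: "Y \<ge> 0" using Yp by (simp add: Y_def)
  have \<rho>: "\<rho> > 0" "\<rho> * (1 + Y) \<le> 1" using Y0 by (auto simp: \<rho>_def)
  have \<rho>1: "\<kappa> * \<rho> \<le> 1" "2 * C4 * \<rho> \<le> 1" "4 * (D1 * 8 * \<kappa> * J) * \<rho> \<le> 1" "2 / e * (8 * \<kappa> * J) * \<rho> \<le> 1" "2 / e * (80 * \<kappa> * K0) * \<rho> \<le> 1"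
    using Yp by (intro small_parameter[OF _ \<rho>] ; simp add: Y_def)+
  \<comment> \<open>Chosen after \<open>\<rho>\<close>. The summands encode \<delta> at most e / 2,
    the comparison of \<open>H N\<close> with \<open>H M\<close> up to \<rho> / 2, and a deviation
    of the frames of at most 1 / 4.\<close>
  define Z where "Z = 2 / e + 80 * c * D1 / \<rho> + 160 * D1"
  define \<delta> where "\<delta> = 1 / (1 + Z)"
  have dp: "0 \<le> 2 / e" "0 \<le> 80 * c * D1 / \<rho>" "0 \<le> 160 * D1" using e c D1 \<rho> by auto
  have Z0: "Z \<ge> 0" using dp unfolding Z_def by linarith
  then have \<delta>: "\<delta> > 0" "\<delta> * (1 + Z) \<le> 1" by (auto simp: \<delta>_def)
  have \<delta>1: "2 / e * \<delta> \<le> 1" "80 * c * D1 / \<rho> * \<delta> \<le> 1" "160 * D1 * \<delta> \<le> 1"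
  proof -
    have "2 / e \<le> Z" "80 * c * D1 / \<rho> \<le> Z" "160 * D1 \<le> Z" unfolding Z_def using dp by linarith+
    then show "2 / e * \<delta> \<le> 1" "80 * c * D1 / \<rho> * \<delta> \<le> 1" "160 * D1 * \<delta> \<le> 1"
      using small_parameter[OF dp(1) \<delta>] small_parameter[OF dp(2) \<delta>] small_parameter[OF dp(3) \<delta>] by blast+
  qed
  have \<delta>le: "\<delta> \<le> 1" using Z0 by (simp add: \<delta>_def)

  obtain m s where ms: "smooth0 m" "smooth0 s"
    "\<And>t. t \<in> {0..1} \<Longrightarrow> norm (integral {0..t} (\<lambda>t. dyad (m t) (s t) - M t)) \<le> \<delta>"
    "\<bar>integral {0..1} (\<lambda>t. nuc (dyad (m t) (s t))) - integral {0..1} (\<lambda>t. nuc (M t))\<bar> \<le> \<delta>"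
    using dyad_approximation[OF M sym \<delta>(1)] by blast
  define N where "N = (\<lambda>t. dyad (m t) (s t))"
  have msc: "continuous_on {0..1} m" "continuous_on {0..1} s" using ms by (auto simp: smooth0_def intro: smooth_cl_continuous)
  have Ns: "sqint N" unfolding N_def dyad_def by (intro sqint_continuous continuous_intros msc)
  have NnK: "integral {0..1} (\<lambda>t. nuc (N t)) \<le> K0" using ms(4) \<delta>le unfolding N_def K0_def by linarith
  have NK: "integral {0..1} (\<lambda>t. (norm (N t))\<^sup>2) \<le> K0" using NnK by (simp add: N_def nuc_dyad)
  \<comment> \<open>Linearity of \<open>pert\<close> in the field turns the difference into a
    perturbation of N - M, whose primitive is small uniformly in the parameter.\<close>
  have uniform: "norm (fr (pt N x) t - fr (pt M x) t) \<le> D1 * (40 * \<delta>)" if x: "\<kappa> * norm x \<le> 1" and t: "t \<in> {0..1}" for x t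
  proof (rule close[OF pts[OF Ns] ptK[OF Ns NK x] pts[OF M] ptK[OF M MK x] _ t])
    fix t :: real assume t: "t \<in> {0..1}"
    have LN: "L * norm x \<le> 1" using x L0 norm_ge_zero[of x] by (simp add: \<kappa>_def)
    have B: "\<bar>comb f x t\<bar> \<le> 1" if "\<And>w. \<bar>f w t\<bar> \<le> l w" for f t using order_trans[OF combL[of f t x, OF that] LN] .
    have "norm (integral {0..t} (\<lambda>t. pert (comb \<phi> x t) (comb \<psi> x t) (N t - M t))) \<le> 40 * \<delta>"
      by (rule primitive_pert_bound[OF sqint_diff[OF Ns M] _ comb_prim(1) comb_cont(1) comb_prim(2) comb_cont(2) _ _ _ _ t])
         (use ms(3) in \<open>auto simp: N_def intro!: B l\<close>)
    then show "norm (integral {0..t} (\<lambda>t. pt N x t - pt M x t)) \<le> 40 * \<delta>" by (simp add: pt_def pert_diff)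
  qed
  have kx: "\<kappa> * norm x \<le> 1" "norm x \<le> \<rho>" if "x \<in> cball 0 \<rho>" for x :: "(real^3) \<times> (real^3)"
    using that mult_left_mono[of "norm x" \<rho> \<kappa>] \<kappa>0 \<rho>1(1) by (simp_all add: dist_norm)
  have Hcont: "continuous_on (cball 0 \<rho>) (H N)"
  proof (rule continuous_onI)
    fix e' :: real and x :: "(real^3) \<times> (real^3)" assume x: "x \<in> cball 0 \<rho>" and e': "e' > 0"
    define B where "B = c * (D1 * (8 * \<kappa> * J))"
    have B: "B \<ge> 0" using c D1 \<kappa>0 J by (simp add: B_def)
    show "\<exists>d>0. \<forall>y\<in>cball 0 \<rho>. dist y x < d \<longrightarrow> dist (H N y) (H N x) \<le> e'"
    proof (intro exI[of _ "e' / (B + 1)"] conjI ballI impI)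
      show "0 < e' / (B + 1)" using e' B by simp
      fix y assume y: "y \<in> cball 0 \<rho>" and yx: "dist y x < e' / (B + 1)"
      have "norm (H N y - H N x) \<le> c * (D1 * (8 * (\<kappa> * norm (y - x)) * J))"
      proof (rule H_diff[OF Ns Ns], rule close[OF pts[OF Ns] ptK[OF Ns NK kx(1)[OF y]] pts[OF Ns] ptK[OF Ns NK kx(1)[OF x]]])
        fix t :: real assume t: "t \<in> {0..1}"
        have "norm (integral {0..t} (\<lambda>t. pt N y t - pt N x t)) \<le> integral {0..1} (\<lambda>t. norm (pt N y t - pt N x t))"
          by (rule norm_primitive_le_integral_norm[OF sqint_diff[OF pts[OF Ns] pts[OF Ns]] t])
        also have "\<dots> \<le> 8 * (\<kappa> * norm (y - x)) * integral {0..1} (\<lambda>t. norm (N t))"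
        proof (rule integral_norm_bound_by[OF sqint_diff[OF pts[OF Ns] pts[OF Ns]] Ns])
          fix t :: real assume t: "t \<in> {0..1}"
          have "norm (pt N y t - pt N x t) \<le> 8 * (\<bar>comb \<phi> y t - comb \<phi> x t\<bar> + \<bar>comb \<psi> y t - comb \<psi> x t\<bar>) * norm (N t)"
            unfolding pt_def using comb_b[OF t, of x] comb_b[OF t, of y] kx(1)[OF x] kx(1)[OF y] by (intro norm_pert_diff) linarith+
          also have "\<dots> \<le> 8 * (\<kappa> * norm (y - x)) * norm (N t)"
            unfolding comb_diff using comb_b[OF t, of "y - x"] by (intro mult_right_mono) auto
          finally show "norm (pt N y t - pt N x t) \<le> 8 * (\<kappa> * norm (y - x)) * norm (N t)" .
        qed
        also have "\<dots> \<le> 8 * (\<kappa> * norm (y - x)) * J"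
          using \<kappa>0 by (intro mult_left_mono NJ[OF Ns NK]) auto
        finally show "norm (integral {0..t} (\<lambda>t. pt N y t - pt N x t)) \<le> 8 * (\<kappa> * norm (y - x)) * J" .
      qed
      also have "\<dots> = B * norm (y - x)" by (simp add: B_def mult_ac)
      also have "\<dots> \<le> (B + 1) * norm (y - x)" by (intro mult_right_mono) auto
      also have "\<dots> \<le> e'" using yx B by (simp add: dist_norm field_simps)
      finally show "dist (H N y) (H N x) \<le> e'" by (simp add: dist_norm)
    qed
  qed
  obtain x where x: "x \<in> cball 0 \<rho>" "x - H N x = x"
  proof (rule brouwer_ball[OF \<rho>(1)])
    show "continuous_on (cball 0 \<rho>) (\<lambda>x. x - H N x)" by (intro continuous_intros Hcont)
    \<comment> \<open>The distance from the identity to \<open>H M\<close> and that from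
      \<open>H M\<close> to \<open>H N\<close> are each at most \<rho> / 2, so the ball is mapped
      into itself; a fixed point is a zero of \<open>H N\<close>.\<close>
    show "(\<lambda>x. x - H N x) \<in> cball 0 \<rho> \<rightarrow> cball 0 \<rho>"
    proof
      fix x :: "(real^3) \<times> (real^3)" assume x: "x \<in> cball 0 \<rho>"
      have "norm (H N x - H M x) \<le> c * (D1 * (40 * \<delta>))"
        by (rule H_diff[OF Ns M uniform[OF kx(1)[OF x]]])
      moreover have "c * (D1 * (40 * \<delta>)) \<le> \<rho> / 2"
        using \<delta>1(2) \<rho>(1) by (simp add: field_simps)
      moreover have "norm (H M x - x) \<le> \<rho> / 2"
      proof -
        have "norm (H M x - x) \<le> C4 * (norm x)\<^sup>2" by (rule HM[OF kx(1)[OF x]])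
        also have "\<dots> \<le> C4 * \<rho>\<^sup>2" using C40 kx(2)[OF x] by (intro mult_left_mono power_mono) auto
        also have "\<dots> = (2 * C4 * \<rho>) * (\<rho> / 2)" by (simp add: power2_eq_square)
        also have "\<dots> \<le> 1 * (\<rho> / 2)" using \<rho>1(2) \<rho>(1) by (intro mult_right_mono) auto
        finally show ?thesis by simp
      qed
      moreover have "norm (x - H N x) \<le> norm (x - H M x) + norm (H M x - H N x)"
        using norm_triangle_ineq[of "x - H M x" "H M x - H N x"] by simp
      ultimately have "norm (x - H N x) \<le> \<rho>"
        unfolding norm_minus_commute[of x "H M x"] norm_minus_commute[of "H M x" "H N x"] by linarith
      then show "x - H N x \<in> cball 0 \<rho>" by (simp add: dist_norm norm_minus_commute)
    qed
  qed blast
  define P where "P = pt N x"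
  have Ps: "sqint P" unfolding P_def by (rule pts[OF Ns])
  note Pc = fr_continuous[OF Ps]
  have "endpoint (r 1) (\<lambda>t. fr P t - r t) = 0" using x(2) by (simp add: H_def P_def)
  then have eq: "endpoint (r 1) (fr P) = endpoint (r 1) r"
    using endpoint_diff[OF Pc rc, of "r 1"] by simp
  have "transpose (r 1) ** r 1 = mat 1" using rot1 by (simp add: rotation_matrix_def orthogonal_matrix_def)
  then have "axial (transpose (r 1) ** fr P 1) = axial (mat 1)" using eq by (simp add: endpoint_def)
  then have ax: "axial (transpose (r 1) ** fr P 1) = 0" by (simp add: axial_def mat_def vec_eq_iff forall_3)
  \<comment> \<open>Excludes that the two rotations differ by a half turn, which the axial vector
    does not detect.\<close>
  have near: "norm (fr P 1 - r 1) < 1"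
  proof -
    have "norm (fr P 1 - fr (pt M x) 1) \<le> D1 * (40 * \<delta>)" unfolding P_def by (rule uniform[OF kx(1)[OF x(1)]]) simp
    moreover have "D1 * (40 * \<delta>) \<le> 1 / 4" using \<delta>1(3) by simp
    moreover have "norm (fr (pt M x) 1 - r 1) \<le> D1 * (8 * (\<kappa> * norm x) * J)" by (rule lin[OF kx(1)[OF x(1)]]) simp
    moreover have "D1 * (8 * (\<kappa> * norm x) * J) \<le> 1 / 4"
    proof -
      have "D1 * (8 * (\<kappa> * norm x) * J) = (D1 * 8 * \<kappa> * J) * norm x" by (simp add: mult_ac)
      also have "\<dots> \<le> (D1 * 8 * \<kappa> * J) * \<rho>" using kx(2)[OF x(1)] Yp(3) by (intro mult_left_mono) auto
      also have "\<dots> \<le> 1 / 4" using \<rho>1(3) by simp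
      finally show ?thesis .
    qed
    ultimately show ?thesis
      using norm_triangle_ineq[of "fr P 1 - fr (pt M x) 1" "fr (pt M x) 1 - r 1"] by simp
  qed
  have fr1: "fr P 1 = r 1"
    by (rule rotation_eq_of_axial_zero[OF rot1 fr_rotation[OF Ps] ax near]) simp
  define m' where "m' = (\<lambda>t. (1 + comb \<phi> x t) * m t)"
  define s' where "s' = (\<lambda>t. s t + comb \<psi> x t)"
  have Peq: "P = (\<lambda>t. dyad (m' t) (s' t))" by (simp add: P_def pt_def N_def pert_dyad m'_def s'_def)
  have bx: "\<kappa> * norm x \<le> \<kappa> * \<rho>" using kx(2)[OF x(1)] \<kappa>0 by (intro mult_left_mono) auto
  show ?thesis
  proof (rule that[of m' s'])
    show "smooth_cl m'" unfolding m'_def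
      using ms(1) comb_smooth(1)[of x] by (intro smooth_cl_mult smooth_cl_add smooth_cl_const) (auto simp: smooth0_def)
    show "smooth0 s'" unfolding s'_def by (intro smooth0_add ms comb_smooth)
    show "fr (\<lambda>t. dyad (m' t) (s' t)) 1 = fr M 1" using fr1 by (simp add: Peq r_def)
    show "Gam (\<lambda>t. A_of (dyad (m' t) (s' t))) = Gam (\<lambda>t. A_of (M t))"
      using eq Gam_eq[OF Ps] Gam_eq[OF M] by (simp add: endpoint_def r_def Peq)
    show "norm (integral {0..t} (\<lambda>t. dyad (m' t) (s' t) - M t)) \<le> e" if t: "t \<in> {0..1}" for t
    proof -
      have i: "(\<lambda>t. P t - N t) integrable_on {0..t}" "(\<lambda>t. N t - M t) integrable_on {0..t}"
        using t by (auto intro!: ai_integrable_sub sqint_ai sqint_diff Ps Ns M)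
      have "integral {0..t} (\<lambda>t. P t - M t) = integral {0..t} (\<lambda>t. (P t - N t) + (N t - M t))" by simp
      also have "\<dots> = integral {0..t} (\<lambda>t. P t - N t) + integral {0..t} (\<lambda>t. N t - M t)"
        by (rule Henstock_Kurzweil_Integration.integral_add[OF i])
      finally have *: "integral {0..t} (\<lambda>t. P t - M t) = integral {0..t} (\<lambda>t. P t - N t) + integral {0..t} (\<lambda>t. N t - M t)" .
      have "norm (integral {0..t} (\<lambda>t. P t - N t)) \<le> integral {0..1} (\<lambda>t. norm (P t - N t))"
        by (rule norm_primitive_le_integral_norm[OF sqint_diff[OF Ps Ns] t])
      also have "\<dots> \<le> 8 * (\<kappa> * norm x) * integral {0..1} (\<lambda>t. norm (N t))"
        unfolding P_def pt_def by (rule pert_integrals(1)[OF Ns comb_c comb_b kx(1)[OF x(1)]])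
      also have "\<dots> \<le> 8 * (\<kappa> * norm x) * J"
        using \<kappa>0 by (intro mult_left_mono NJ[OF Ns NK]) auto
      also have "\<dots> \<le> 8 * (\<kappa> * \<rho>) * J"
        by (rule mult_right_mono[OF mult_left_mono[OF bx]]) (use J in auto)
      also have "\<dots> \<le> e / 2" using \<rho>1(4) e by (simp add: field_simps)
      finally have "norm (integral {0..t} (\<lambda>t. P t - N t)) \<le> e / 2" .
      moreover have "norm (integral {0..t} (\<lambda>t. N t - M t)) \<le> e / 2"
      proof -
        have "\<delta> \<le> e / 2" using \<delta>1(1) e by (simp add: field_simps)
        then show ?thesis using ms(3)[OF t] by (simp add: N_def)
      qed
      ultimately have "norm (integral {0..t} (\<lambda>t. P t - M t)) \<le> e"
        unfolding * using norm_triangle_ineq[of "integral {0..t} (\<lambda>t. P t - N t)" "integral {0..t} (\<lambda>t. N t - M t)"] by linarith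
      then show ?thesis by (simp add: Peq)
    qed
    have "\<bar>integral {0..1} (\<lambda>t. nuc (P t)) - integral {0..1} (\<lambda>t. nuc (N t))\<bar> \<le> 80 * (\<kappa> * norm x) * integral {0..1} (\<lambda>t. nuc (N t))"
      unfolding P_def pt_def N_def
      by (rule nuc_pert_dyad_integral[OF Ns[unfolded N_def] comb_c comb_b kx(1)[OF x(1)]])
    also have "\<dots> \<le> 80 * (\<kappa> * norm x) * K0"
      using \<kappa>0 by (intro mult_left_mono NnK) auto
    also have "\<dots> \<le> 80 * (\<kappa> * \<rho>) * K0"
      by (rule mult_right_mono[OF mult_left_mono[OF bx]]) (use K0 in auto)
    also have "\<dots> \<le> e / 2" using \<rho>1(5) e by (simp add: field_simps)
    finally have "\<bar>integral {0..1} (\<lambda>t. nuc (P t)) - integral {0..1} (\<lambda>t. nuc (N t))\<bar> \<le> e / 2" .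
    moreover have "\<delta> \<le> e / 2" using \<delta>1(1) e by (simp add: field_simps)
    ultimately have "\<bar>integral {0..1} (\<lambda>t. nuc (P t)) - integral {0..1} (\<lambda>t. nuc (M t))\<bar> \<le> e"
      using ms(4) unfolding N_def by linarith
    then show "\<bar>integral {0..1} (\<lambda>t. nuc (dyad (m' t) (s' t))) - integral {0..1} (\<lambda>t. nuc (M t))\<bar> \<le> e"
      by (simp add: Peq)
  qed
qed

text \<open>The squared length 1 + s^2 of (1, s) moves into the scalar factor. The normalised
  direction has a positive first component for every slope.\<close>

lemma dyad_eq_outer:
  "dyad m s = (m * (1 + s\<^sup>2)) *\<^sub>R
    ((vector [1 / sqrt (1 + s\<^sup>2), s * (1 / sqrt (1 + s\<^sup>2))] :: real^2) \<otimes>\<^sub>o (vector [1 / sqrt (1 + s\<^sup>2), s * (1 / sqrt (1 + s\<^sup>2))] :: real^2))"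
proof -
  have p: "1 + s\<^sup>2 > 0" by (simp add: add_pos_nonneg)
  define q where "q = 1 / sqrt (1 + s\<^sup>2)"
  have q2: "(1 + s\<^sup>2) * (q * q) = 1" using p by (simp add: q_def)
  have e: "m * (1 + s\<^sup>2) * (q * q) = m" using q2 by (simp add: mult.assoc)
  have "m * (1 + s\<^sup>2) * (q * (s * q)) = m * (1 + s\<^sup>2) * (q * q) * s"
    "m * (1 + s\<^sup>2) * (s * q * q) = m * (1 + s\<^sup>2) * (q * q) * s"
    "m * (1 + s\<^sup>2) * (s * q * (s * q)) = m * (1 + s\<^sup>2) * (q * q) * s\<^sup>2"
    by (simp_all only: power2_eq_square mult.commute mult.left_commute mult.assoc)
  then show ?thesis
    unfolding q_def[symmetric] using e by (simp add: vec_eq_iff forall_2 outer_def) (elim disjE; simp)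
qed

lemma negligible_of_AE_01:
  assumes "AE t in lebesgue_on I01. P t"
  shows "negligible {t\<in>{0..1}. \<not> P t}"
proof -
  have "AE t in lebesgue. t \<in> I01 \<longrightarrow> P t" using assms by (simp add: AE_restrict_space_iff)
  then obtain N where N: "N \<in> null_sets lebesgue" "{t\<in>space lebesgue. \<not> (t \<in> I01 \<longrightarrow> P t)} \<subseteq> N"
    unfolding eventually_ae_filter by blast
  have "{t\<in>{0..1}. \<not> P t} \<subseteq> N \<union> {0, 1}"
  proof
    fix t assume t: "t \<in> {t\<in>{0..1}. \<not> P t}"
    show "t \<in> N \<union> {0, 1}"
    proof (cases "t = 0 \<or> t = 1")
      case False
      then have "t \<in> I01" using t by auto
      then show ?thesis using N(2) t by auto
    qed auto
  qed
  moreover have "negligible (N \<union> {0, 1})"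
    using N(1) by (intro negligible_Un) (simp_all add: negligible_iff_null_sets[symmetric])
  ultimately show ?thesis using negligible_subset by blast
qed

theorem proposition3p1:
  fixes A0 :: "real \<Rightarrow> real^3^3" and M :: "real \<Rightarrow> real^2^2"
  assumes "A0 \<in> L2 frakA" and "nondegenerate A0"
    and "M \<in> L2 Sym2"
    and "emeasure lebesgue {t\<in>I01. M t $ 1 $ 1 \<noteq> 0} > 0"
    and "admissible A0 (\<lambda>t. A_of (M t))"
  shows "\<exists>(lam :: nat \<Rightarrow> real \<Rightarrow> real) (p :: nat \<Rightarrow> real \<Rightarrow> real^2) (Mn :: nat \<Rightarrow> real \<Rightarrow> real^2^2).
     (\<forall>n. smooth_cl (lam n)) \<and>
     (\<forall>n. smooth_cl (p n) \<and> (\<forall>t\<in>{0..1}. p n t \<in> sphere 0 1)) \<and>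
     (\<forall>n t. Mn n t = lam n t *\<^sub>R (p n t \<otimes>\<^sub>o p n t)) \<and>
     (\<forall>n. (\<forall>t\<in>{0..1}. p n t \<bullet> axis 1 1 > 0) \<and>
          (\<exists>U. open U \<and> {0, 1} \<subseteq> U \<and> (\<forall>t\<in>U \<inter> {0..1}. p n t = axis 1 1)) \<and>
          admissible A0 (\<lambda>t. A_of (Mn n t))) \<and>
     weakly_L2 Sym2 Mn M \<and>
     (\<lambda>n. calF (Mn n)) \<longlonglongrightarrow> calF M"
proof -
  have M: "sqint M" and sym: "negligible {t\<in>{0..1}. M t \<notin> Sym2}"
    using assms(3) negligible_of_AE_01[of "\<lambda>t. M t \<in> Sym2"] by (simp_all add: L2_iff)
  have S: "\<not> negligible {t\<in>{0..1}. M t $ 1 $ 1 \<noteq> 0}"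
  proof
    assume "negligible {t\<in>{0..1}. M t $ 1 $ 1 \<noteq> 0}"
    then have "negligible {t\<in>I01. M t $ 1 $ 1 \<noteq> 0}" by (rule negligible_subset) auto
    then have "emeasure lebesgue {t\<in>I01. M t $ 1 $ 1 \<noteq> 0} = 0"
      unfolding negligible_iff_null_sets by (rule null_setsD1)
    then show False using assms(4) by (metis less_irrefl)
  qed
  define ok where "ok = (\<lambda>n m s. smooth_cl m \<and> smooth0 s \<and> fr (\<lambda>t. dyad (m t) (s t)) 1 = fr M 1
    \<and> Gam (\<lambda>t. A_of (dyad (m t) (s t))) = Gam (\<lambda>t. A_of (M t))
    \<and> (\<forall>t\<in>{0..1}. norm (integral {0..t} (\<lambda>t. dyad (m t) (s t) - M t)) \<le> 1 / real (Suc n))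
    \<and> \<bar>integral {0..1} (\<lambda>t. nuc (dyad (m t) (s t))) - integral {0..1} (\<lambda>t. nuc (M t))\<bar> \<le> 1 / real (Suc n))"
  have "\<exists>m s. ok n m s" for n
  proof -
    have "1 / real (Suc n) > 0" by simp
    then show ?thesis
    proof (rule admissible_dyad_approximation[OF M sym S])
      fix m s assume "smooth_cl m" "smooth0 s" "fr (\<lambda>t. dyad (m t) (s t)) 1 = fr M 1"
        "Gam (\<lambda>t. A_of (dyad (m t) (s t))) = Gam (\<lambda>t. A_of (M t))"
        "\<And>t. t \<in> {0..1} \<Longrightarrow> norm (integral {0..t} (\<lambda>t. dyad (m t) (s t) - M t)) \<le> 1 / real (Suc n)"
        "\<bar>integral {0..1} (\<lambda>t. nuc (dyad (m t) (s t))) - integral {0..1} (\<lambda>t. nuc (M t))\<bar> \<le> 1 / real (Suc n)"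
      then show ?thesis
        unfolding ok_def by (intro exI[of _ m] exI[of _ s] conjI ballI)
    qed
  qed
  then obtain m s where ok: "\<And>n. ok n (m n) (s n)" by metis
  have sm: "smooth_cl (m n)" "smooth0 (s n)" and fr1: "fr (\<lambda>t. dyad (m n t) (s n t)) 1 = fr M 1"
    and gam: "Gam (\<lambda>t. A_of (dyad (m n t) (s n t))) = Gam (\<lambda>t. A_of (M t))"
    and prim: "\<And>t. t \<in> {0..1} \<Longrightarrow> norm (integral {0..t} (\<lambda>t. dyad (m n t) (s n t) - M t)) \<le> 1 / real (Suc n)"
    and nuc: "\<bar>integral {0..1} (\<lambda>t. nuc (dyad (m n t) (s n t))) - integral {0..1} (\<lambda>t. nuc (M t))\<bar> \<le> 1 / real (Suc n)" for n
    using ok[of n] unfolding ok_def by auto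
  have ss: "smooth_cl (s n)" for n using sm(2)[of n] by (simp add: smooth0_def)
  define F where "F = (\<lambda>n t. dyad (m n t) (s n t))"
  have Fs: "sqint (F n)" for n
    unfolding F_def dyad_def by (intro sqint_continuous continuous_intros smooth_cl_continuous sm ss)
  define p :: "nat \<Rightarrow> real \<Rightarrow> real^2"
    where "p = (\<lambda>n t. vector [1 / sqrt (1 + (s n t)\<^sup>2), s n t * (1 / sqrt (1 + (s n t)\<^sup>2))])"
  define lam where "lam = (\<lambda>n t. m n t * (1 + (s n t)\<^sup>2))"
  have lim: "(\<lambda>n. 1 / real (Suc n)) \<longlonglongrightarrow> 0" using LIMSEQ_inverse_real_of_nat by (simp add: inverse_eq_divide)
  have Fsym: "F n t \<in> Sym2" for n t by (simp add: F_def Sym2_iff)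
  have nucF: "calF (F n) = integral {0..1} (\<lambda>t. nuc (F n t))" for n by (rule calF_eq[OF Fs])
  show ?thesis
  proof (intro exI[of _ lam] exI[of _ p] exI[of _ F] conjI allI ballI)
    fix n
    show "smooth_cl (lam n)"
      unfolding lam_def power2_eq_square by (intro smooth_cl_mult smooth_cl_add smooth_cl_const sm ss)
    show "smooth_cl (p n)"
      unfolding p_def by (intro smooth_cl_vec2 smooth_cl_mult smooth_cl_inverse_sqrt ss)
    have pos: "1 + (s n t)\<^sup>2 > 0" for t by (simp add: add_pos_nonneg)
    show "p n t \<in> sphere 0 1" for t
    proof -
      define q where "q = 1 / sqrt (1 + (s n t)\<^sup>2)"
      have "p n t = vector [q, s n t * q]" by (simp add: p_def q_def)
      then have "p n t \<bullet> p n t = (1 + (s n t)\<^sup>2) * q\<^sup>2"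
        by (simp add: inner_vec_def sum_2 power2_eq_square algebra_simps)
      also have "\<dots> = 1" using pos[of t] by (simp add: q_def power_divide)
      finally show ?thesis by (simp add: norm_eq_1)
    qed
    show "F n t = lam n t *\<^sub>R (p n t \<otimes>\<^sub>o p n t)" for t
      unfolding F_def lam_def p_def by (rule dyad_eq_outer)
    show "p n t \<bullet> axis 1 1 > 0" for t
      using pos[of t] by (simp add: p_def inner_axis)
    obtain U where "open U" "{0, 1} \<subseteq> U" "\<forall>t\<in>U \<inter> {0..1}. s n t = 0" using sm(2)[of n] by (auto simp: smooth0_def)
    then show "\<exists>U. open U \<and> {0, 1} \<subseteq> U \<and> (\<forall>t\<in>U \<inter> {0..1}. p n t = axis 1 1)"
      by (intro exI[of _ U]) (simp add: p_def vec_eq_iff forall_2 axis_def)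
    show "admissible A0 (\<lambda>t. A_of (F n t))"
      unfolding admissible_def
    proof (intro conjI)
      show "(\<lambda>t. A_of (F n t)) \<in> L2 frakA"
        unfolding L2_iff by (intro conjI sqint_linear[OF Fs bounded_linear_A_of]) (simp add: A_of_char)
      show "frame (\<lambda>t. A_of (F n t)) 1 = frame A0 1"
        using fr1[of n] assms(5) by (simp add: admissible_def fr_def F_def)
      show "Gam (\<lambda>t. A_of (F n t)) = Gam A0"
        using gam[of n] assms(5) by (simp add: admissible_def F_def)
    qed
  next
    show "weakly_L2 Sym2 F M"
      unfolding weakly_L2_def
    proof (intro conjI allI ballI)
      show "F n \<in> L2 Sym2" for n by (simp add: L2_iff Fs Fsym)
      show "M \<in> L2 Sym2" by (rule assms)
      fix \<phi> :: "real \<Rightarrow> real^2^2" assume "\<phi> \<in> L2 Sym2"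
      then have \<phi>: "sqint \<phi>" by (simp add: L2_iff)
      have "(\<lambda>n. integral {0..1} (\<lambda>t. F n t \<bullet> \<phi> t)) \<longlonglongrightarrow> integral {0..1} (\<lambda>t. M t \<bullet> \<phi> t)"
      proof (rule weak_convergence_matrix[OF Fs _ M _ lim \<phi>])
        \<comment> \<open>On dyads \<open>nuc\<close> is the squared norm, so the energy estimate
          itself supplies the L2 bound for weak convergence.\<close>
        show "integral {0..1} (\<lambda>t. (norm (F n t))\<^sup>2) \<le> integral {0..1} (\<lambda>t. nuc (M t)) + 1" for n
        proof -
          have "1 / real (Suc n) \<le> 1" by simp
          then have "integral {0..1} (\<lambda>t. nuc (F n t)) \<le> integral {0..1} (\<lambda>t. nuc (M t)) + 1"
            using nuc[of n] unfolding F_def by linarith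
          then show ?thesis by (simp add: F_def nuc_dyad)
        qed
        show "norm (integral {0..t} (\<lambda>t. F n t - M t)) \<le> 1 / real (Suc n)" if "t \<in> {0..1}" for n t
          unfolding F_def by (rule prim[OF that])
      qed
      then show "(\<lambda>n. LINT t|lebesgue_on I01. F n t \<bullet> \<phi> t) \<longlonglongrightarrow> (LINT t|lebesgue_on I01. M t \<bullet> \<phi> t)"
        using LINT_01[OF sqint_integrable_products[OF Fs \<phi>], of 1] LINT_01[OF sqint_integrable_products[OF M \<phi>], of 1] by simp
    qed
    have "(\<lambda>n. calF (F n) - calF M) \<longlonglongrightarrow> 0"
    proof (rule Lim_null_comparison[OF always_eventually lim], rule allI)
      show "norm (calF (F n) - calF M) \<le> 1 / real (Suc n)" for n
        unfolding nucF calF_eq[OF M] real_norm_def using nuc[of n] unfolding F_def .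
    qed
    then show "(\<lambda>n. calF (F n)) \<longlonglongrightarrow> calF M" by (rule LIM_zero_cancel)
  qed
qed

end
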